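(* Let $\Omega\subset\mathbb{R}^3$ be a bounded open set whose boundary $\Gamma=\partial\Omega$ is a $C^2$ surface, let $\epsilon>0$ be small, and let $\mu\in\mathbb{R}$. Let $L=L(x,q,\mathbf{p}):\Gamma\times\mathbb{R}\times\mathbb{R}^3\to\mathbb{R}$ be twice continuously differentiable and satisfy $L_{\mathbf{p}}(x,q,\mathbf{t})\cdot\mathbf{n}(x)=0$ for any vector $\mathbf{t}$ tangent to $\Gamma$ at $x$. Let $u$ be a $C^2$ solution of the Euler--Lagrange equation $\delta I_\Gamma[u]=0$ of the surface energy, i.e. $$-\nabla_\Gamma\cdot L_{\mathbf{p}}(x,u,\nabla_\Gamma u)+L_q(x,u,\nabla_\Gamma u)=0\quad\text{for all } x\in\Gamma .$$ Then its normal extension $\bar u:=u\circ P_\Gamma$ is a solution of the Euler--Lagrange equation $\delta\tilde I_{T_\epsilon}[\bar u]=0$ of the extended energy, i.e. $$-\nabla\cdot\bigl(J A\,L_{\mathbf{p}}(P_\Gamma z,\bar u,A\nabla\bar u)\bigr)+J\,L_q(P_\Gamma z,\bar u,A\nabla\bar u)=0\quad\text{in } T_\epsilon,$$ and $\bar u$ satisfies the Neumann boundary condition $\frac{\partial\bar u}{\partial n}=0$ on $\partial T_\epsilon$.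
   Context: Notation. $d_\Gamma$ is the signed distance function to $\Gamma$ (negative in $\Omega$, positive outside $\overline{\Omega}$). $T_\epsilon=\{z\in\mathbb{R}^3:|d_\Gamma(z)|<\epsilon\}$. $P_\Gamma z$ is the closest point of $\Gamma$ to $z$; $\epsilon$ is taken small enough (in particular $\epsilon\kappa_\infty<1$, where $\kappa_\infty$ is an upper bound of the curvatures of $\Gamma$) that $P_\Gamma$ is well defined on $T_\epsilon$. $\mathbf{n}(z)=\nabla d_\Gamma(z)$, which equals the outward unit normal of $\Gamma$ at $P_\Gamma z$, and $\frac{\partial v}{\partial n}=\mathbf{n}\cdot\nabla v$. $\nabla_\Gamma$ and $\nabla_\Gamma\cdot$ are the surface gradient and surface divergence on $\Gamma$; $\nabla_\Gamma u$ is viewed as a vector in $\mathbb{R}^3$ tangent to $\Gamma$. For $z\in T_\epsilon$ let $\mathbf{t}_1,\mathbf{t}_2$ be orthonormal principal directions of $\Gamma$ at $P_\Gamma z$ with principal curvatures $\kappa_1,\kappa_2$ (signed so that $\partial_{\mathbf{t}_i}\mathbf{n}=\kappa_i\mathbf{t}_i$ on $\Gamma$). Put $\sigma_i(z)=(1+d_\Gamma(z)\kappa_i(P_\Gamma z))^{-1}$; these are the two largest singular values of $DP_\Gamma(z)$. Set $J(z)=\sigma_1(z)\sigma_2(z)$ and $$A(z)=A(z;\mu)=\sigma_1^{-1}\,\mathbf{t}_1\otimes\mathbf{t}_1+\sigma_2^{-1}\,\mathbf{t}_2\otimes\mathbf{t}_2+\mu\,\mathbf{n}\otimes\mathbf{n}.$$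 $L_q$ and $L_{\mathbf{p}}$ denote the partial derivative of $L$ in $q$ and the gradient of $L$ in $\mathbf{p}$. The energies are $$I_\Gamma[u]=\int_\Gamma L(x,u,\nabla_\Gamma u)\,dS,\qquad \tilde I_{T_\epsilon}[v]=\frac1{2\epsilon}\int_{T_\epsilon}L(P_\Gamma z,v(z),A(z)\nabla v(z))\,J(z)\,dz .$$ $\delta I_\Gamma[u]=0$ and $\delta\tilde I_{T_\epsilon}[v]=0$ denote the corresponding Euler--Lagrange equations, displayed in the claim.
   Formalization: As Γ is only C², the field J A L_p need not be differentiable, so the extended Euler–Lagrange equation is stated with the distributional divergence on T_ε, which equals the classical divergence at every point where the field is differentiable (everywhere if Γ is C³). *)

theory Defs
  imports "HOL-Analysis.Analysis"
begin

section \<open>Regularity classes and differential operators\<close>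

definition C1_on :: "'a::euclidean_space set \<Rightarrow> ('a \<Rightarrow> real) \<Rightarrow> bool" where
  "C1_on U f \<longleftrightarrow> (\<exists>f' :: 'a \<Rightarrow> 'a \<Rightarrow>\<^sub>L real.
     (\<forall>x\<in>U. (f has_derivative blinfun_apply (f' x)) (at x)) \<and> continuous_on U f')"

definition C2_on :: "'a::euclidean_space set \<Rightarrow> ('a \<Rightarrow> real) \<Rightarrow> bool" where
  "C2_on U f \<longleftrightarrow> (\<exists>(f' :: 'a \<Rightarrow> 'a \<Rightarrow>\<^sub>L real) (f'' :: 'a \<Rightarrow> 'a \<Rightarrow>\<^sub>L ('a \<Rightarrow>\<^sub>L real)).
     (\<forall>x\<in>U. (f has_derivative blinfun_apply (f' x)) (at x)) \<and>
     (\<forall>x\<in>U. (f' has_derivative blinfun_apply (f'' x)) (at x)) \<and> continuous_on U f'')"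

text \<open>A function on an arbitrary subset \<open>M\<close> (here an embedded \<open>C\<^sup>2\<close> manifold) is of class
  \<open>C\<^sup>2\<close> if it is locally the restriction of a \<open>C\<^sup>2\<close> function of the ambient space.
  Only the values of the function on \<open>M\<close> matter.\<close>

definition C2_on_subset :: "'a::euclidean_space set \<Rightarrow> ('a \<Rightarrow> real) \<Rightarrow> bool" where
  "C2_on_subset M f \<longleftrightarrow> (\<forall>x\<in>M. \<exists>U g. open U \<and> x \<in> U \<and> C2_on U g \<and> (\<forall>y\<in>M \<inter> U. f y = g y))"

definition grad :: "('a::euclidean_space \<Rightarrow> real) \<Rightarrow> 'a \<Rightarrow> 'a" where
  "grad f x = (THE D. GDERIV f x :> D)"

definition divergence :: "(real^3 \<Rightarrow> real^3) \<Rightarrow> real^3 \<Rightarrow> real" where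
  "divergence F z = trace (jacobian F (at z))"

text \<open>\<open>g\<close> is the divergence of \<open>F\<close> on the open set \<open>S\<close> in the sense of distributions. Test
  functions are taken from the class of compactly supported \<open>C\<^sup>1\<close> functions, which contains
  the compactly supported smooth ones.\<close>

definition test_function :: "(real^3) set \<Rightarrow> (real^3 \<Rightarrow> real) \<Rightarrow> bool" where
  "test_function S \<phi> \<longleftrightarrow> C1_on UNIV \<phi> \<and> compact (closure {z. \<phi> z \<noteq> 0}) \<and> closure {z. \<phi> z \<noteq> 0} \<subseteq> S"

definition has_weak_divergence_on ::
  "(real^3 \<Rightarrow> real^3) \<Rightarrow> (real^3 \<Rightarrow> real) \<Rightarrow> (real^3) set \<Rightarrow> bool" where
  "has_weak_divergence_on F g S \<longleftrightarrow> (\<forall>\<phi>. test_function S \<phi> \<longrightarrow>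
     (\<lambda>z. F z \<bullet> grad \<phi> z) absolutely_integrable_on S \<and>
     (\<lambda>z. g z * \<phi> z) absolutely_integrable_on S \<and>
     integral S (\<lambda>z. F z \<bullet> grad \<phi> z) = - integral S (\<lambda>z. g z * \<phi> z))"

definition tensor :: "real^3 \<Rightarrow> real^3 \<Rightarrow> real^3^3"  (infixl "\<otimes>\<^sub>v" 75) where
  "a \<otimes>\<^sub>v b = (\<chi> i j. a $ i * b $ j)"


section \<open>Geometry of the boundary\<close>

text \<open>\<open>C\<^sup>2\<close> boundary via local defining functions. The set lies locally on one side of its
  boundary, so that an outward unit normal exists everywhere.\<close>

definition C2_boundary :: "(real^3) set \<Rightarrow> bool" where
  "C2_boundary \<Omega> \<longleftrightarrow> (\<forall>x\<in>frontier \<Omega>. \<exists>U \<psi>. open U \<and> x \<in> U \<and> C2_on U \<psi> \<and>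
     (\<forall>z\<in>U. grad \<psi> z \<noteq> 0) \<and>
     \<Omega> \<inter> U = {z\<in>U. \<psi> z < 0} \<and> frontier \<Omega> \<inter> U = {z\<in>U. \<psi> z = 0})"

definition signed_dist :: "(real^3) set \<Rightarrow> real^3 \<Rightarrow> real" where
  "signed_dist \<Omega> z = (if z \<in> \<Omega> then - infdist z (frontier \<Omega>) else infdist z (frontier \<Omega>))"

definition tube :: "(real^3) set \<Rightarrow> real \<Rightarrow> (real^3) set" where
  "tube \<Omega> \<epsilon> = {z. \<bar>signed_dist \<Omega> z\<bar> < \<epsilon>}"

definition proj :: "(real^3) set \<Rightarrow> real^3 \<Rightarrow> real^3" where
  "proj \<Omega> z = closest_point (frontier \<Omega>) z"

definition has_unique_closest_point :: "(real^3) set \<Rightarrow> real^3 \<Rightarrow> bool" where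
  "has_unique_closest_point \<Gamma> z \<longleftrightarrow> (\<exists>!x. x \<in> \<Gamma> \<and> (\<forall>y\<in>\<Gamma>. dist z x \<le> dist z y))"

definition normal :: "(real^3) set \<Rightarrow> real^3 \<Rightarrow> real^3" where
  "normal \<Omega> z = grad (signed_dist \<Omega>) z"

definition normal_deriv :: "(real^3) set \<Rightarrow> (real^3 \<Rightarrow> real) \<Rightarrow> real^3 \<Rightarrow> real" where
  "normal_deriv \<Omega> v z = normal \<Omega> z \<bullet> grad v z"

text \<open>The surface gradient is the tangent vector representing the derivative of \<open>u\<close> along
  \<open>\<Gamma>\<close>; it depends only on the values of \<open>u\<close> on \<open>\<Gamma>\<close>.\<close>

definition surf_grad :: "(real^3) set \<Rightarrow> (real^3 \<Rightarrow> real) \<Rightarrow> real^3 \<Rightarrow> real^3" where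
  "surf_grad \<Omega> u x = (THE g. g \<bullet> normal \<Omega> x = 0 \<and>
     (u has_derivative (\<lambda>h. g \<bullet> h)) (at x within frontier \<Omega>))"

definition surf_div :: "(real^3) set \<Rightarrow> (real^3 \<Rightarrow> real^3) \<Rightarrow> real^3 \<Rightarrow> real" where
  "surf_div \<Omega> F x = (\<Sum>i\<in>UNIV. surf_grad \<Omega> (\<lambda>y. F y $ i) x $ i)"

definition principal_frame ::
  "(real^3) set \<Rightarrow> real^3 \<Rightarrow> real^3 \<Rightarrow> real^3 \<Rightarrow> real \<Rightarrow> real \<Rightarrow> bool" where
  "principal_frame \<Omega> x t\<^sub>1 t\<^sub>2 \<kappa>\<^sub>1 \<kappa>\<^sub>2 \<longleftrightarrow>
     norm t\<^sub>1 = 1 \<and> norm t\<^sub>2 = 1 \<and> t\<^sub>1 \<bullet> t\<^sub>2 = 0 \<and>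
     t\<^sub>1 \<bullet> normal \<Omega> x = 0 \<and> t\<^sub>2 \<bullet> normal \<Omega> x = 0 \<and>
     ((\<lambda>s. normal \<Omega> (x + s *\<^sub>R t\<^sub>1)) has_vector_derivative \<kappa>\<^sub>1 *\<^sub>R t\<^sub>1) (at 0) \<and>
     ((\<lambda>s. normal \<Omega> (x + s *\<^sub>R t\<^sub>2)) has_vector_derivative \<kappa>\<^sub>2 *\<^sub>R t\<^sub>2) (at 0)"

text \<open>Below, \<open>t\<^sub>i\<close> and \<open>\<kappa>\<^sub>i\<close> are functions of the point of \<open>\<Gamma>\<close>; no regularity of the choice of
  the frame is assumed, since \<open>J\<close> and \<open>A\<close> do not depend on it.\<close>

definition sigma :: "(real^3) set \<Rightarrow> (real^3 \<Rightarrow> real) \<Rightarrow> real^3 \<Rightarrow> real" where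
  "sigma \<Omega> \<kappa> z = inverse (1 + signed_dist \<Omega> z * \<kappa> (proj \<Omega> z))"

definition Jfac :: "(real^3) set \<Rightarrow> (real^3 \<Rightarrow> real) \<Rightarrow> (real^3 \<Rightarrow> real) \<Rightarrow> real^3 \<Rightarrow> real" where
  "Jfac \<Omega> \<kappa>\<^sub>1 \<kappa>\<^sub>2 z = sigma \<Omega> \<kappa>\<^sub>1 z * sigma \<Omega> \<kappa>\<^sub>2 z"

definition Amat :: "(real^3) set \<Rightarrow> (real^3 \<Rightarrow> real^3) \<Rightarrow> (real^3 \<Rightarrow> real^3) \<Rightarrow>
    (real^3 \<Rightarrow> real) \<Rightarrow> (real^3 \<Rightarrow> real) \<Rightarrow> real \<Rightarrow> real^3 \<Rightarrow> real^3^3" where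
  "Amat \<Omega> t\<^sub>1 t\<^sub>2 \<kappa>\<^sub>1 \<kappa>\<^sub>2 \<mu> z =
     inverse (sigma \<Omega> \<kappa>\<^sub>1 z) *\<^sub>R (t\<^sub>1 (proj \<Omega> z) \<otimes>\<^sub>v t\<^sub>1 (proj \<Omega> z)) +
     inverse (sigma \<Omega> \<kappa>\<^sub>2 z) *\<^sub>R (t\<^sub>2 (proj \<Omega> z) \<otimes>\<^sub>v t\<^sub>2 (proj \<Omega> z)) +
     \<mu> *\<^sub>R (normal \<Omega> z \<otimes>\<^sub>v normal \<Omega> z)"


section \<open>Lagrangians and the Euler--Lagrange equations\<close>

type_synonym lagrangian = "real^3 \<Rightarrow> real \<Rightarrow> real^3 \<Rightarrow> real"

definition L_q :: "lagrangian \<Rightarrow> real^3 \<Rightarrow> real \<Rightarrow> real^3 \<Rightarrow> real" where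
  "L_q L x q p = deriv (\<lambda>r. L x r p) q"

definition L_p :: "lagrangian \<Rightarrow> real^3 \<Rightarrow> real \<Rightarrow> real^3 \<Rightarrow> real^3" where
  "L_p L x q p = grad (L x q) p"

definition EL_surface :: "(real^3) set \<Rightarrow> lagrangian \<Rightarrow> (real^3 \<Rightarrow> real) \<Rightarrow> bool" where
  "EL_surface \<Omega> L u \<longleftrightarrow> (\<forall>x\<in>frontier \<Omega>.
     - surf_div \<Omega> (\<lambda>y. L_p L y (u y) (surf_grad \<Omega> u y)) x + L_q L x (u x) (surf_grad \<Omega> u x) = 0)"

text \<open>The two terms \<open>J A L_p(P z, v, A \<nabla>v)\<close> and \<open>J L_q(P z, v, A \<nabla>v)\<close> of the Euler--Lagrange
  equation of the extended energy.\<close>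

definition ext_flux :: "(real^3) set \<Rightarrow> (real^3 \<Rightarrow> real^3) \<Rightarrow> (real^3 \<Rightarrow> real^3) \<Rightarrow>
    (real^3 \<Rightarrow> real) \<Rightarrow> (real^3 \<Rightarrow> real) \<Rightarrow> real \<Rightarrow> lagrangian \<Rightarrow> (real^3 \<Rightarrow> real) \<Rightarrow> real^3 \<Rightarrow> real^3" where
  "ext_flux \<Omega> t\<^sub>1 t\<^sub>2 \<kappa>\<^sub>1 \<kappa>\<^sub>2 \<mu> L v z =
     Jfac \<Omega> \<kappa>\<^sub>1 \<kappa>\<^sub>2 z *\<^sub>R (Amat \<Omega> t\<^sub>1 t\<^sub>2 \<kappa>\<^sub>1 \<kappa>\<^sub>2 \<mu> z *v
       L_p L (proj \<Omega> z) (v z) (Amat \<Omega> t\<^sub>1 t\<^sub>2 \<kappa>\<^sub>1 \<kappa>\<^sub>2 \<mu> z *v grad v z))"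

definition ext_source :: "(real^3) set \<Rightarrow> (real^3 \<Rightarrow> real^3) \<Rightarrow> (real^3 \<Rightarrow> real^3) \<Rightarrow>
    (real^3 \<Rightarrow> real) \<Rightarrow> (real^3 \<Rightarrow> real) \<Rightarrow> real \<Rightarrow> lagrangian \<Rightarrow> (real^3 \<Rightarrow> real) \<Rightarrow> real^3 \<Rightarrow> real" where
  "ext_source \<Omega> t\<^sub>1 t\<^sub>2 \<kappa>\<^sub>1 \<kappa>\<^sub>2 \<mu> L v z =
     Jfac \<Omega> \<kappa>\<^sub>1 \<kappa>\<^sub>2 z *
       L_q L (proj \<Omega> z) (v z) (Amat \<Omega> t\<^sub>1 t\<^sub>2 \<kappa>\<^sub>1 \<kappa>\<^sub>2 \<mu> z *v grad v z)"

text \<open>For a boundary that is merely \<open>C\<^sup>2\<close> the principal curvatures, hence \<open>J\<close>, \<open>A\<close> and the flux,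
  are only continuous, so the flux need not have classical partial derivatives. Its divergence
  \<open>g\<close> is therefore the distributional one, and it is moreover required to be the classical
  divergence at every point where the flux is differentiable (which is every point if the boundary
  is \<open>C\<^sup>3\<close>).\<close>

definition EL_extended :: "(real^3) set \<Rightarrow> (real^3 \<Rightarrow> real^3) \<Rightarrow> (real^3 \<Rightarrow> real^3) \<Rightarrow>
    (real^3 \<Rightarrow> real) \<Rightarrow> (real^3 \<Rightarrow> real) \<Rightarrow> real \<Rightarrow> lagrangian \<Rightarrow> real \<Rightarrow> (real^3 \<Rightarrow> real) \<Rightarrow> bool" where
  "EL_extended \<Omega> t\<^sub>1 t\<^sub>2 \<kappa>\<^sub>1 \<kappa>\<^sub>2 \<mu> L \<epsilon> v \<longleftrightarrow> (\<exists>g.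
     has_weak_divergence_on (ext_flux \<Omega> t\<^sub>1 t\<^sub>2 \<kappa>\<^sub>1 \<kappa>\<^sub>2 \<mu> L v) g (tube \<Omega> \<epsilon>) \<and>
     (\<forall>z\<in>tube \<Omega> \<epsilon>. ext_flux \<Omega> t\<^sub>1 t\<^sub>2 \<kappa>\<^sub>1 \<kappa>\<^sub>2 \<mu> L v differentiable (at z) \<longrightarrow>
        divergence (ext_flux \<Omega> t\<^sub>1 t\<^sub>2 \<kappa>\<^sub>1 \<kappa>\<^sub>2 \<mu> L v) z = g z) \<and>
     (\<forall>z\<in>tube \<Omega> \<epsilon>. - g z + ext_source \<Omega> t\<^sub>1 t\<^sub>2 \<kappa>\<^sub>1 \<kappa>\<^sub>2 \<mu> L v z = 0))"

end

theory Submission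
  imports Defs
begin

text \<open>
  Write \<open>P\<close>, \<open>d\<close>, \<open>n\<close> for the projection, the signed distance and the normal. The normal
  extension of \<open>u\<close> satisfies \<open>A \<nabla>(u \<circ> P) = (\<nabla>\<^sub>\<Gamma> u) \<circ> P\<close>, so the flux is \<open>J A W\<close> with the tangential
  \<open>C\<^sup>1\<close> field \<open>W = L\<^sub>p(x, u, \<nabla>\<^sub>\<Gamma> u) \<circ> P\<close>. Although \<open>J A\<close> is merely continuous, the flux equals
  \<open>\<Sum>\<^sub>p V\<^sub>p (\<nabla>P\<^sub>p \<times> n)\<close> with \<open>V = n \<times> W\<close>, in which only \<open>C\<^sup>1\<close> functions are differentiated. Since
  \<open>n = \<nabla>d\<close> is \<open>C\<^sup>1\<close> and curl free, \<open>\<nabla>P\<^sub>p \<times> n\<close> is weakly divergence free, and the weak divergence of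
  the flux is \<open>\<Sum>\<^sub>p \<nabla>V\<^sub>p \<bullet> (\<nabla>P\<^sub>p \<times> n)\<close>. In a principal frame this equals \<open>J (\<nabla>\<^sub>\<Gamma> \<bullet> W) \<circ> P\<close>,
  which is \<open>J L\<^sub>q\<close> by the surface equation.
\<close>

section \<open>Continuously differentiable maps\<close>

text \<open>On the tangent plane \<open>J A\<close> acts as diag(\<open>\<sigma>\<^sub>2\<close>,
  \<open>\<sigma>\<^sub>1\<close>), the cofactor matrix of the derivative of \<open>P\<close>. In
  two dimensions the cofactor matrix of M is - R M R, with R the rotation by a right angle, here v
  \<mapsto> n \<times> v. This is the origin of \<open>V\<close> and of the fields \<nabla>P_p
  \<times> n, whose vanishing weak divergence is a Piola identity. The usual proof of such an
  identity differentiates \<open>P\<close> twice, which a C2 boundary does not permit; commuting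
  second derivatives are replaced by \<open>weak_symmetry\<close>, which rests on translation
  invariance of the integral. That \<open>P\<close> is C1 at all is a separate task, since
  \<open>P\<close> is given as a closest point and the frame may be discontinuous. It is read off
  the equation P z + d z \<nu>(P z) = z for a local unit normal field \<nu>, first near \<Gamma> and
  only then, with the curvatures identified, on the closed tube. Finally, a weak divergence is
  determined only almost everywhere, whereas the claim concerns every point at which the flux is
  differentiable; continuity of the source term closes this gap.\<close>

lemma grad_eqI:
  fixes f :: "'a::euclidean_space \<Rightarrow> real"
  assumes "(f has_derivative (\<lambda>h. h \<bullet> D)) (at x)"
  shows "grad f x = D"
  unfolding grad_def
proof (rule the_equality)
  show "GDERIV f x :> D"
    using assms by (simp add: gderiv_def)
next
  fix E assume "GDERIV f x :> E"
  then have "(\<lambda>h. h \<bullet> E) = (\<lambda>h. h \<bullet> D)"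
    using has_derivative_unique assms by (auto simp: gderiv_def)
  then show "E = D"
    by (metis inner_commute vector_eq_ldot)
qed

lemma has_derivative_grad:
  fixes f :: "'a::euclidean_space \<Rightarrow> real"
  assumes "f differentiable (at x)"
  shows "(f has_derivative (\<lambda>h. h \<bullet> grad f x)) (at x)"
proof -
  obtain f' where f': "(f has_derivative f') (at x)"
    using assms by (auto simp: differentiable_def)
  interpret f': bounded_linear f'
    using f' by (rule has_derivative_bounded_linear)
  define D where "D = (\<Sum>b\<in>Basis. f' b *\<^sub>R b)"
  have "f' h = h \<bullet> D" for h
  proof -
    have "f' h = f' (\<Sum>b\<in>Basis. (h \<bullet> b) *\<^sub>R b)"
      by (simp add: euclidean_representation)
    also have "\<dots> = h \<bullet> D"
      by (simp add: f'.sum f'.scaleR D_def inner_sum_right mult.commute)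
    finally show ?thesis .
  qed
  then have "f' = (\<lambda>h. h \<bullet> D)" by auto
  then show ?thesis
    using f' grad_eqI by metis
qed

definition C1_map :: "'a::euclidean_space set \<Rightarrow> ('a \<Rightarrow> 'b::euclidean_space) \<Rightarrow> bool" where
  "C1_map U f \<longleftrightarrow> (\<exists>f' :: 'a \<Rightarrow> 'a \<Rightarrow>\<^sub>L 'b.
     (\<forall>x\<in>U. (f has_derivative blinfun_apply (f' x)) (at x)) \<and> continuous_on U f')"

lemma C1_on_iff: "C1_on U f \<longleftrightarrow> C1_map U f"
  by (simp add: C1_on_def C1_map_def)

text \<open>In finite dimension, continuity of x \<mapsto> \<open>f' x h\<close> for each fixed
  \<open>h\<close> already gives continuity in operator norm, so derivatives can be handled as plain
  functions.\<close>

lemma C1_mapI: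
  fixes f :: "'a::euclidean_space \<Rightarrow> 'b::euclidean_space"
  assumes "\<And>x. x \<in> U \<Longrightarrow> (f has_derivative f' x) (at x)"
    and "\<And>h. continuous_on U (\<lambda>x. f' x h)"
  shows "C1_map U f"
  unfolding C1_map_def
proof (intro exI conjI ballI)
  fix x assume "x \<in> U"
  then have "bounded_linear (f' x)"
    using assms(1) has_derivative_bounded_linear by blast
  then show "(f has_derivative blinfun_apply (Blinfun (f' x))) (at x)"
    using assms(1) \<open>x \<in> U\<close> by (simp add: bounded_linear_Blinfun_apply)
next
  have "blinfun_apply (Blinfun (f' x)) h = f' x h" if "x \<in> U" for x h
    using assms(1)[OF that] by (simp add: bounded_linear_Blinfun_apply has_derivative_bounded_linear)
  then show "continuous_on U (\<lambda>x. Blinfun (f' x))"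
    using assms(2) by (intro continuous_on_blinfun_componentwise) (simp cong: continuous_on_cong)
qed

lemma C1_map_frechet:
  assumes "C1_map U f"
  shows "\<And>x. x \<in> U \<Longrightarrow> (f has_derivative frechet_derivative f (at x)) (at x)"
    and "\<And>h. continuous_on U (\<lambda>x. frechet_derivative f (at x) h)"
proof -
  obtain f' where f': "\<And>x. x \<in> U \<Longrightarrow> (f has_derivative blinfun_apply (f' x)) (at x)"
    "continuous_on U f'" using assms unfolding C1_map_def by blast
  have eq: "frechet_derivative f (at x) = blinfun_apply (f' x)" if "x \<in> U" for x
    using f'(1)[OF that] frechet_derivative_at by force
  show "(f has_derivative frechet_derivative f (at x)) (at x)" if "x \<in> U" for x
    using f'(1)[OF that] eq[OF that] by simp
  show "continuous_on U (\<lambda>x. frechet_derivative f (at x) h)" for h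
    using eq f'(2) by (auto cong: continuous_on_cong intro!: continuous_intros)
qed

lemma C1_map_subset: "C1_map U f \<Longrightarrow> V \<subseteq> U \<Longrightarrow> C1_map V f"
  unfolding C1_map_def by (meson continuous_on_subset subsetD)

text \<open>The local derivatives glue because \<open>frechet_derivative\<close> is a canonical
  choice that does not depend on the neighbourhood.\<close>

lemma C1_map_local:
  assumes "\<And>x. x \<in> U \<Longrightarrow> \<exists>V. open V \<and> x \<in> V \<and> C1_map V f"
  shows "C1_map U f"
proof (rule C1_mapI)
  show "(f has_derivative frechet_derivative f (at x)) (at x)" if "x \<in> U" for x
    using assms[OF that] C1_map_frechet(1) by blast
  show "continuous_on U (\<lambda>x. frechet_derivative f (at x) h)" for h
  proof (rule continuous_at_imp_continuous_on, intro ballI)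
    fix x assume "x \<in> U"
    then show "isCont (\<lambda>x. frechet_derivative f (at x) h) x"
      using assms C1_map_frechet(2) continuous_on_eq_continuous_at by blast
  qed
qed

lemma C1_map_cong:
  assumes "open U" "C1_map U f" "\<And>x. x \<in> U \<Longrightarrow> f x = g x"
  shows "C1_map U g"
proof -
  obtain f' where f': "\<And>x. x \<in> U \<Longrightarrow> (f has_derivative blinfun_apply (f' x)) (at x)"
    "continuous_on U f'" using assms(2) unfolding C1_map_def by blast
  have "(g has_derivative blinfun_apply (f' x)) (at x)" if "x \<in> U" for x
    using has_derivative_transform_within_open[OF f'(1)[OF that] assms(1) that] assms(3) by blast
  then show ?thesis
    using f'(2) unfolding C1_map_def by blast
qed

lemma C1_map_differentiable: "C1_map U f \<Longrightarrow> x \<in> U \<Longrightarrow> f differentiable (at x)"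
  unfolding C1_map_def differentiable_def by blast

lemma C1_map_continuous_on: "C1_map U f \<Longrightarrow> continuous_on U f"
  by (meson C1_map_differentiable continuous_at_imp_continuous_on differentiable_imp_continuous_within)

lemma C1_map_compose:
  assumes "C1_map U f" "C1_map V g" "f ` U \<subseteq> V"
  shows "C1_map U (\<lambda>x. g (f x))"
proof -
  obtain f' where f': "\<And>x. x \<in> U \<Longrightarrow> (f has_derivative blinfun_apply (f' x)) (at x)"
    "continuous_on U f'" using assms(1) unfolding C1_map_def by blast
  obtain g' where g': "\<And>x. x \<in> V \<Longrightarrow> (g has_derivative blinfun_apply (g' x)) (at x)"
    "continuous_on V g'" using assms(2) unfolding C1_map_def by blast
  show ?thesis
  proof (rule C1_mapI)
    show "((\<lambda>x. g (f x)) has_derivative (\<lambda>h. g' (f x) (f' x h))) (at x)" if "x \<in> U" for x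
      using has_derivative_compose[OF f'(1)[OF that] g'(1)] assms(3) that by blast
    have "continuous_on U (\<lambda>x. g' (f x))"
      using continuous_on_compose2[OF g'(2) C1_map_continuous_on[OF assms(1)] assms(3)] .
    then show "continuous_on U (\<lambda>x. g' (f x) (f' x h))" for h
      using f'(2) by (intro continuous_intros)
  qed
qed

lemma C1_map_bounded_linear:
  assumes "bounded_linear g" "C1_map U f"
  shows "C1_map U (\<lambda>x. g (f x))"
proof -
  obtain f' where f': "\<And>x. x \<in> U \<Longrightarrow> (f has_derivative blinfun_apply (f' x)) (at x)"
    "continuous_on U f'" using assms(2) unfolding C1_map_def by blast
  show ?thesis
  proof (rule C1_mapI)
    show "((\<lambda>x. g (f x)) has_derivative (\<lambda>h. g (f' x h))) (at x)" if "x \<in> U" for x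
      using bounded_linear.has_derivative[OF assms(1) f'(1)[OF that]] .
    show "continuous_on U (\<lambda>x. g (f' x h))" for h
      using f'(2) by (intro bounded_linear.continuous_on[OF assms(1)] continuous_intros)
  qed
qed

lemma C1_map_bounded_bilinear:
  assumes "bounded_bilinear b" "C1_map U f" "C1_map U g"
  shows "C1_map U (\<lambda>x. b (f x) (g x))"
proof -
  obtain f' where f': "\<And>x. x \<in> U \<Longrightarrow> (f has_derivative blinfun_apply (f' x)) (at x)"
    "continuous_on U f'" using assms(2) unfolding C1_map_def by blast
  obtain g' where g': "\<And>x. x \<in> U \<Longrightarrow> (g has_derivative blinfun_apply (g' x)) (at x)"
    "continuous_on U g'" using assms(3) unfolding C1_map_def by blast
  note fg = C1_map_continuous_on[OF assms(2)] C1_map_continuous_on[OF assms(3)]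
  show ?thesis
  proof (rule C1_mapI)
    show "((\<lambda>x. b (f x) (g x)) has_derivative (\<lambda>h. b (f x) (g' x h) + b (f' x h) (g x))) (at x)"
      if "x \<in> U" for x
      using bounded_bilinear.FDERIV[OF assms(1) f'(1)[OF that] g'(1)[OF that]] .
    show "continuous_on U (\<lambda>x. b (f x) (g' x h) + b (f' x h) (g x))" for h
      using f'(2) g'(2) fg
      by (intro continuous_intros bounded_bilinear.continuous_on[OF assms(1)])
  qed
qed

lemma C1_map_add:
  assumes "C1_map U f" "C1_map U g"
  shows "C1_map U (\<lambda>x. f x + g x)"
proof -
  obtain f' where f': "\<And>x. x \<in> U \<Longrightarrow> (f has_derivative blinfun_apply (f' x)) (at x)"
    "continuous_on U f'" using assms(1) unfolding C1_map_def by blast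
  obtain g' where g': "\<And>x. x \<in> U \<Longrightarrow> (g has_derivative blinfun_apply (g' x)) (at x)"
    "continuous_on U g'" using assms(2) unfolding C1_map_def by blast
  show ?thesis
    by (rule C1_mapI[where f'="\<lambda>x h. f' x h + g' x h"])
      (use f' g' in \<open>auto intro!: derivative_intros continuous_intros\<close>)
qed

lemma C1_map_minus: "C1_map U f \<Longrightarrow> C1_map U (\<lambda>x. - f x)"
  by (rule C1_map_bounded_linear[OF bounded_linear_minus[OF bounded_linear_ident]])

lemma C1_map_diff: "C1_map U f \<Longrightarrow> C1_map U g \<Longrightarrow> C1_map U (\<lambda>x. f x - g x)"
  using C1_map_add[OF _ C1_map_minus] by fastforce

lemma C1_map_Pair:
  assumes "C1_map U f" "C1_map U g"
  shows "C1_map U (\<lambda>x. (f x, g x))"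
proof -
  obtain f' where f': "\<And>x. x \<in> U \<Longrightarrow> (f has_derivative blinfun_apply (f' x)) (at x)"
    "continuous_on U f'" using assms(1) unfolding C1_map_def by blast
  obtain g' where g': "\<And>x. x \<in> U \<Longrightarrow> (g has_derivative blinfun_apply (g' x)) (at x)"
    "continuous_on U g'" using assms(2) unfolding C1_map_def by blast
  show ?thesis
    by (rule C1_mapI[where f'="\<lambda>x h. (f' x h, g' x h)"])
      (use f' g' in \<open>auto intro!: derivative_intros has_derivative_Pair continuous_intros\<close>)
qed

lemma C1_map_const: "C1_map U (\<lambda>x. c)"
  by (rule C1_mapI[where f'="\<lambda>x h. 0"]) (auto intro!: derivative_intros)

lemma C1_map_ident: "C1_map U (\<lambda>x. x)"
  by (rule C1_mapI[where f'="\<lambda>x h. h"]) (auto intro!: derivative_intros)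

lemma C1_map_scaleR: "C1_map U f \<Longrightarrow> C1_map U g \<Longrightarrow> C1_map U (\<lambda>x. f x *\<^sub>R g x)"
  by (rule C1_map_bounded_bilinear[OF bounded_bilinear_scaleR])

lemma C1_map_mult: "C1_map U f \<Longrightarrow> C1_map U g \<Longrightarrow> C1_map U (\<lambda>x. f x * g x :: real)"
  by (rule C1_map_bounded_bilinear[OF bounded_bilinear_mult])

lemma C1_map_inner: "C1_map U f \<Longrightarrow> C1_map U g \<Longrightarrow> C1_map U (\<lambda>x. f x \<bullet> g x)"
  by (rule C1_map_bounded_bilinear[OF bounded_bilinear_inner])

lemma C1_map_nth: "C1_map U f \<Longrightarrow> C1_map U (\<lambda>x. f x $ i)"
  by (rule C1_map_bounded_linear[OF bounded_linear_vec_nth])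

lemma C1_map_inverse_norm:
  fixes f :: "'a::euclidean_space \<Rightarrow> 'b::euclidean_space"
  assumes "C1_map U f" "\<And>x. x \<in> U \<Longrightarrow> f x \<noteq> 0"
  shows "C1_map U (\<lambda>x. inverse (norm (f x)))"
proof -
  have "C1_map (- {0}) (\<lambda>x::'b. inverse (norm x))"
    by (rule C1_mapI[where f'="\<lambda>x h. - (inverse (norm x) * (h \<bullet> sgn x) * inverse (norm x))"])
      (auto intro!: derivative_eq_intros has_derivative_norm continuous_intros
        simp: continuous_on_sgn)
  then show ?thesis
    by (rule C1_map_compose[OF assms(1)]) (use assms(2) in auto)
qed

text \<open>The gradient is the Riesz representative of \<open>f' x\<close>; written as a sum over
  \<open>Basis\<close> it is a linear image of \<open>f'\<close>, so \<open>f''\<close> provides its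
  derivative.\<close>

lemma C2_on_grad:
  assumes "C2_on U f"
  shows "x \<in> U \<Longrightarrow> (f has_derivative (\<lambda>h. h \<bullet> grad f x)) (at x)"
    and "open U \<Longrightarrow> C1_map U (grad f)"
proof -
  obtain f' :: "'a \<Rightarrow> 'a \<Rightarrow>\<^sub>L real" and f'' :: "'a \<Rightarrow> 'a \<Rightarrow>\<^sub>L ('a \<Rightarrow>\<^sub>L real)" where
    f': "\<And>x. x\<in>U \<Longrightarrow> (f has_derivative blinfun_apply (f' x)) (at x)" and
    f'': "\<And>x. x\<in>U \<Longrightarrow> (f' has_derivative blinfun_apply (f'' x)) (at x)" "continuous_on U f''"
    using assms unfolding C2_on_def by blast
  show g: "(f has_derivative (\<lambda>h. h \<bullet> grad f x)) (at x)" if "x \<in> U" for x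
    using has_derivative_grad f'[OF that] differentiable_def by blast
  have eq: "grad f x = (\<Sum>b\<in>Basis. f' x b *\<^sub>R b)" if "x \<in> U" for x
  proof -
    have "f' x h = h \<bullet> grad f x" for h
      using has_derivative_unique[OF f'[OF that] g[OF that]] by meson
    then show ?thesis
      by (simp add: euclidean_representation inner_commute[of _ "grad f x"])
  qed
  assume "open U"
  have "C1_map U (\<lambda>x. \<Sum>b\<in>Basis. f' x b *\<^sub>R b)"
  proof (rule C1_mapI)
    show "((\<lambda>x. \<Sum>b\<in>Basis. f' x b *\<^sub>R b) has_derivative (\<lambda>h. \<Sum>b\<in>Basis. f'' x h b *\<^sub>R b)) (at x)"
      if "x \<in> U" for x
      using f''(1)[OF that] by (auto intro!: derivative_eq_intros)
    show "continuous_on U (\<lambda>x. \<Sum>b\<in>Basis. f'' x h b *\<^sub>R b)" for h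
      using f''(2) by (intro continuous_intros)
  qed
  then show "C1_map U (grad f)"
    using C1_map_cong[OF \<open>open U\<close>] eq by fastforce
qed

text \<open>A continuous section \<open>g\<close> of \<open>f\<close> over \<open>\<iota>\<close> is differentiable wherever \<open>f\<close> has a
  left-invertible derivative; unlike in the inverse function theorem, \<open>g\<close> is given beforehand.\<close>

lemma has_derivative_section:
  fixes f :: "'a::real_normed_vector \<Rightarrow> 'b::real_normed_vector"
    and \<iota> :: "'c::real_normed_vector \<Rightarrow> 'b"
  assumes f: "(f has_derivative f') (at (g y))" and g': "bounded_linear g'" "\<And>h. g' (f' h) = h"
    and cont: "continuous (at y) g" and \<iota>: "(\<iota> has_derivative \<iota>') (at y)"
    and ev: "\<forall>\<^sub>F z in nhds y. f (g z) = \<iota> z"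
  shows "(g has_derivative (\<lambda>h. g' (\<iota>' h))) (at y)"
proof -
  interpret f': bounded_linear f' using f by (rule has_derivative_bounded_linear)
  interpret g': bounded_linear g' by fact
  interpret \<iota>': bounded_linear \<iota>' using \<iota> by (rule has_derivative_bounded_linear)
  obtain C where C: "C > 0" "\<And>v. norm (g' v) \<le> norm v * C"
    using g'.pos_bounded by blast
  obtain D where D: "D > 0" "\<And>v. norm (\<iota>' v) \<le> norm v * D"
    using \<iota>'.pos_bounded by blast
  have fgy: "f (g y) = \<iota> y" using ev by (rule eventually_nhds_x_imp_x)
  have key: "\<forall>\<^sub>F z in nhds y. norm (g z - g y - g' (\<iota>' (z - y))) \<le> e * norm (z - y)" if "e > 0" for e
  proof -
    \<comment> \<open>\<open>a\<close> bounds the relative error of \<open>f\<close>,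
      \<open>b\<close> that of \<open>\<iota>\<close>. The bound 1/2 allows the error term in
      \<open>norm k\<close> to be absorbed on the left; the other entries make the two final errors
      at most e/2 each.\<close>
    define a where "a = min (1/2) (e / (2 * (2 * (C * (D + 1)))))"
    define b where "b = min 1 (e / (2 * C))"
    have K: "2 * (2 * (C * (D + 1))) > 0" using C(1) D(1) by simp
    have "a \<le> e / (2 * (2 * (C * (D + 1))))" by (simp add: a_def)
    then have "a * (2 * (2 * (C * (D + 1)))) \<le> e"
      using K by (simp only: pos_le_divide_eq)
    moreover have "e / (2 * (2 * (C * (D + 1)))) > 0" using K that by (rule divide_pos_pos[rotated])
    ultimately have a: "a > 0" "a \<le> 1/2" "a * (2 * (C * (D + 1))) \<le> e / 2"
      by (simp_all add: a_def)
    have b: "b > 0" "b \<le> 1" "C * b \<le> e / 2"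
      using that C(1) unfolding b_def by (auto simp: min_def field_simps)
    have lim: "filterlim g (nhds (g y)) (nhds y)"
      using cont by (simp add: isCont_def tendsto_at_iff_tendsto_nhds)
    have evf: "\<forall>\<^sub>F w in nhds (g y). norm (f w - f (g y) - f' (w - g y)) \<le> (a / C) * norm (w - g y)"
    proof -
      have "a / C > 0" using a C by simp
      then obtain d where "d > 0" "\<And>w. norm (w - g y) < d \<Longrightarrow>
          norm (f w - f (g y) - f' (w - g y)) \<le> (a / C) * norm (w - g y)"
        using f unfolding has_derivative_at_alt by blast
      then show ?thesis
        by (auto simp: eventually_nhds_metric dist_norm)
    qed
    have ev1: "\<forall>\<^sub>F z in nhds y.
        norm (f (g z) - f (g y) - f' (g z - g y)) \<le> (a / C) * norm (g z - g y)"
      using eventually_compose_filterlim[OF evf lim] .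
    have ev2: "\<forall>\<^sub>F z in nhds y. norm (\<iota> z - \<iota> y - \<iota>' (z - y)) \<le> b * norm (z - y)"
    proof -
      obtain d where "d > 0" "\<And>w. norm (w - y) < d \<Longrightarrow>
          norm (\<iota> w - \<iota> y - \<iota>' (w - y)) \<le> b * norm (w - y)"
        using \<iota> b(1) unfolding has_derivative_at_alt by blast
      then show ?thesis
        by (auto simp: eventually_nhds_metric dist_norm)
    qed
    show ?thesis
      using ev ev1 ev2
    proof eventually_elim
      case (elim z)
      define k where "k = g z - g y"
      define r where "r = \<iota> z - \<iota> y - \<iota>' (z - y)"
      define q where "q = f (g z) - f (g y) - f' k"
      \<comment> \<open>The left inverse is applied to the expansion of f (g z) = \<iota> z; only
        left invertibility of \<open>f'\<close> enters.\<close>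
      have k: "k = g' (\<iota>' (z - y)) + g' r - g' q"
      proof -
        have "\<iota>' (z - y) + r - q = f' k"
          using elim(1) fgy by (simp add: r_def q_def)
        then show ?thesis
          using g'(2)[of k] by (metis g'.add g'.diff)
      qed
      have q: "norm (g' q) \<le> a * norm k"
      proof -
        have "norm (g' q) \<le> norm q * C" by (rule C(2))
        also have "\<dots> \<le> (a / C) * norm k * C"
          using elim(2) C(1) unfolding q_def k_def by (intro mult_right_mono) auto
        finally show ?thesis using C(1) by simp
      qed
      have r: "norm (g' r) \<le> C * b * norm (z - y)"
      proof -
        have "norm (g' r) \<le> norm r * C" by (rule C(2))
        also have "\<dots> \<le> (b * norm (z - y)) * C"
          using elim(3) C(1) unfolding r_def by (intro mult_right_mono) auto
        finally show ?thesis by (simp add: mult_ac)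
      qed
      have m: "norm (g' (\<iota>' (z - y))) \<le> C * D * norm (z - y)"
      proof -
        have "norm (g' (\<iota>' (z - y))) \<le> norm (\<iota>' (z - y)) * C" by (rule C(2))
        also have "\<dots> \<le> (norm (z - y) * D) * C"
          using D(2) C(1) by (intro mult_right_mono) auto
        finally show ?thesis by (simp add: mult_ac)
      qed
      \<comment> \<open>An a priori Lipschitz estimate for \<open>g\<close> at \<open>y\<close>,
        with constant 2 C (D + 1), comes first; it turns the error a * norm k into a multiple of
        norm (z - y).\<close>
      have "norm k \<le> norm (g' (\<iota>' (z - y))) + norm (g' r) + norm (g' q)"
        using norm_triangle_ineq4[of "g' (\<iota>' (z - y)) + g' r" "g' q"]
          norm_triangle_ineq[of "g' (\<iota>' (z - y))" "g' r"] unfolding k[symmetric] by linarith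
      also have "\<dots> \<le> C * D * norm (z - y) + C * b * norm (z - y) + a * norm k"
        using q r m by simp
      also have "\<dots> \<le> C * D * norm (z - y) + C * norm (z - y) + norm k / 2"
      proof -
        have "C * b * norm (z - y) \<le> C * 1 * norm (z - y)"
          using b C by (intro mult_mono) auto
        moreover have "a * norm k \<le> 1/2 * norm k"
          using a by (intro mult_right_mono) auto
        ultimately show ?thesis by simp
      qed
      finally have "norm k \<le> 2 * (C * (D + 1)) * norm (z - y)"
        by (simp add: algebra_simps)
      then have "a * norm k \<le> a * (2 * (C * (D + 1)) * norm (z - y))"
        using a by (intro mult_left_mono) auto
      also have "\<dots> \<le> e / 2 * norm (z - y)"
        using a(3) by (metis mult.assoc mult_right_mono norm_ge_zero)
      finally have *: "norm (g' q) \<le> e / 2 * norm (z - y)" using q by simp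
      have **: "norm (g' r) \<le> e / 2 * norm (z - y)"
        using r mult_right_mono[OF b(3) norm_ge_zero] order_trans by blast
      have "k - g' (\<iota>' (z - y)) = g' r - g' q"
        using k by (simp add: algebra_simps)
      then have "norm (k - g' (\<iota>' (z - y))) \<le> norm (g' r) + norm (g' q)"
        by (metis norm_triangle_ineq4)
      then show ?case
        using * ** unfolding k_def by (simp add: field_simps)
    qed
  qed
  show ?thesis
    unfolding has_derivative_at_alt
  proof (intro conjI allI impI)
    show "bounded_linear (\<lambda>h. g' (\<iota>' h))"
      using g' \<iota>'.bounded_linear_axioms bounded_linear_compose by blast
    fix e :: real assume "e > 0"
    then show "\<exists>d>0. \<forall>z. norm (z - y) < d \<longrightarrow>
        norm (g z - g y - g' (\<iota>' (z - y))) \<le> e * norm (z - y)"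
      using key[of e] unfolding eventually_nhds_metric dist_norm by blast
  qed
qed

section \<open>Weak divergence\<close>

lemma test_functionI:
  assumes "C1_map UNIV \<phi>" "compact K" "K \<subseteq> S" "\<And>z. z \<notin> K \<Longrightarrow> \<phi> z = 0"
  shows "test_function S \<phi>"
proof -
  have "closure {z. \<phi> z \<noteq> 0} \<subseteq> K"
    using assms(2,4) by (intro closure_minimal compact_imp_closed) auto
  moreover from this have "compact (closure {z. \<phi> z \<noteq> 0})"
    using assms(2) by (auto simp: compact_eq_bounded_closed intro: bounded_subset)
  ultimately show ?thesis
    using assms(1,3) by (simp add: test_function_def C1_on_iff)
qed

lemma test_function_C1: "test_function S \<phi> \<Longrightarrow> C1_map UNIV \<phi>"
  by (simp add: test_function_def C1_on_iff)

lemma test_function_support: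
  assumes "test_function S \<phi>"
  shows "\<exists>K. compact K \<and> K \<subseteq> S \<and> (\<forall>z. z \<notin> K \<longrightarrow> \<phi> z = 0) \<and> (\<forall>z. z \<notin> K \<longrightarrow> grad \<phi> z = 0)"
proof -
  define K where "K = closure {z. \<phi> z \<noteq> 0}"
  have K: "compact K" "K \<subseteq> S" "closed K"
    using assms by (simp_all add: test_function_def K_def)
  have zero: "\<phi> z = 0" if "z \<notin> K" for z
    using that closure_subset[of "{z. \<phi> z \<noteq> 0}"] unfolding K_def by auto
  have "grad \<phi> z = 0" if "z \<notin> K" for z
  proof -
    have "((\<lambda>z. 0) has_derivative (\<lambda>h. h \<bullet> 0)) (at z)" by simp
    then have "(\<phi> has_derivative (\<lambda>h. h \<bullet> 0)) (at z)"
      by (rule has_derivative_transform_within_open[of _ _ _ _ "- K"]) (use that zero K in auto)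
    then show ?thesis by (rule grad_eqI)
  qed
  then show ?thesis using K zero by blast
qed

text \<open>\<open>f\<close> is controlled on \<open>S\<close> only. The product is C1 on the whole
  space because \<open>S\<close> and the complement of the support form an open cover, and on the
  latter the product is identically zero.\<close>

lemma test_function_mult:
  assumes "test_function S \<phi>" "open S" "C1_map S f"
  shows "test_function S (\<lambda>z. f z * \<phi> z)"
proof -
  obtain K where K: "C1_map UNIV \<phi>" "compact K" "K \<subseteq> S" "\<And>z. z \<notin> K \<Longrightarrow> \<phi> z = 0"
    using test_function_support[OF assms(1)] test_function_C1[OF assms(1)] by blast
  have 1: "C1_map S (\<lambda>z. f z * \<phi> z)"
    using assms(3) C1_map_subset[OF K(1)] by (intro C1_map_mult) auto
  have 2: "C1_map (- K) (\<lambda>z. f z * \<phi> z)"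
    by (rule C1_map_cong[OF _ C1_map_const[of _ 0]]) (use K in \<open>auto simp: compact_imp_closed\<close>)
  have "C1_map UNIV (\<lambda>z. f z * \<phi> z)"
  proof (rule C1_map_local)
    fix x
    have "open (- K)" using K(2) by (simp add: compact_imp_closed open_Compl)
    then show "\<exists>V. open V \<and> x \<in> V \<and> C1_map V (\<lambda>z. f z * \<phi> z)"
      using 1 2 K(3) assms(2) by (cases "x \<in> K") blast+
  qed
  then show ?thesis
    using K by (intro test_functionI[of _ K]) auto
qed

lemma C1_map_continuous_on_grad:
  assumes "C1_map U f"
  shows "continuous_on U (grad f)"
proof -
  have "continuous_on U (\<lambda>x. \<Sum>b\<in>Basis. frechet_derivative f (at x) b *\<^sub>R b)"
    by (intro continuous_intros C1_map_frechet(2)[OF assms])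
  moreover have "(\<Sum>b\<in>Basis. frechet_derivative f (at x) b *\<^sub>R b) = grad f x" if "x \<in> U" for x
  proof -
    have "frechet_derivative f (at x) b = b \<bullet> grad f x" for b
      using has_derivative_grad[OF C1_map_differentiable[OF assms that]] frechet_derivative_at
      by metis
    then show ?thesis
      by (simp add: euclidean_representation inner_commute[of _ "grad f x"])
  qed
  ultimately show ?thesis
    by (simp cong: continuous_on_cong)
qed

lemma continuous_on_extend_by_zero:
  fixes f :: "'a::t2_space \<Rightarrow> 'b::topological_space"
  assumes "open S" "compact K" "K \<subseteq> S" "continuous_on S f" "\<And>z. z \<notin> K \<Longrightarrow> f z = c"
  shows "continuous_on UNIV f"
proof -
  have "continuous_on (- K) f"
    by (rule continuous_on_eq[OF continuous_on_const[of _ c]]) (use assms(5) in auto)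
  then have "continuous_on (S \<union> - K) f"
    using assms by (intro continuous_on_open_Un) (auto intro: compact_imp_closed)
  moreover have "S \<union> - K = UNIV" using assms(3) by blast
  ultimately show ?thesis by simp
qed

lemma integrable_compact_support:
  fixes f :: "'a::euclidean_space \<Rightarrow> real"
  assumes "continuous_on UNIV f" "compact K" "\<And>z. z \<notin> K \<Longrightarrow> f z = 0"
  shows "integrable lborel f"
proof -
  have "integrable lborel (\<lambda>x. indicator K x *\<^sub>R f x)"
    using assms(1,2) by (intro borel_integrable_compact) (auto intro: continuous_on_subset)
  moreover have "(\<lambda>x. indicator K x *\<^sub>R f x) = f"
    using assms(3) by (intro ext) (simp split: split_indicator)
  ultimately show ?thesis by simp
qed

text \<open>Passes from the gauge integral over \<open>S\<close> in the definition of weak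
  divergence to the Lebesgue integral over the whole space, where translation invariance and
  dominated convergence apply.\<close>

lemma integral_compact_support:
  fixes f :: "'a::euclidean_space \<Rightarrow> real"
  assumes "continuous_on UNIV f" "compact K" "K \<subseteq> S" "\<And>z. z \<notin> K \<Longrightarrow> f z = 0"
  shows "f absolutely_integrable_on S" and "integral S f = (LINT x|lborel. f x)"
proof -
  have eq: "(\<lambda>x. indicator S x *\<^sub>R f x) = f"
    using assms(3,4) by (intro ext) (auto split: split_indicator)
  have f: "f \<in> borel_measurable lborel" "integrable lborel f"
    using assms(1) integrable_compact_support[OF assms(1,2,4)] by (auto intro: borel_measurable_continuous_onI)
  then show 1: "f absolutely_integrable_on S"
    unfolding set_integrable_def eq by (simp add: integrable_completion)
  have "integral S f = (LINT x:S|lebesgue. f x)"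
    using set_lebesgue_integral_eq_integral(2)[OF 1] by simp
  also have "\<dots> = (LINT x|lborel. f x)"
    unfolding set_lebesgue_integral_def eq using f by (simp add: integral_completion)
  finally show "integral S f = (LINT x|lborel. f x)" .
qed

lemma lborel_integral_translate:
  fixes f :: "'a::euclidean_space \<Rightarrow> real"
  assumes "f \<in> borel_measurable borel"
  shows "(LINT x|lborel. f (x + c)) = (LINT x|lborel. f x)"
proof -
  have "(LINT x|lborel. f x) = (LINT x|distr lborel borel ((+) c). f x)"
    by (simp add: lborel_distr_plus)
  also have "\<dots> = (LINT x|lborel. f (c + x))"
    using assms by (subst integral_distr) auto
  finally show ?thesis by (simp add: add.commute)
qed

text \<open>A mean value estimate whose constant serves all increments at once. It asks for the
  segment to lie in \<open>K\<close> rather than for convexity, since \<open>K\<close> will be a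
  neighbourhood of a support; it yields the dominating function in
  \<open>weak_symmetry\<close>.\<close>

lemma C1_map_bound_increment:
  fixes f :: "'a::euclidean_space \<Rightarrow> 'b::euclidean_space"
  assumes "C1_map S f" "compact K" "K \<subseteq> S"
  shows "\<exists>B\<ge>0. \<forall>x a. (\<forall>t\<in>{0..1}. x + t *\<^sub>R a \<in> K) \<longrightarrow> norm (f (x + a) - f x) \<le> B * norm a"
proof -
  obtain f' where f': "\<And>x. x \<in> S \<Longrightarrow> (f has_derivative blinfun_apply (f' x)) (at x)"
    "continuous_on S f'" using assms(1) unfolding C1_map_def by blast
  have "compact (f' ` K)"
    using f'(2) assms(2,3) compact_continuous_image continuous_on_subset by blast
  then obtain B where B: "B > 0" "\<And>x. x \<in> K \<Longrightarrow> norm (f' x) \<le> B"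
    using compact_imp_bounded bounded_pos by (metis imageI)
  show ?thesis
  proof (intro exI conjI allI impI)
    show "B \<ge> 0" using B by simp
    fix x a assume K: "\<forall>t\<in>{0..1}. x + t *\<^sub>R a \<in> K"
    have "norm (f (x + a) - f x) \<le> norm a * B"
    proof (rule differentiable_bound_segment[where G=K and f'="\<lambda>x. blinfun_apply (f' x)"])
      show "(f has_derivative blinfun_apply (f' x)) (at x within K)" if "x \<in> K" for x
        using f'(1) assms(3) that has_derivative_at_withinI by blast
      show "onorm (blinfun_apply (f' (x + t *\<^sub>R a))) \<le> B" if "t \<in> {0..1}" for t
        using B(2)[OF K[rule_format, OF that]] by (simp add: norm_blinfun.rep_eq)
    qed (use K in auto)
    then show "norm (f (x + a) - f x) \<le> B * norm a" by (simp add: mult.commute)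
  qed
qed

lemma tendsto_difference_quotient:
  fixes f :: "'a::euclidean_space \<Rightarrow> real"
  assumes "f differentiable (at x)"
  shows "((\<lambda>t. (f (x + t *\<^sub>R a) - f x) / t) \<longlongrightarrow> a \<bullet> grad f x) (at 0)"
proof -
  have l: "((\<lambda>t. x + t *\<^sub>R a) has_derivative (\<lambda>t. t *\<^sub>R a)) (at 0)"
    by (auto intro!: derivative_eq_intros)
  have "(f has_derivative (\<lambda>h. h \<bullet> grad f x)) (at (x + 0 *\<^sub>R a))"
    using has_derivative_grad[OF assms] by simp
  then have "((\<lambda>t. f (x + t *\<^sub>R a)) has_derivative (\<lambda>t. (t *\<^sub>R a) \<bullet> grad f x)) (at 0)"
    using has_derivative_compose[OF l] by blast
  then have "((\<lambda>t. f (x + t *\<^sub>R a)) has_field_derivative (a \<bullet> grad f x)) (at 0)"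
    by (simp add: has_field_derivative_def mult_commute_abs)
  then show ?thesis
    by (simp add: DERIV_def)
qed

text \<open>Weak symmetry of second derivatives. After a translation the integral of
  \<open>(g (z + t a) - g z) (m z - m (z - t b))\<close> becomes symmetric in \<open>a\<close> and \<open>b\<close>; then \<open>t\<close> tends to 0.\<close>

lemma weak_symmetry:
  fixes S :: "(real^3) set" and a b :: "real^3"
  assumes S: "open S" and g: "C1_map S g" and m: "test_function S m"
  shows "(LINT z|lborel. (a \<bullet> grad g z) * (b \<bullet> grad m z)) =
         (LINT z|lborel. (b \<bullet> grad g z) * (a \<bullet> grad m z))"
proof -
  obtain K where K: "C1_map UNIV m" "compact K" "K \<subseteq> S" "\<And>z. z \<notin> K \<Longrightarrow> m z = 0"
    "\<And>z. z \<notin> K \<Longrightarrow> grad m z = 0"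
    using test_function_support[OF m] test_function_C1[OF m] by blast
  obtain e where e: "e > 0" "(\<Union>x\<in>K. cball x e) \<subseteq> S"
    using compact_subset_open_imp_cball_epsilon_subset[OF K(2) S K(3)] by auto
  \<comment> \<open>The closed e-neighbourhood of the support, still inside \<open>S\<close>: it
    contains every point at which a translated factor \<open>m\<close> can be nonzero.\<close>
  define K1 where "K1 = {x + y | x y. x \<in> K \<and> y \<in> cball 0 e}"
  have K1: "compact K1" "K1 \<subseteq> S"
  proof -
    show "compact K1" unfolding K1_def using K(2) by (intro compact_sums) auto
    show "K1 \<subseteq> S" unfolding K1_def using e(2) by (force simp: dist_norm)
  qed
  have K1I: "z + v \<in> K1" if "z \<in> K" "norm v \<le> e" for z v
    unfolding K1_def using that by auto
  have KK1: "K \<subseteq> K1" using K1I[of _ 0] e(1) by auto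
  have gc: "continuous_on S g" and mc: "continuous_on UNIV m"
    using g K(1) C1_map_continuous_on by auto
  \<comment> \<open>All four products obtained by expanding \<open>Q\<close> are translates of such
    functions, so their integrals depend on the relative shift \<open>v\<close> alone.\<close>
  define h where "h v z = g z * m (z - v)" for v z
  have h0: "h v z = 0" if "norm v \<le> e" "z \<notin> K1" for v z
    using K1I[of "z - v" v] K(4)[of "z - v"] that by (auto simp: h_def)
  have hc: "continuous_on UNIV (h v)" if "norm v \<le> e" for v
  proof (rule continuous_on_extend_by_zero[OF S K1])
    show "continuous_on S (h v)" unfolding h_def
      by (intro continuous_intros gc continuous_on_compose2[OF mc]) auto
  qed (use h0 that in auto)
  have hi: "integrable lborel (h v)" if "norm v \<le> e" for v
    using integrable_compact_support[OF hc[OF that] K1(1)] h0[OF that] by blast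
  have hm: "h v \<in> borel_measurable borel" if "norm v \<le> e" for v
    using hc[OF that] by (rule borel_measurable_continuous_onI)
  define I where "I v = (LINT z|lborel. h v z)" for v
  have tr: "integrable lborel (\<lambda>z. h v (z + c))" "(LINT z|lborel. h v (z + c)) = I v"
    if "norm v \<le> e" for v c
  proof -
    show "(LINT z|lborel. h v (z + c)) = I v"
      using lborel_integral_translate[OF hm[OF that]] by (simp add: I_def)
    have "continuous_on UNIV (\<lambda>z. h v (z + c))"
      by (intro continuous_on_compose2[OF hc[OF that]] continuous_intros) auto
    moreover have "compact ((\<lambda>z. z - c) ` K1)"
      by (intro compact_continuous_image K1 continuous_intros)
    moreover have "h v (z + c) = 0" if "z \<notin> (\<lambda>z. z - c) ` K1" for z
      using that h0[OF \<open>norm v \<le> e\<close>, of "z + c"] by (force simp: image_iff)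
    ultimately show "integrable lborel (\<lambda>z. h v (z + c))"
      by (rule integrable_compact_support)
  qed
  \<comment> \<open>A forward difference of \<open>g\<close> against a backward difference of
    \<open>m\<close>: with this pairing the relative shifts are t a, t a + t b, 0 and t b, a set
    symmetric in \<open>a\<close> and \<open>b\<close>.\<close>
  define Q where "Q a b t z = (g (z + t *\<^sub>R a) - g z) * (m z - m (z - t *\<^sub>R b))" for a b :: "real^3" and t z
  \<comment> \<open>For t \<le> c both shifts have length at most e/2; the summand 1 avoids division
    by zero when \<open>a\<close> and \<open>b\<close> vanish.\<close>
  define c where "c = e / (2 * (norm a + norm b + 1))"
  have nab: "norm a + norm b + 1 > 0" by (smt (verit) norm_ge_zero)
  have c: "c > 0" using e(1) nab by (simp add: c_def)
  have ce: "c * (norm a + norm b) \<le> e / 2"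
  proof -
    have "c * (norm a + norm b) \<le> c * (norm a + norm b + 1)" using c by simp
    also have "\<dots> = e / 2" using nab by (simp add: c_def field_simps)
    finally show ?thesis .
  qed
  have small: "norm (t *\<^sub>R a) \<le> e / 2" "norm (t *\<^sub>R b) \<le> e / 2" "norm (t *\<^sub>R a + t *\<^sub>R b) \<le> e"
    if "0 \<le> t" "t \<le> c" for t
  proof -
    have "t * norm a + t * norm b \<le> c * (norm a + norm b)"
      using that by (metis add_nonneg_nonneg distrib_left mult_right_mono norm_ge_zero)
    then have *: "t * norm a + t * norm b \<le> e / 2" using ce by simp
    have **: "0 \<le> t * norm a" "0 \<le> t * norm b" using that by auto
    show 1: "norm (t *\<^sub>R a) \<le> e / 2" "norm (t *\<^sub>R b) \<le> e / 2"
      using * ** that(1) unfolding norm_scaleR by linarith+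
    show "norm (t *\<^sub>R a + t *\<^sub>R b) \<le> e"
      using norm_triangle_ineq[of "t *\<^sub>R a" "t *\<^sub>R b"] 1 by linarith
  qed
  have Qint: "integrable lborel (Q a b t) \<and>
      (LINT z|lborel. Q a b t z) = I (t *\<^sub>R a) - I (t *\<^sub>R a + t *\<^sub>R b) - I 0 + I (t *\<^sub>R b)"
    if "norm (t *\<^sub>R a) \<le> e" "norm (t *\<^sub>R b) \<le> e" "norm (t *\<^sub>R a + t *\<^sub>R b) \<le> e" for a b t
  proof -
    have Q: "Q a b t = (\<lambda>z. h (t *\<^sub>R a) (z + t *\<^sub>R a) - h (t *\<^sub>R a + t *\<^sub>R b) (z + t *\<^sub>R a)
        - h 0 (z + 0) + h (t *\<^sub>R b) (z + 0))"
      by (auto simp: Q_def h_def algebra_simps)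
    note tr' = tr[OF that(1), of "t *\<^sub>R a"] tr[OF that(3), of "t *\<^sub>R a"] tr[of 0 0] tr[OF that(2), of 0]
    show ?thesis
      unfolding Q using tr' e(1) by (simp del: add_0_right)
  qed
  have Qsym: "(LINT z|lborel. Q a b t z) = (LINT z|lborel. Q b a t z)" if "0 \<le> t" "t \<le> c" for t
    using Qint[of t a b] Qint[of t b a] small[OF that] e(1) by (simp add: add.commute)
  obtain Bg where Bg: "Bg \<ge> 0"
    "\<And>x a. (\<And>t. t \<in> {0..1} \<Longrightarrow> x + t *\<^sub>R a \<in> K1) \<Longrightarrow> norm (g (x + a) - g x) \<le> Bg * norm a"
    using C1_map_bound_increment[OF g K1] by blast
  obtain Bm where Bm: "Bm \<ge> 0"
    "\<And>x a. (\<And>t. t \<in> {0..1} \<Longrightarrow> x + t *\<^sub>R a \<in> K1) \<Longrightarrow> norm (m (x + a) - m x) \<le> Bm * norm a"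
    using C1_map_bound_increment[OF K(1) K1(1)] by blast
  \<comment> \<open>Stated for arbitrary directions because it is used twice, with \<open>a\<close>
    and \<open>b\<close> exchanged; equality of the integrals of \<open>Q\<close> then identifies
    the two limits.\<close>
  have lim: "(\<lambda>n. LINT z|lborel. Q a b (X n) z / (X n)\<^sup>2) \<longlonglongrightarrow>
      (LINT z|lborel. (a \<bullet> grad g z) * (b \<bullet> grad m z))"
    if X: "\<And>n. 0 < X n" "\<And>n. X n * (norm a + norm b) \<le> e / 2" "X \<longlonglongrightarrow> 0" for a b and X :: "nat \<Rightarrow> real"
  proof (rule integral_dominated_convergence)
    have na: "norm (X n *\<^sub>R a) \<le> e / 2" "norm (X n *\<^sub>R b) \<le> e / 2" "norm (X n *\<^sub>R a + X n *\<^sub>R b) \<le> e" for n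
    proof -
      have *: "X n * norm a + X n * norm b \<le> e / 2"
        using X(2)[of n] by (simp add: distrib_left)
      have **: "0 \<le> X n * norm a" "0 \<le> X n * norm b" using X(1)[of n] by auto
      show 1: "norm (X n *\<^sub>R a) \<le> e / 2" "norm (X n *\<^sub>R b) \<le> e / 2"
        using * ** X(1)[of n] unfolding norm_scaleR by linarith+
      show "norm (X n *\<^sub>R a + X n *\<^sub>R b) \<le> e"
        using norm_triangle_ineq[of "X n *\<^sub>R a" "X n *\<^sub>R b"] 1 by linarith
    qed
    show meas: "(\<lambda>z. Q a b (X n) z / (X n)\<^sup>2) \<in> borel_measurable lborel" for n
      using Qint[of "X n" a b] na[of n] e(1) by (intro borel_measurable_divide) auto
    show "AE z in lborel. (\<lambda>n. Q a b (X n) z / (X n)\<^sup>2) \<longlonglongrightarrow> (a \<bullet> grad g z) * (b \<bullet> grad m z)"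
    proof (rule AE_I2)
      fix z
      show "(\<lambda>n. Q a b (X n) z / (X n)\<^sup>2) \<longlonglongrightarrow> (a \<bullet> grad g z) * (b \<bullet> grad m z)"
      proof (cases "z \<in> S")
        case True
        have X0: "filterlim X (at 0) sequentially"
          using X(1,3) by (auto simp: filterlim_at intro!: always_eventually) (metis less_irrefl)
        have "(\<lambda>n. (g (z + X n *\<^sub>R a) - g z) / X n) \<longlonglongrightarrow> a \<bullet> grad g z"
          by (rule filterlim_compose[OF tendsto_difference_quotient X0])
            (rule C1_map_differentiable[OF g True])
        moreover have "(\<lambda>n. (m (z + X n *\<^sub>R (- b)) - m z) / X n) \<longlonglongrightarrow> (- b) \<bullet> grad m z"
          by (rule filterlim_compose[OF tendsto_difference_quotient X0])
            (rule C1_map_differentiable[OF K(1) UNIV_I])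
        ultimately have "(\<lambda>n. (g (z + X n *\<^sub>R a) - g z) / X n * (- ((m (z + X n *\<^sub>R (- b)) - m z) / X n)))
            \<longlonglongrightarrow> (a \<bullet> grad g z) * (- ((- b) \<bullet> grad m z))"
          by (intro tendsto_intros)
        moreover have "(g (z + X n *\<^sub>R a) - g z) / X n * (- ((m (z + X n *\<^sub>R (- b)) - m z) / X n))
            = Q a b (X n) z / (X n)\<^sup>2" for n
          using X(1)[of n] by (simp add: Q_def power2_eq_square field_simps)
        ultimately show ?thesis by simp
      next
        case False
        then have "z \<notin> K1" using K1(2) by blast
        then have "z \<notin> K" "z - X n *\<^sub>R b \<notin> K" for n
          using KK1 K1I[of "z - X n *\<^sub>R b" "X n *\<^sub>R b"] na(2)[of n] e(1) by auto
        then show ?thesis using K(4,5) by (simp add: Q_def)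
      qed
    qed
    show "integrable lborel (\<lambda>z. indicator K1 z *\<^sub>R (Bg * norm a * (Bm * norm b)))"
      using K1(1) by (intro borel_integrable_compact) auto
    show "AE z in lborel. norm (Q a b (X n) z / (X n)\<^sup>2) \<le> indicator K1 z *\<^sub>R (Bg * norm a * (Bm * norm b))" for n
    proof (rule AE_I2)
      fix z
      show "norm (Q a b (X n) z / (X n)\<^sup>2) \<le> indicator K1 z *\<^sub>R (Bg * norm a * (Bm * norm b))"
      \<comment> \<open>Within distance e/2 of the support, a further shift by at most e/2 keeps
        both difference segments in \<open>K1\<close>, where the increment bounds hold. Farther away
        \<open>m\<close> vanishes at \<open>z\<close> and at z - X n b, so \<open>Q\<close> is
        zero.\<close>
      proof (cases "\<exists>x v. x \<in> K \<and> norm v \<le> e / 2 \<and> z = x + v")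
        case True
        then obtain x v where xv: "x \<in> K" "norm v \<le> e / 2" "z = x + v" by blast
        have zin: "z + w \<in> K1" if "norm w \<le> e / 2" for w
          using K1I[OF xv(1), of "v + w"] norm_triangle_ineq[of v w] that xv(2,3)
          by (simp add: add.assoc)
        have seg: "z + t *\<^sub>R w \<in> K1" if "norm w \<le> e / 2" "t \<in> {0..1}" for w t
        proof (rule zin)
          have "\<bar>t\<bar> * norm w \<le> 1 * norm w" using that by (intro mult_right_mono) auto
          then show "norm (t *\<^sub>R w) \<le> e / 2" using that by simp
        qed
        have 1: "norm (g (z + X n *\<^sub>R a) - g z) \<le> Bg * norm (X n *\<^sub>R a)"
          using Bg(2)[OF seg[OF na(1)]] .
        have "norm (m (z + - (X n *\<^sub>R b)) - m z) \<le> Bm * norm (- (X n *\<^sub>R b))"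
          using Bm(2)[of z "- (X n *\<^sub>R b)"] seg[of "- (X n *\<^sub>R b)"] na(2)[of n] by simp
        then have 2: "norm (m z - m (z - X n *\<^sub>R b)) \<le> Bm * norm (X n *\<^sub>R b)"
          by (simp add: norm_minus_commute)
        have "norm (Q a b (X n) z) \<le> (Bg * norm (X n *\<^sub>R a)) * (Bm * norm (X n *\<^sub>R b))"
          unfolding Q_def norm_mult by (rule mult_mono[OF 1 2]) (use Bg Bm in auto)
        also have "\<dots> = (Bg * norm a * (Bm * norm b)) * (X n)\<^sup>2"
          using X(1)[of n] by (simp add: power2_eq_square)
        finally have "norm (Q a b (X n) z) / (X n)\<^sup>2 \<le> Bg * norm a * (Bm * norm b)"
          using X(1)[of n] by (simp add: pos_divide_le_eq)
        moreover have "z \<in> K1" using zin[of 0] e(1) by simp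
        ultimately show ?thesis by simp
      next
        case False
        have "z \<notin> K" using False e(1) by (metis add_0_right norm_zero half_gt_zero less_imp_le)
        moreover have "z - X n *\<^sub>R b \<notin> K" using False na(2)[of n] by (metis diff_add_cancel)
        ultimately have "Q a b (X n) z = 0" using K(4) by (simp add: Q_def)
        then show ?thesis using Bg(1) Bm(1) by (simp add: indicator_def)
      qed
    qed
    have "continuous_on S (\<lambda>z. (a \<bullet> grad g z) * (b \<bullet> grad m z))"
      using C1_map_continuous_on_grad[OF g] C1_map_continuous_on_grad[OF C1_map_subset[OF K(1), of S]]
      by (intro continuous_intros) auto
    then have "continuous_on UNIV (\<lambda>z. (a \<bullet> grad g z) * (b \<bullet> grad m z))"
      by (rule continuous_on_extend_by_zero[OF S K(2,3)]) (use K(5) in auto)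
    then show "(\<lambda>z. (a \<bullet> grad g z) * (b \<bullet> grad m z)) \<in> borel_measurable lborel"
      using borel_measurable_continuous_onI by simp
  qed
  define X where "X n = c * inverse (real (Suc n))" for n
  have X: "0 < X n" "X n \<le> c" for n
  proof -
    show "0 < X n" using c by (simp add: X_def)
    have "c * inverse (real (Suc n)) \<le> c * 1"
      using c by (intro mult_left_mono) (auto simp: field_simps)
    then show "X n \<le> c" by (simp add: X_def)
  qed
  have X0: "X \<longlonglongrightarrow> 0"
    unfolding X_def using tendsto_mult_right_zero[OF LIMSEQ_inverse_real_of_nat] .
  have Xe: "X n * (norm a + norm b) \<le> e / 2" for n
    using mult_right_mono[OF X(2), of "norm a + norm b" n] ce by simp
  have eq: "(\<lambda>n. LINT z|lborel. Q a b (X n) z / (X n)\<^sup>2) = (\<lambda>n. LINT z|lborel. Q b a (X n) z / (X n)\<^sup>2)"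
    using Qsym X by (intro ext) (simp add: less_imp_le)
  have Xe': "X n * (norm b + norm a) \<le> e / 2" for n
    using Xe[of n] by (simp add: add.commute)
  show ?thesis
    using LIMSEQ_unique[OF lim[OF X(1) Xe X0, unfolded eq] lim[OF X(1) Xe' X0]] .
qed

section \<open>Weak divergence of fields built from gradients and cross products\<close>

lemma grad_mult:
  fixes f g :: "'a::euclidean_space \<Rightarrow> real"
  assumes "f differentiable (at x)" "g differentiable (at x)"
  shows "grad (\<lambda>z. f z * g z) x = f x *\<^sub>R grad g x + g x *\<^sub>R grad f x"
proof (rule grad_eqI)
  have "((\<lambda>z. f z * g z) has_derivative (\<lambda>h. f x * (h \<bullet> grad g x) + (h \<bullet> grad f x) * g x)) (at x)"
    using has_derivative_mult[OF assms[THEN has_derivative_grad]] .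
  then show "((\<lambda>z. f z * g z) has_derivative (\<lambda>h. h \<bullet> (f x *\<^sub>R grad g x + g x *\<^sub>R grad f x))) (at x)"
    by (simp add: inner_add_right mult.commute)
qed

lemma grad_nth:
  fixes N :: "'a::euclidean_space \<Rightarrow> real^'n"
  assumes "(N has_derivative N') (at x)"
  shows "h \<bullet> grad (\<lambda>y. N y $ k) x = N' h $ k"
proof -
  have "((\<lambda>y. N y $ k) has_derivative (\<lambda>h. N' h $ k)) (at x)"
    using bounded_linear.has_derivative[OF bounded_linear_vec_nth assms] .
  then show ?thesis
    using has_derivative_unique has_derivative_grad unfolding differentiable_def by metis
qed

lemma test_function_integrals:
  fixes S :: "(real^3) set"
  assumes "test_function S \<phi>" "open S" "continuous_on S h" "continuous_on S f"
  shows "integrable lborel (\<lambda>z. h z \<bullet> grad \<phi> z)"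
    and "integrable lborel (\<lambda>z. f z * \<phi> z)"
    and "(\<lambda>z. h z \<bullet> grad \<phi> z) absolutely_integrable_on S"
    and "(\<lambda>z. f z * \<phi> z) absolutely_integrable_on S"
    and "integral S (\<lambda>z. h z \<bullet> grad \<phi> z) = (LINT z|lborel. h z \<bullet> grad \<phi> z)"
    and "integral S (\<lambda>z. f z * \<phi> z) = (LINT z|lborel. f z * \<phi> z)"
proof -
  obtain K where K: "compact K" "K \<subseteq> S" "\<And>z. z \<notin> K \<Longrightarrow> \<phi> z = 0" "\<And>z. z \<notin> K \<Longrightarrow> grad \<phi> z = 0"
    using test_function_support[OF assms(1)] by blast
  have C1: "C1_map S \<phi>"
    using test_function_C1[OF assms(1)] C1_map_subset by blast
  have "continuous_on S (\<lambda>z. h z \<bullet> grad \<phi> z)" "continuous_on S (\<lambda>z. f z * \<phi> z)"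
    using C1_map_continuous_on[OF C1] C1_map_continuous_on_grad[OF C1] assms(3,4)
    by (auto intro!: continuous_intros)
  then have c: "continuous_on UNIV (\<lambda>z. h z \<bullet> grad \<phi> z)" "continuous_on UNIV (\<lambda>z. f z * \<phi> z)"
    using K(3,4) by (auto intro!: continuous_on_extend_by_zero[OF assms(2) K(1,2), of _ 0])
  show "integrable lborel (\<lambda>z. h z \<bullet> grad \<phi> z)" "integrable lborel (\<lambda>z. f z * \<phi> z)"
    using integrable_compact_support[OF c(1) K(1)] integrable_compact_support[OF c(2) K(1)] K(3,4)
    by simp_all
  show "(\<lambda>z. h z \<bullet> grad \<phi> z) absolutely_integrable_on S"
    "integral S (\<lambda>z. h z \<bullet> grad \<phi> z) = (LINT z|lborel. h z \<bullet> grad \<phi> z)"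
    using integral_compact_support[OF c(1) K(1,2)] K(4) by simp_all
  show "(\<lambda>z. f z * \<phi> z) absolutely_integrable_on S"
    "integral S (\<lambda>z. f z * \<phi> z) = (LINT z|lborel. f z * \<phi> z)"
    using integral_compact_support[OF c(2) K(1,2)] K(3) by simp_all
qed

lemma test_function_outside:
  assumes "test_function S \<phi>" "z \<notin> S"
  shows "\<phi> z = 0" "grad \<phi> z = 0"
  using test_function_support[OF assms(1)] assms(2) by blast+

text \<open>With \<open>m = f N\<close> and \<open>curl N = 0\<close>, the integrand is \<open>- grad g \<bullet> curl m\<close>, whose integral
  vanishes by weak symmetry.\<close>

lemma integral_cross_grad_eq_0:
  fixes N :: "real^3 \<Rightarrow> real^3"
  assumes S: "open S" and g: "C1_map S g" and N: "C1_map S N"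
    and N': "\<And>z. z \<in> S \<Longrightarrow> (N has_derivative N' z) (at z)"
    and sym: "\<And>z a b. z \<in> S \<Longrightarrow> a \<bullet> N' z b = b \<bullet> N' z a"
    and f: "test_function S f"
  shows "(LINT z|lborel. cross3 (grad g z) (N z) \<bullet> grad f z) = 0"
proof -
  define m where "m k z = N z $ k * f z" for k z
  have m: "test_function S (m k)" for k
    unfolding m_def by (rule test_function_mult[OF f S C1_map_nth[OF N]])
  define q where "q i j k z = grad g z $ i * grad (m k) z $ j" for i j k z
  have qi: "integrable lborel (q i j k)" for i j k
  proof -
    have "continuous_on S (\<lambda>z. (grad g z \<bullet> axis i 1) *\<^sub>R (axis j 1 :: real^3))"
      using C1_map_continuous_on_grad[OF g] by (intro continuous_intros)
    from test_function_integrals(1)[OF m S this continuous_on_const[of _ 0], of k]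
    show ?thesis unfolding q_def by (simp add: inner_axis inner_axis')
  qed
  have qs: "(LINT z|lborel. q i j k z) = (LINT z|lborel. q j i k z)" for i j k
    using weak_symmetry[OF S g m, of "axis i 1" "axis j 1" k] by (simp add: q_def inner_axis')
  \<comment> \<open>Each \<open>grad (m k)\<close> contributes a term with a derivative of
    \<open>f\<close> and one with \<open>N'\<close>. The latter cancel between the two members of
    each bracket because \<open>N'\<close> is symmetric; each bracket integrates to zero by
    \<open>weak_symmetry\<close>.\<close>
  have eq: "cross3 (grad g z) (N z) \<bullet> grad f z =
      (q 2 1 3 z - q 1 2 3 z) + (q 3 2 1 z - q 2 3 1 z) + (q 1 3 2 z - q 3 1 2 z)" for z
  proof (cases "z \<in> S")
    case True
    have fd: "f differentiable (at z)"
      using C1_map_differentiable[OF test_function_C1[OF f]] by simp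
    have gm: "grad (m k) z $ j = N z $ k * grad f z $ j + f z * N' z (axis j 1) $ k" for j k
    proof -
      have "grad (m k) z = N z $ k *\<^sub>R grad f z + f z *\<^sub>R grad (\<lambda>z. N z $ k) z"
        unfolding m_def by (rule grad_mult[OF C1_map_differentiable[OF C1_map_nth[OF N] True] fd])
      then show ?thesis
        using grad_nth[OF N'[OF True], of "axis j 1" k] by (simp add: inner_axis')
    qed
    have s: "N' z (axis j 1) $ k = N' z (axis k 1) $ j" for j k
      using sym[OF True, of "axis k 1" "axis j 1"] by (simp add: inner_axis')
    show ?thesis
      unfolding q_def gm s[of 1 2] s[of 1 3] s[of 2 3]
      by (simp add: cross3_simps)
  next
    case False
    then show ?thesis
      using test_function_outside[OF f] test_function_outside[OF m] by (simp add: q_def)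
  qed
  show ?thesis
    unfolding eq using qi qs[of 2 1 3] qs[of 3 2 1] qs[of 1 3 2] by simp
qed

lemma has_weak_divergence_on_cong:
  assumes "has_weak_divergence_on F g S" "\<And>z. z \<in> S \<Longrightarrow> F z = F1 z" "\<And>z. z \<in> S \<Longrightarrow> g z = g1 z"
  shows "has_weak_divergence_on F1 g1 S"
  unfolding has_weak_divergence_on_def
proof (intro allI impI)
  fix \<phi> assume "test_function S \<phi>"
  then have *: "(\<lambda>z. F z \<bullet> grad \<phi> z) absolutely_integrable_on S"
     "(\<lambda>z. g z * \<phi> z) absolutely_integrable_on S"
     "integral S (\<lambda>z. F z \<bullet> grad \<phi> z) = - integral S (\<lambda>z. g z * \<phi> z)"
    using assms(1) unfolding has_weak_divergence_on_def by auto
  have "integral S (\<lambda>z. F z \<bullet> grad \<phi> z) = integral S (\<lambda>z. F1 z \<bullet> grad \<phi> z)"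
    "integral S (\<lambda>z. g z * \<phi> z) = integral S (\<lambda>z. g1 z * \<phi> z)"
    using assms(2,3) by (auto intro!: integral_cong)
  moreover have "(\<lambda>z. F z \<bullet> grad \<phi> z) absolutely_integrable_on S \<longleftrightarrow> (\<lambda>z. F1 z \<bullet> grad \<phi> z) absolutely_integrable_on S"
    "(\<lambda>z. g z * \<phi> z) absolutely_integrable_on S \<longleftrightarrow> (\<lambda>z. g1 z * \<phi> z) absolutely_integrable_on S"
    using assms(2,3) by (auto intro!: set_integrable_cong[OF refl refl])
  ultimately show "(\<lambda>z. F1 z \<bullet> grad \<phi> z) absolutely_integrable_on S \<and>
     (\<lambda>z. g1 z * \<phi> z) absolutely_integrable_on S \<and>
     integral S (\<lambda>z. F1 z \<bullet> grad \<phi> z) = - integral S (\<lambda>z. g1 z * \<phi> z)"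
    using * by simp
qed

lemma has_weak_divergence_on_sum:
  assumes "finite I" "\<And>i. i \<in> I \<Longrightarrow> has_weak_divergence_on (F i) (g i) S"
  shows "has_weak_divergence_on (\<lambda>z. \<Sum>i\<in>I. F i z) (\<lambda>z. \<Sum>i\<in>I. g i z) S"
  unfolding has_weak_divergence_on_def
proof (intro allI impI)
  fix \<phi> assume \<phi>: "test_function S \<phi>"
  have *: "(\<lambda>z. F i z \<bullet> grad \<phi> z) absolutely_integrable_on S"
     "(\<lambda>z. g i z * \<phi> z) absolutely_integrable_on S"
     "integral S (\<lambda>z. F i z \<bullet> grad \<phi> z) = - integral S (\<lambda>z. g i z * \<phi> z)" if "i \<in> I" for i
    using assms(2)[OF that] \<phi> unfolding has_weak_divergence_on_def by auto
  have i: "(\<lambda>z. F i z \<bullet> grad \<phi> z) integrable_on S" "(\<lambda>z. g i z * \<phi> z) integrable_on S" if "i \<in> I" for i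
    using *(1,2)[OF that] set_lebesgue_integral_eq_integral(1) by auto
  have eq: "(\<lambda>z. (\<Sum>i\<in>I. F i z) \<bullet> grad \<phi> z) = (\<lambda>z. \<Sum>i\<in>I. F i z \<bullet> grad \<phi> z)"
     "(\<lambda>z. (\<Sum>i\<in>I. g i z) * \<phi> z) = (\<lambda>z. \<Sum>i\<in>I. g i z * \<phi> z)"
    by (simp_all add: inner_sum_left sum_distrib_right)
  show "(\<lambda>z. (\<Sum>i\<in>I. F i z) \<bullet> grad \<phi> z) absolutely_integrable_on S \<and>
     (\<lambda>z. (\<Sum>i\<in>I. g i z) * \<phi> z) absolutely_integrable_on S \<and>
     integral S (\<lambda>z. (\<Sum>i\<in>I. F i z) \<bullet> grad \<phi> z) = - integral S (\<lambda>z. (\<Sum>i\<in>I. g i z) * \<phi> z)"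
    unfolding eq using * i assms(1)
    by (simp add: absolutely_integrable_sum integral_sum sum_negf)
qed

text \<open>\<open>V z * \<phi> z\<close> is again a test function. Testing the weakly
  divergence-free field \<nabla>g \<times> N against it and expanding by the product rule leaves
  derivatives on \<open>V\<close> and \<phi> only, so neither \<nabla>g nor the cross product is
  ever differentiated.\<close>

lemma has_weak_divergence_on_cross:
  fixes N :: "real^3 \<Rightarrow> real^3"
  assumes S: "open S" and V: "C1_map S V" and g: "C1_map S g" and N: "C1_map S N"
    and N': "\<And>z. z \<in> S \<Longrightarrow> (N has_derivative N' z) (at z)"
    and sym: "\<And>z a b. z \<in> S \<Longrightarrow> a \<bullet> N' z b = b \<bullet> N' z a"
  shows "has_weak_divergence_on (\<lambda>z. V z *\<^sub>R cross3 (grad g z) (N z))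
    (\<lambda>z. grad V z \<bullet> cross3 (grad g z) (N z)) S"
  unfolding has_weak_divergence_on_def
proof (intro allI impI)
  fix \<phi> assume \<phi>: "test_function S \<phi>"
  have f: "test_function S (\<lambda>z. V z * \<phi> z)"
    by (rule test_function_mult[OF \<phi> S V])
  have c: "continuous_on S (\<lambda>z. V z *\<^sub>R cross3 (grad g z) (N z))"
    "continuous_on S (\<lambda>z. grad V z \<bullet> cross3 (grad g z) (N z))"
    using C1_map_continuous_on[OF V] C1_map_continuous_on[OF N]
      C1_map_continuous_on_grad[OF V] C1_map_continuous_on_grad[OF g]
    by (auto intro!: continuous_intros continuous_on_cross)
  note ints = test_function_integrals[OF \<phi> S c]
  have eq: "cross3 (grad g z) (N z) \<bullet> grad (\<lambda>z. V z * \<phi> z) z =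
      (V z *\<^sub>R cross3 (grad g z) (N z)) \<bullet> grad \<phi> z + (grad V z \<bullet> cross3 (grad g z) (N z)) * \<phi> z" for z
  proof (cases "z \<in> S")
    case True
    have "\<phi> differentiable (at z)"
      using C1_map_differentiable[OF test_function_C1[OF \<phi>]] by simp
    with grad_mult[OF C1_map_differentiable[OF V True] this] show ?thesis
      by (simp add: inner_add_right inner_commute mult.commute)
  next
    case False
    then show ?thesis
      using test_function_outside[OF f] test_function_outside[OF \<phi>] by simp
  qed
  have "(LINT z|lborel. (V z *\<^sub>R cross3 (grad g z) (N z)) \<bullet> grad \<phi> z) +
      (LINT z|lborel. (grad V z \<bullet> cross3 (grad g z) (N z)) * \<phi> z) = 0"
    using integral_cross_grad_eq_0[OF S g N N' sym f] ints(1,2) unfolding eq by simp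
  then show "(\<lambda>z. (V z *\<^sub>R cross3 (grad g z) (N z)) \<bullet> grad \<phi> z) absolutely_integrable_on S \<and>
     (\<lambda>z. (grad V z \<bullet> cross3 (grad g z) (N z)) * \<phi> z) absolutely_integrable_on S \<and>
     integral S (\<lambda>z. (V z *\<^sub>R cross3 (grad g z) (N z)) \<bullet> grad \<phi> z) =
     - integral S (\<lambda>z. (grad V z \<bullet> cross3 (grad g z) (N z)) * \<phi> z)"
    using ints by simp
qed

section \<open>Comparison of the weak with the classical divergence\<close>

lemma integral_partial_eq_0:
  fixes S :: "(real^3) set"
  assumes \<psi>: "test_function S \<psi>" and S: "open S"
  shows "(LINT z|lborel. grad \<psi> z $ j) = 0"
proof -
  \<comment> \<open>For a coordinate i different from j, \<open>weak_symmetry\<close> with the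
    coordinate function z_i has partial derivative 1 on one side and 0 on the other, so the integral
    of the j-th partial derivative of \<psi> vanishes.\<close>
  define i :: 3 where "i = (if j = 1 then 2 else 1)"
  have i: "i \<noteq> j" by (simp add: i_def)
  have g: "grad (\<lambda>z::real^3. z $ i) x = axis i 1" for x
    by (rule grad_eqI) (simp add: inner_axis bounded_linear.has_derivative[OF bounded_linear_vec_nth])
  have "C1_map S (\<lambda>z::real^3. z $ i)"
    by (rule C1_map_nth[OF C1_map_ident])
  from weak_symmetry[OF S this \<psi>, of "axis i 1" "axis j 1"]
  show ?thesis
    using i by (simp add: g inner_axis' inner_axis_axis) (simp add: axis_def)
qed

text \<open>Componentwise integration by parts; applied below to the affine Taylor polynomial of the
  flux.\<close>

lemma has_weak_divergence_on_C1:
  fixes F :: "real^3 \<Rightarrow> real^3"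
  assumes S: "open S" and F: "C1_map S F"
  shows "has_weak_divergence_on F (divergence F) S"
  unfolding has_weak_divergence_on_def
proof (intro allI impI)
  fix \<phi> assume \<phi>: "test_function S \<phi>"
  have div: "divergence F z = (\<Sum>j\<in>UNIV. grad (\<lambda>y. F y $ j) z $ j)" if "z \<in> S" for z
    using grad_nth[OF C1_map_frechet(1)[OF F that], of "axis j 1" j for j]
    by (simp add: divergence_def trace_def jacobian_def matrix_def inner_axis')
  have f: "test_function S (\<lambda>z. F z $ j * \<phi> z)" for j
    by (rule test_function_mult[OF \<phi> S C1_map_nth[OF F]])
  have "continuous_on S (\<lambda>z. \<Sum>j\<in>UNIV. grad (\<lambda>y. F y $ j) z \<bullet> axis j 1)"
    using C1_map_continuous_on_grad[OF C1_map_nth[OF F]] by (intro continuous_intros)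
  then have "continuous_on S (divergence F)"
    using div by (simp add: inner_axis cong: continuous_on_cong)
  note ints = test_function_integrals[OF \<phi> S C1_map_continuous_on[OF F] this]
  have eq: "(\<Sum>j\<in>UNIV. grad (\<lambda>z. F z $ j * \<phi> z) z $ j) = F z \<bullet> grad \<phi> z + divergence F z * \<phi> z" for z
  proof (cases "z \<in> S")
    case True
    have d: "\<phi> differentiable (at z)"
      using C1_map_differentiable[OF test_function_C1[OF \<phi>]] by simp
    have "grad (\<lambda>z. F z $ j * \<phi> z) z = F z $ j *\<^sub>R grad \<phi> z + \<phi> z *\<^sub>R grad (\<lambda>z. F z $ j) z" for j
      using grad_mult[OF C1_map_differentiable[OF C1_map_nth[OF F] True] d] .
    then show ?thesis
      by (simp add: div[OF True] inner_vec_def sum.distrib sum_distrib_left mult.commute)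
  next
    case False
    then show ?thesis
      using test_function_outside[OF f] test_function_outside[OF \<phi>] by simp
  qed
  have "integrable lborel (\<lambda>z. grad (\<lambda>z. F z $ j * \<phi> z) z $ j)" for j
    using test_function_integrals(1)[OF f S continuous_on_const[of _ "axis j 1"] continuous_on_const[of _ 0]]
    by (simp add: inner_axis')
  then have "(LINT z|lborel. (\<Sum>j\<in>UNIV. grad (\<lambda>z. F z $ j * \<phi> z) z $ j)) = 0"
    using integral_partial_eq_0[OF f S] by simp
  then have "(LINT z|lborel. F z \<bullet> grad \<phi> z) + (LINT z|lborel. divergence F z * \<phi> z) = 0"
    unfolding eq using ints(1,2) by simp
  then show "(\<lambda>z. F z \<bullet> grad \<phi> z) absolutely_integrable_on S \<and>
     (\<lambda>z. divergence F z * \<phi> z) absolutely_integrable_on S \<and>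
     integral S (\<lambda>z. F z \<bullet> grad \<phi> z) = - integral S (\<lambda>z. divergence F z * \<phi> z)"
    using ints by simp
qed

text \<open>The outer square makes the truncated paraboloid C1 across the sphere, and being explicit
  it comes with constants: the gradient is -4 max(0, q)(y - z0) with q \<le> r^2 and |y - z0| \<le>
  r on the ball, while q \<ge> 3/4 r^2 on the half ball.\<close>

lemma bump_function:
  fixes z0 :: "real^3" and r :: real
  defines "\<phi> \<equiv> \<lambda>y. (max 0 (r\<^sup>2 - (y - z0) \<bullet> (y - z0)))\<^sup>2"
  assumes r: "r > 0" and S: "cball z0 r \<subseteq> S"
  shows "test_function S \<phi>"
    and "0 \<le> \<phi> y" and "y \<notin> cball z0 r \<Longrightarrow> \<phi> y = 0" and "y \<notin> cball z0 r \<Longrightarrow> grad \<phi> y = 0"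
    and "norm (grad \<phi> y) \<le> 4 * r ^ 3"
    and "y \<in> cball z0 (r/2) \<Longrightarrow> 9/16 * r ^ 4 \<le> \<phi> y"
proof -
  define q where "q y = r\<^sup>2 - (y - z0) \<bullet> (y - z0)" for y
  have q: "q y = r\<^sup>2 - (norm (y - z0))\<^sup>2" for y
    by (simp add: q_def power2_norm_eq_inner)
  have qneg: "q y \<le> 0" if "y \<notin> cball z0 r" for y
    using that r by (simp add: q dist_norm norm_minus_commute power_mono)
  have \<phi>: "\<phi> y = (max 0 (q y))\<^sup>2" for y
    by (simp add: \<phi>_def q_def)
  have sq: "((\<lambda>t::real. (max 0 t)\<^sup>2) has_field_derivative 2 * max 0 t) (at t)" for t
  proof -
    consider "t < 0" | "t > 0" | "t = 0" by linarith
    then show ?thesis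
    proof cases
      case 1
      have "((\<lambda>t::real. 0) has_field_derivative 0) (at t)" by simp
      then have "((\<lambda>t::real. (max 0 t)\<^sup>2) has_field_derivative 0) (at t)"
        by (rule DERIV_cong_ev[THEN iffD1, rotated 3])
          (use 1 in \<open>auto simp: eventually_nhds intro!: exI[of _ "{..<0}"]\<close>)
      then show ?thesis using 1 by simp
    next
      case 2
      have "((\<lambda>t::real. t\<^sup>2) has_field_derivative 2 * t) (at t)"
        by (auto intro!: derivative_eq_intros)
      then have "((\<lambda>t::real. (max 0 t)\<^sup>2) has_field_derivative 2 * t) (at t)"
        by (rule DERIV_cong_ev[THEN iffD1, rotated 3])
          (use 2 in \<open>auto simp: eventually_nhds intro!: exI[of _ "{0<..}"]\<close>)
      then show ?thesis using 2 by simp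
    next
      case 3
      have "((\<lambda>h::real. (max 0 h)\<^sup>2 / h) \<longlongrightarrow> 0) (at 0)"
      proof (rule Lim_null_comparison)
        show "\<forall>\<^sub>F h in at 0. norm ((max 0 h)\<^sup>2 / h) \<le> \<bar>h\<bar>"
          by (rule always_eventually) (auto simp: max_def power2_eq_square)
        show "((\<lambda>h::real. \<bar>h\<bar>) \<longlongrightarrow> 0) (at 0)"
          by (auto intro!: tendsto_eq_intros)
      qed
      then show ?thesis using 3 by (simp add: DERIV_def)
    qed
  qed
  have qd: "(q has_derivative (\<lambda>h. h \<bullet> (- 2 *\<^sub>R (y - z0)))) (at y)" for y
    unfolding q_def by (auto intro!: derivative_eq_intros simp: inner_commute algebra_simps)
  have d: "(\<phi> has_derivative (\<lambda>h. h \<bullet> (- (4 * max 0 (q y)) *\<^sub>R (y - z0)))) (at y)" for y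
    using has_derivative_compose[OF qd sq[of "q y", unfolded has_field_derivative_def]]
    unfolding \<phi>[abs_def] by (simp add: mult.assoc)
  have g: "grad \<phi> y = - (4 * max 0 (q y)) *\<^sub>R (y - z0)" for y
    by (rule grad_eqI[OF d])
  show "0 \<le> \<phi> y" by (simp add: \<phi>)
  show z: "\<phi> y = 0" "grad \<phi> y = 0" if "y \<notin> cball z0 r" for y
    using qneg[OF that] by (auto simp: \<phi> g max_def)
  show "test_function S \<phi>"
  proof (rule test_functionI[OF _ compact_cball S z(1)])
    show "C1_map UNIV \<phi>"
      by (rule C1_mapI[OF d]) (auto simp: q_def intro!: continuous_intros)
  qed
  show "norm (grad \<phi> y) \<le> 4 * r ^ 3"
  proof (cases "y \<in> cball z0 r")
    case True
    then have "norm (y - z0) \<le> r" by (simp add: dist_norm norm_minus_commute)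
    moreover have "max 0 (q y) \<le> r\<^sup>2" by (simp add: q)
    ultimately have "max 0 (q y) * norm (y - z0) \<le> r\<^sup>2 * r"
      using r by (intro mult_mono) auto
    then show ?thesis by (simp add: g power2_eq_square power3_eq_cube)
  next
    case False
    then show ?thesis using z(2) r by simp
  qed
  show "9/16 * r ^ 4 \<le> \<phi> y" if "y \<in> cball z0 (r/2)"
  proof -
    have "norm (y - z0) \<le> r / 2" using that by (simp add: dist_norm norm_minus_commute)
    then have "(norm (y - z0))\<^sup>2 \<le> (r / 2)\<^sup>2" by (intro power_mono) auto
    then have "3/4 * r\<^sup>2 \<le> q y" by (simp add: q power_divide)
    then have "3/4 * r\<^sup>2 \<le> max 0 (q y)" by simp
    then have "(3/4 * r\<^sup>2)\<^sup>2 \<le> \<phi> y" unfolding \<phi> by (rule power_mono) simp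
    moreover have "(3/4 * r\<^sup>2)\<^sup>2 = 9/16 * r ^ 4"
      by (simp add: power_mult_distrib power_divide)
    ultimately show ?thesis by simp
  qed
qed

lemma has_integral_cball_const:
  fixes z0 :: "real^3"
  assumes "r \<ge> 0" "cball z0 r \<subseteq> S"
  shows "((\<lambda>y. if y \<in> cball z0 r then C else 0) has_integral C * (unit_ball_vol 3 * r ^ 3)) S"
proof -
  have "((\<lambda>y. 1::real) has_integral measure lebesgue (cball z0 r)) (cball z0 r)"
    using lmeasure_integral[of "cball z0 r"] lmeasurable_iff_integrable_on[of "cball z0 r"]
    by (simp add: has_integral_integral)
  then have "((\<lambda>y. C * 1) has_integral C * measure lebesgue (cball z0 r)) (cball z0 r)"
    by (rule has_integral_mult_right)
  moreover have "measure lebesgue (cball z0 r) = unit_ball_vol 3 * r ^ 3"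
    using content_cball[OF assms(1), of z0] by (simp add: measure_completion)
  ultimately show ?thesis
    using has_integral_restrict[OF assms(2), of "\<lambda>y. C"] by simp
qed

text \<open>\<open>F\<close> is compared with its affine Taylor polynomial \<open>A\<close> at
  \<open>z0\<close>, whose weak divergence is the constant \<open>D\<close>. Tested with a bump of
  radius r, the remainder contributes at most e r times 4 r^3 times the volume of the ball, whereas
  the bump has mass at least a constant times r^4 times that volume. The powers of r balance, and e
  is arbitrary.\<close>

lemma weak_divergence_eq_divergence:
  fixes F :: "real^3 \<Rightarrow> real^3"
  assumes S: "open S" and z0: "z0 \<in> S" and weak: "has_weak_divergence_on F g S"
    and F: "F differentiable (at z0)" and g: "continuous (at z0) g"
  shows "divergence F z0 = g z0"
proof -
  define F' where "F' = frechet_derivative F (at z0)"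
  have F': "(F has_derivative F') (at z0)"
    using F unfolding F'_def frechet_derivative_works .
  then have lin: "bounded_linear F'" by (rule has_derivative_bounded_linear)
  define A where "A y = F z0 + F' (y - z0)" for y
  define D where "D = divergence F z0"
  have A': "(A has_derivative F') (at y)" for y
    unfolding A_def
    by (rule has_derivative_eq_rhs[OF has_derivative_add[OF has_derivative_const
            bounded_linear.has_derivative[OF lin has_derivative_diff[OF has_derivative_ident has_derivative_const]]]])
      simp
  have "divergence A y = D" for y
    using frechet_derivative_at[OF A'[of y]] by (simp add: D_def divergence_def jacobian_def F'_def)
  then have divA: "divergence A = (\<lambda>y. D)" by blast
  have A1: "C1_map S A"
    by (rule C1_mapI[OF A']) simp
  have weakA: "has_weak_divergence_on A (\<lambda>y. D) S"
    using has_weak_divergence_on_C1[OF S A1] unfolding divA .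
  have key: "\<bar>D - g z0\<bar> \<le> 58 * e" if e: "e > 0" for e
  proof -
    obtain d1 where d1: "d1 > 0" "\<And>y. norm (y - z0) < d1 \<Longrightarrow> norm (F y - F z0 - F' (y - z0)) \<le> e * norm (y - z0)"
      using F' e unfolding has_derivative_at_alt by blast
    obtain d2 where d2: "d2 > 0" "\<And>y. norm (y - z0) < d2 \<Longrightarrow> \<bar>g y - g z0\<bar> < e"
      using g e unfolding continuous_at_eps_delta dist_norm by auto
    obtain d3 where d3: "d3 > 0" "ball z0 d3 \<subseteq> S"
      using S z0 open_contains_ball by blast
    define r where "r = min d1 (min d2 d3) / 2"
    have r: "r > 0" "r < d1" "r < d2" "r < d3"
      using d1 d2 d3 by (auto simp: r_def)
    have rS: "cball z0 r \<subseteq> S" using r(4) d3(2) by auto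
    define \<phi> where "\<phi> y = (max 0 (r\<^sup>2 - (y - z0) \<bullet> (y - z0)))\<^sup>2" for y
    note b = bump_function[OF r(1) rS, folded \<phi>_def]
    have ints: "(\<lambda>z. F z \<bullet> grad \<phi> z) integrable_on S" "(\<lambda>z. g z * \<phi> z) integrable_on S"
      "(\<lambda>z. A z \<bullet> grad \<phi> z) integrable_on S" "(\<lambda>z. D * \<phi> z) integrable_on S"
      and eqs: "integral S (\<lambda>z. F z \<bullet> grad \<phi> z) = - integral S (\<lambda>z. g z * \<phi> z)"
      "integral S (\<lambda>z. A z \<bullet> grad \<phi> z) = - integral S (\<lambda>z. D * \<phi> z)"
      using weak weakA b(1) set_lebesgue_integral_eq_integral(1)
      unfolding has_weak_divergence_on_def by blast+
    have \<phi>i: "\<phi> integrable_on S"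
      using test_function_integrals(4)[OF b(1) S continuous_on_const continuous_on_const[of _ 1]]
        set_lebesgue_integral_eq_integral(1) by fastforce
    define M where "M = integral S \<phi>"
    define v where "v = unit_ball_vol 3 * r ^ 3"
    have v: "v > 0" using r(1) by (simp add: v_def)
    have M: "9/16 * r ^ 4 * (v / 8) \<le> M"
    proof -
      have rS2: "cball z0 (r/2) \<subseteq> S"
        using rS r(1) subset_cball[of "r/2" r z0] by auto
      have hi: "((\<lambda>y. if y \<in> cball z0 (r/2) then 9/16 * r ^ 4 else 0) has_integral
          9/16 * r ^ 4 * (unit_ball_vol 3 * (r/2) ^ 3)) S"
        by (rule has_integral_cball_const[OF _ rS2]) (use r in simp)
      have "9/16 * r ^ 4 * (unit_ball_vol 3 * (r/2) ^ 3) \<le> M"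
        unfolding M_def
        by (rule has_integral_le[OF hi integrable_integral[OF \<phi>i]]) (use b(2,6) in auto)
      then show ?thesis by (simp add: v_def power_divide)
    qed
    have M0: "M > 0" using M v r(1) by (smt (verit) divide_pos_pos mult_pos_pos zero_less_power)
    \<comment> \<open>512/9 is 4 from the gradient bound, times 16/9 from the height of the bump,
      times 8 from the volume of the half ball; it is rounded up to 57. One further e from the
      oscillation of \<open>g\<close> gives 58.\<close>
    have "(4 * e * r ^ 4) * v = 512/9 * e * (9/16 * r ^ 4 * (v / 8))" by simp
    also have "\<dots> \<le> 512/9 * e * M" using M e by (intro mult_left_mono) auto
    also have "\<dots> \<le> 57 * e * M" using M0 e by (intro mult_right_mono) auto
    finally have 4: "(4 * e * r ^ 4) * v \<le> 57 * e * M" .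
    have 1: "\<bar>integral S (\<lambda>z. (F z - A z) \<bullet> grad \<phi> z)\<bar> \<le> (4 * e * r ^ 4) * v"
    proof -
      have hi: "((\<lambda>y. if y \<in> cball z0 r then 4 * e * r ^ 4 else 0) has_integral 4 * e * r ^ 4 * v) S"
        unfolding v_def by (rule has_integral_cball_const[OF _ rS]) (use r in simp)
      have le: "norm ((F y - A y) \<bullet> grad \<phi> y) \<le> (if y \<in> cball z0 r then 4 * e * r ^ 4 else 0)" for y
      proof (cases "y \<in> cball z0 r")
        case True
        then have ny: "norm (y - z0) \<le> r" by (simp add: dist_norm norm_minus_commute)
        have "norm (F y - A y) \<le> e * norm (y - z0)"
          using d1(2)[of y] ny r(2) by (simp add: A_def algebra_simps)
        also have "\<dots> \<le> e * r" using ny e by simp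
        finally have "norm (F y - A y) * norm (grad \<phi> y) \<le> (e * r) * (4 * r ^ 3)"
          using b(5) e r(1) by (intro mult_mono) auto
        moreover have "(e * r) * (4 * r ^ 3) = 4 * e * r ^ 4"
          by (simp add: power3_eq_cube power4_eq_xxxx)
        ultimately show ?thesis
          using True Cauchy_Schwarz_ineq2[of "F y - A y" "grad \<phi> y"] by simp
      next
        case False
        then show ?thesis using b(4) by simp
      qed
      have "norm (integral S (\<lambda>z. (F z - A z) \<bullet> grad \<phi> z)) \<le>
          integral S (\<lambda>y. if y \<in> cball z0 r then 4 * e * r ^ 4 else 0)"
        using ints(1,3) hi le
        by (intro integral_norm_bound_integral) (auto simp: inner_diff_left intro: integrable_diff)
      then show ?thesis using integral_unique[OF hi] by simp
    qed
    have 2: "integral S (\<lambda>z. (F z - A z) \<bullet> grad \<phi> z) = (D - g z0) * M - integral S (\<lambda>z. (g z - g z0) * \<phi> z)"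
    proof -
      have "integral S (\<lambda>z. (F z - A z) \<bullet> grad \<phi> z) = integral S (\<lambda>z. F z \<bullet> grad \<phi> z) - integral S (\<lambda>z. A z \<bullet> grad \<phi> z)"
        unfolding inner_diff_left using ints(1,3) by (rule integral_diff)
      also have "\<dots> = D * M - integral S (\<lambda>z. g z * \<phi> z)"
        unfolding eqs M_def by simp
      finally have *: "integral S (\<lambda>z. (F z - A z) \<bullet> grad \<phi> z) = D * M - integral S (\<lambda>z. g z * \<phi> z)" .
      have "(\<lambda>z. g z0 * \<phi> z) integrable_on S"
        using \<phi>i integrable_on_mult_right by blast
      then have "integral S (\<lambda>z. (g z - g z0) * \<phi> z) = integral S (\<lambda>z. g z * \<phi> z) - g z0 * M"
        unfolding left_diff_distrib M_def using ints(2) by (simp add: integral_diff)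
      then show ?thesis using * by (simp add: algebra_simps)
    qed
    have 3: "\<bar>integral S (\<lambda>z. (g z - g z0) * \<phi> z)\<bar> \<le> e * M"
    proof -
      have "norm (integral S (\<lambda>z. (g z - g z0) * \<phi> z)) \<le> integral S (\<lambda>z. e * \<phi> z)"
      proof (rule integral_norm_bound_integral)
        have "(\<lambda>z. g z0 * \<phi> z) integrable_on S"
          using \<phi>i integrable_on_mult_right by blast
        then show "(\<lambda>z. (g z - g z0) * \<phi> z) integrable_on S"
          unfolding left_diff_distrib using ints(2) by (intro integrable_diff)
        show "(\<lambda>z. e * \<phi> z) integrable_on S"
          using \<phi>i integrable_on_mult_right by blast
        show "norm ((g y - g z0) * \<phi> y) \<le> e * \<phi> y" for y
        proof (cases "y \<in> cball z0 r")
          case True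
          then have "\<bar>g y - g z0\<bar> \<le> e"
            using d2(2)[of y] r(3) by (simp add: dist_norm norm_minus_commute)
          then show ?thesis using b(2)[of y] by (simp add: abs_mult mult_right_mono)
        next
          case False
          then show ?thesis using b(3) by simp
        qed
      qed
      then show ?thesis by (simp add: M_def)
    qed
    have "\<bar>(D - g z0) * M\<bar> \<le> 57 * e * M + e * M"
      using 1 2 3 4 by linarith
    then have "\<bar>D - g z0\<bar> * M \<le> (58 * e) * M"
      using M0 unfolding abs_mult by simp
    then show ?thesis using M0 by (rule mult_right_le_imp_le)
  qed
  have "\<bar>D - g z0\<bar> \<le> 0 + e" if "e > 0" for e
    using key[of "e / 58"] that by simp
  then have "\<bar>D - g z0\<bar> \<le> 0" by (rule field_le_epsilon)
  then show ?thesis by (simp add: D_def)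
qed

section \<open>The tubular neighbourhood\<close>

text \<open>A nonzero remainder would be orthogonal to all three vectors and produce four
  independent vectors in a space of dimension 3.\<close>

lemma orthonormal_expansion:
  fixes a b c v :: "real^3"
  assumes "norm a = 1" "norm b = 1" "norm c = 1" "a \<bullet> b = 0" "a \<bullet> c = 0" "b \<bullet> c = 0"
  shows "(v \<bullet> a) *\<^sub>R a + (v \<bullet> b) *\<^sub>R b + (v \<bullet> c) *\<^sub>R c = v"
proof -
  define w where "w = v - ((v \<bullet> a) *\<^sub>R a + (v \<bullet> b) *\<^sub>R b + (v \<bullet> c) *\<^sub>R c)"
  have n: "a \<bullet> a = 1" "b \<bullet> b = 1" "c \<bullet> c = 1"
    using assms(1-3) by (simp_all add: norm_eq_1)
  have w: "w \<bullet> a = 0" "w \<bullet> b = 0" "w \<bullet> c = 0"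
    using n assms(4-6) by (simp_all add: w_def inner_diff_left inner_add_left inner_commute[of b a]
      inner_commute[of c a] inner_commute[of c b])
  have "w = 0"
  proof (rule ccontr)
    assume "w \<noteq> 0"
    have "pairwise orthogonal {w, a, b, c}"
      using w assms(4-6) by (auto simp: pairwise_def orthogonal_def inner_commute)
    moreover have "0 \<notin> {w, a, b, c}"
      using \<open>w \<noteq> 0\<close> assms(1-3) by auto
    ultimately have "independent {w, a, b, c}"
      by (rule pairwise_orthogonal_independent)
    then have "card {w, a, b, c} \<le> 3"
      using independent_bound[of "{w, a, b, c}"] by simp
    moreover have "w \<noteq> a" "w \<noteq> b" "w \<noteq> c" "a \<noteq> b" "a \<noteq> c" "b \<noteq> c"
      using n w assms(4-6) by auto
    ultimately show False by simp
  qed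
  then show ?thesis by (simp add: w_def)
qed

lemma tensor_mult_vec: "(a \<otimes>\<^sub>v b) *v v = (b \<bullet> v) *\<^sub>R a"
  by (simp add: tensor_def matrix_vector_mult_def vec_eq_iff inner_vec_def sum_distrib_left mult_ac)

lemma inner_cross3: "cross3 a b \<bullet> c = b \<bullet> cross3 c a"
  by (simp add: cross3_simps)

text \<open>The purely geometric part. Uniqueness of the closest point is required on the closed
  tube, so that \<open>P\<close> can be differentiated also where the Neumann condition is
  posed.\<close>

locale tubular_neighborhood =
  fixes \<Omega> :: "(real^3) set" and \<epsilon> \<kappa>\<^sub>m :: real
    and t\<^sub>1 t\<^sub>2 :: "real^3 \<Rightarrow> real^3" and \<kappa>\<^sub>1 \<kappa>\<^sub>2 :: "real^3 \<Rightarrow> real"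
  assumes open_\<Omega>: "open \<Omega>" and bounded_\<Omega>: "bounded \<Omega>" and C2_boundary: "C2_boundary \<Omega>"
    and frame: "\<forall>x\<in>frontier \<Omega>. principal_frame \<Omega> x (t\<^sub>1 x) (t\<^sub>2 x) (\<kappa>\<^sub>1 x) (\<kappa>\<^sub>2 x)"
    and curv: "\<forall>x\<in>frontier \<Omega>. \<bar>\<kappa>\<^sub>1 x\<bar> \<le> \<kappa>\<^sub>m \<and> \<bar>\<kappa>\<^sub>2 x\<bar> \<le> \<kappa>\<^sub>m"
    and \<epsilon>_pos: "\<epsilon> > 0" and \<epsilon>_small: "\<epsilon> * \<kappa>\<^sub>m < 1"
    and proj_wd: "\<forall>z\<in>closure (tube \<Omega> \<epsilon>). has_unique_closest_point (frontier \<Omega>) z"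
begin

abbreviation "\<Gamma> \<equiv> frontier \<Omega>"
abbreviation "d \<equiv> signed_dist \<Omega>"
abbreviation "P \<equiv> proj \<Omega>"
abbreviation "n \<equiv> normal \<Omega>"
abbreviation "T \<equiv> tube \<Omega> \<epsilon>"

lemma abs_signed_dist: "\<bar>d z\<bar> = infdist z \<Gamma>"
  by (simp add: signed_dist_def infdist_nonneg)

lemma boundary_nonempty: "\<Gamma> \<noteq> {}"
proof
  assume "\<Gamma> = {}"
  \<comment> \<open>By convention \<open>infdist\<close> to the empty set is 0, so the tube would be
    the whole space, and no point of it could have a closest point.\<close>
  then have "0 \<in> closure T"
    using \<epsilon>_pos closure_subset[of T] by (auto simp: tube_def abs_signed_dist infdist_def)
  then show False
    using proj_wd \<open>\<Gamma> = {}\<close> by (auto simp: has_unique_closest_point_def)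
qed

section \<open>Signed distance and closest point map: metric properties and continuity\<close>

lemma compact_boundary: "compact \<Gamma>"
  using bounded_\<Omega> by (simp add: compact_frontier_bounded)

lemma proj_in: "P z \<in> \<Gamma>" and dist_proj_le: "y \<in> \<Gamma> \<Longrightarrow> dist z (P z) \<le> dist z y"
  using closest_point_exists[OF frontier_closed boundary_nonempty] by (auto simp: proj_def)

lemma infdist_eq: "infdist z \<Gamma> = dist z (P z)"
proof (rule antisym)
  show "infdist z \<Gamma> \<le> dist z (P z)" using proj_in by (rule infdist_le)
  show "dist z (P z) \<le> infdist z \<Gamma>"
    unfolding infdist_notempty[OF boundary_nonempty]
    using boundary_nonempty dist_proj_le by (intro cINF_greatest) auto
qed

lemma abs_signed_dist_eq: "\<bar>d z\<bar> = dist z (P z)"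
  by (simp add: abs_signed_dist infdist_eq)

lemma proj_unique:
  assumes "z \<in> closure T" "x \<in> \<Gamma>" "dist z x \<le> dist z (P z)"
  shows "x = P z"
proof -
  have "\<exists>!x. x \<in> \<Gamma> \<and> (\<forall>y\<in>\<Gamma>. dist z x \<le> dist z y)"
    using proj_wd assms(1) by (simp add: has_unique_closest_point_def)
  moreover have "\<forall>y\<in>\<Gamma>. dist z x \<le> dist z y"
    using assms(3) dist_proj_le order_trans by blast
  ultimately show ?thesis using assms(2) proj_in dist_proj_le by blast
qed

lemma signed_dist_boundary: "x \<in> \<Gamma> \<Longrightarrow> d x = 0" and proj_boundary: "x \<in> \<Gamma> \<Longrightarrow> P x = x"
proof -
  assume "x \<in> \<Gamma>"
  then have "dist x (P x) \<le> 0" using dist_proj_le[of x x] by simp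
  then show "P x = x" "d x = 0" using abs_signed_dist_eq[of x] by auto
qed

lemma boundary_subset: "\<Gamma> \<subseteq> T"
  using \<epsilon>_pos by (auto simp: tube_def signed_dist_boundary)

lemma tube_eq: "T = {z. infdist z \<Gamma> < \<epsilon>}"
  by (simp add: tube_def abs_signed_dist)

lemma open_tube: "open T"
  unfolding tube_eq by (intro open_Collect_less continuous_intros)

lemma closure_tube: "z \<in> closure T \<Longrightarrow> \<bar>d z\<bar> \<le> \<epsilon>"
proof -
  have "closed {z. infdist z \<Gamma> \<le> \<epsilon>}" by (intro closed_Collect_le continuous_intros)
  then have "closure T \<subseteq> {z. infdist z \<Gamma> \<le> \<epsilon>}"
    by (rule closure_minimal[rotated]) (auto simp: tube_eq)
  then show "z \<in> closure T \<Longrightarrow> \<bar>d z\<bar> \<le> \<epsilon>" by (auto simp: abs_signed_dist)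
qed

text \<open>The sign can change only across \<Gamma>, and there the absolute value tends to
  zero.\<close>

lemma isCont_signed_dist: "isCont d z"
proof -
  have c: "isCont (\<lambda>z. infdist z \<Gamma>) z" for z by (intro continuous_intros)
  consider "z \<in> \<Omega>" | "z \<in> - closure \<Omega>" | "z \<in> \<Gamma>"
    using open_\<Omega> by (auto simp: frontier_def interior_open)
  then show ?thesis
  proof cases
    case 1
    have "\<forall>\<^sub>F y in nhds z. - infdist y \<Gamma> = d y"
      using eventually_nhds_in_open[OF open_\<Omega> 1] by eventually_elim (simp add: signed_dist_def)
    then show ?thesis
      using isCont_cong[of "\<lambda>z. - infdist z \<Gamma>" d] c by (simp add: continuous_minus)
  next
    case 2
    have "\<forall>\<^sub>F y in nhds z. infdist y \<Gamma> = d y"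
    proof (rule eventually_mono[OF eventually_nhds_in_open[OF _ 2]])
      show "open (- closure \<Omega>)" by (simp add: open_Compl)
      fix y assume "y \<in> - closure \<Omega>"
      then have "y \<notin> \<Omega>" using closure_subset[of \<Omega>] by blast
      then show "infdist y \<Gamma> = d y" by (simp add: signed_dist_def)
    qed
    then show ?thesis
      using isCont_cong[of "\<lambda>z. infdist z \<Gamma>" d] c by simp
  next
    case 3
    have "infdist z \<Gamma> = 0" using 3 by simp
    then have "(\<lambda>y. \<bar>d y\<bar>) \<midarrow>z\<rightarrow> 0"
      using c[of z] by (simp add: abs_signed_dist isCont_def)
    then show ?thesis
      using signed_dist_boundary[OF 3] by (simp add: isCont_def tendsto_rabs_zero_iff)
  qed
qed

text \<open>By compactness and uniqueness, the points of \<Gamma> at distance at least e from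
  \<open>P z\<close> are farther from \<open>z\<close> than \<open>P z\<close> is by a positive gap;
  moving \<open>z\<close> by less than half the gap cannot close it. Nearby points may lie outside
  the tube and have several closest points: the estimate holds for whichever one \<open>P\<close>
  selects.\<close>

lemma isCont_proj:
  assumes "z \<in> closure T"
  shows "isCont P z"
  unfolding continuous_at_eps_delta
proof (intro allI impI)
  fix e :: real assume "e > 0"
  define K where "K = \<Gamma> - ball (P z) e"
  have K: "compact K" unfolding K_def using compact_boundary by (intro compact_diff) auto
  show "\<exists>\<delta>>0. \<forall>y. dist y z < \<delta> \<longrightarrow> dist (P y) (P z) < e"
  proof (cases "K = {}")
    case True
    then have "dist (P y) (P z) < e" for y
      using proj_in[of y] by (auto simp: K_def dist_commute)
    then show ?thesis using zero_less_one by blast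
  next
    case False
    obtain x where x: "x \<in> K" "\<And>y. y \<in> K \<Longrightarrow> dist z x \<le> dist z y"
      using distance_attains_inf[OF compact_imp_closed[OF K] False, of z] by blast
    have "x \<noteq> P z" using x(1) \<open>e > 0\<close> by (auto simp: K_def)
    then have gap: "dist z x > dist z (P z)"
      using proj_unique[OF assms, of x] x(1) by (force simp: K_def)
    have "dist (P y) (P z) < e" if y: "dist y z < (dist z x - dist z (P z)) / 2" for y
    proof (rule ccontr)
      assume "\<not> dist (P y) (P z) < e"
      then have "P y \<in> K" using proj_in[of y] by (simp add: K_def dist_commute)
      then have "dist z x \<le> dist z (P y)" by (rule x(2))
      moreover have "dist z (P y) \<le> dist y z + dist y (P y)"
        by (metis dist_commute dist_triangle)
      moreover have "dist y (P y) \<le> dist y (P z)" by (rule dist_proj_le[OF proj_in])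
      moreover have "dist y (P z) \<le> dist y z + dist z (P z)" by (rule dist_triangle)
      ultimately show False using y by simp
    qed
    then show ?thesis using gap by (intro exI[of _ "(dist z x - dist z (P z)) / 2"]) auto
  qed
qed

lemma filterlim_proj:
  assumes "z \<in> closure T"
  shows "filterlim P (nhds (P z)) (nhds z)"
  using isCont_proj[OF assms] by (simp add: isCont_def tendsto_at_iff_tendsto_nhds)

text \<open>A local defining function together with its normalised gradient \<nu> on a full
  neighbourhood. Off \<Gamma> the field \<nu> generally differs from \<open>n\<close>, because level
  sets of \<psi> need not be parallel to \<Gamma>; the two are linked by n z = \<nu> (P z).
  \<open>D\<nu>\<close> is operator-valued so that its continuity can be used in norm.\<close>

definition chart where
  "chart U \<psi> \<nu> D\<nu> \<longleftrightarrow> open U \<and> continuous_on U (D\<nu> :: real^3 \<Rightarrow> (real^3) \<Rightarrow>\<^sub>L (real^3)) \<and>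
    (\<forall>x\<in>U. norm (\<nu> x) = 1 \<and> (\<nu> has_derivative blinfun_apply (D\<nu> x)) (at x) \<and>
      (\<exists>c>0. (\<psi> has_derivative (\<lambda>h. c * (h \<bullet> \<nu> x))) (at x))) \<and>
    \<Omega> \<inter> U = {x\<in>U. \<psi> x < (0::real)} \<and> \<Gamma> \<inter> U = {x\<in>U. \<psi> x = 0}"

lemma chart_exists:
  assumes "x \<in> \<Gamma>"
  obtains U \<psi> \<nu> D\<nu> where "x \<in> U" "chart U \<psi> \<nu> D\<nu>"
proof -
  obtain U \<psi> where "open U \<and> x \<in> U \<and> C2_on U \<psi> \<and> (\<forall>z\<in>U. grad \<psi> z \<noteq> 0) \<and>
     \<Omega> \<inter> U = {z\<in>U. \<psi> z < 0} \<and> \<Gamma> \<inter> U = {z\<in>U. \<psi> z = 0}"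
    using bspec[OF C2_boundary[unfolded C2_boundary_def] assms] by (elim exE)
  then have U: "open U" "x \<in> U" "C2_on U \<psi>" "\<And>z. z \<in> U \<Longrightarrow> grad \<psi> z \<noteq> 0"
     "\<Omega> \<inter> U = {z\<in>U. \<psi> z < 0}" "\<Gamma> \<inter> U = {z\<in>U. \<psi> z = 0}"
    by simp_all
  define \<nu> where "\<nu> x = inverse (norm (grad \<psi> x)) *\<^sub>R grad \<psi> x" for x
  have g: "C1_map U (grad \<psi>)" using C2_on_grad(2)[OF U(3,1)] .
  have "C1_map U \<nu>" unfolding \<nu>_def
    by (intro C1_map_scaleR C1_map_inverse_norm g U(4))
  then obtain D\<nu> where D: "\<And>x. x \<in> U \<Longrightarrow> (\<nu> has_derivative blinfun_apply (D\<nu> x)) (at x)" "continuous_on U D\<nu>"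
    unfolding C1_map_def by blast
  have 1: "norm (\<nu> x) = 1" if "x \<in> U" for x
    using U(4)[OF that] by (simp add: \<nu>_def)
  have 2: "\<exists>c>0. (\<psi> has_derivative (\<lambda>h. c * (h \<bullet> \<nu> x))) (at x)" if "x \<in> U" for x
    using C2_on_grad(1)[OF U(3) that] U(4)[OF that]
    by (intro exI[of _ "norm (grad \<psi> x)"]) (simp add: \<nu>_def mult.assoc[symmetric])
  show ?thesis
    by (rule that[OF U(2), of \<psi> \<nu> D\<nu>]) (use U D 1 2 in \<open>simp add: chart_def\<close>)
qed

lemma chart_inner_deriv_eq_0:
  assumes "chart U \<psi> \<nu> D\<nu>" "x \<in> U"
  shows "D\<nu> x h \<bullet> \<nu> x = 0"
proof -
  have U: "open U" and \<nu>: "\<And>y. y \<in> U \<Longrightarrow> \<nu> y \<bullet> \<nu> y = 1"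
    and D: "(\<nu> has_derivative blinfun_apply (D\<nu> x)) (at x)"
    using assms by (auto simp: chart_def norm_eq_1)
  have "((\<lambda>y. \<nu> y \<bullet> \<nu> y) has_derivative (\<lambda>h. \<nu> x \<bullet> D\<nu> x h + D\<nu> x h \<bullet> \<nu> x)) (at x)"
    by (rule has_derivative_inner[OF D D])
  moreover have "((\<lambda>y. \<nu> y \<bullet> \<nu> y) has_derivative (\<lambda>h. 0)) (at x)"
    by (rule has_derivative_transform_within_open[OF has_derivative_const[of 1] U assms(2)]) (simp add: \<nu>)
  ultimately have "(\<lambda>h. \<nu> x \<bullet> D\<nu> x h + D\<nu> x h \<bullet> \<nu> x) = (\<lambda>h. 0)"
    by (rule has_derivative_unique)
  then have "\<nu> x \<bullet> D\<nu> x h + D\<nu> x h \<bullet> \<nu> x = 0" by meson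
  then show ?thesis by (simp add: inner_commute)
qed

lemma ball_disjoint_boundary: "y \<in> ball z (dist z (P z)) \<Longrightarrow> y \<notin> \<Gamma>"
  using dist_proj_le[of y z] by auto

text \<open>The open ball around \<open>z\<close> touching \<open>\<Gamma>\<close> at \<open>P z\<close> lies on one side of \<open>\<Gamma>\<close>, so that
  \<open>\<psi>\<close> has a sign on it and its gradient at \<open>P z\<close> must point along the radius.\<close>

lemma proj_add_normal:
  assumes ch: "chart U \<psi> \<nu> D\<nu>" and PU: "P z \<in> U"
  shows "P z + d z *\<^sub>R \<nu> (P z) = z"
proof (cases "dist z (P z) = 0")
  case True
  then show ?thesis using abs_signed_dist_eq[of z] by simp
next
  case False
  define x where "x = P z"
  define r where "r = dist z x"
  define s :: real where "s = (if z \<in> \<Omega> then -1 else 1)"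
  define e where "e = (1 / r) *\<^sub>R (z - x)"
  have r: "r > 0" using False by (simp add: r_def x_def)
  have dz: "d z = s * r"
    by (simp add: signed_dist_def s_def r_def x_def infdist_eq)
  have s2: "s * s = 1" "s = 1 \<or> s = -1" by (auto simp: s_def)
  have xU: "x \<in> U" "x \<in> \<Gamma>" using PU proj_in by (auto simp: x_def)
  obtain c where c: "c > 0" "(\<psi> has_derivative (\<lambda>h. c * (h \<bullet> \<nu> x))) (at x)"
    and U: "open U" "\<Omega> \<inter> U = {x\<in>U. \<psi> x < 0}" "\<Gamma> \<inter> U = {x\<in>U. \<psi> x = 0}" and n1: "norm (\<nu> x) = 1"
    using ch xU unfolding chart_def by blast
  have e1: "norm e = 1" using r by (simp add: e_def r_def dist_norm)
  have side: "y \<in> \<Omega> \<longleftrightarrow> z \<in> \<Omega>" if "y \<in> ball z r" for y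
  proof -
    have "ball z r \<inter> \<Gamma> = {}"
      using ball_disjoint_boundary by (auto simp: r_def x_def)
    then have "ball z r \<inter> \<Omega> = {} \<or> ball z r - \<Omega> = {}"
      using connected_Int_frontier[OF connected_ball] by metis
    moreover have "z \<in> ball z r" using r by simp
    ultimately show ?thesis using that by blast
  qed
  \<comment> \<open>A direction \<open>h\<close> with positive component along the radius leads from
    \<open>x\<close> into the open ball for small t > 0. There s \<psi> cannot be negative, so its
    derivative along \<open>h\<close> cannot be negative either.\<close>
  have key: "s * (h \<bullet> \<nu> x) \<ge> 0" if h: "h \<bullet> e > 0" for h
  proof (rule ccontr)
    assume neg: "\<not> s * (h \<bullet> \<nu> x) \<ge> 0"
    have "((\<lambda>t. x + t *\<^sub>R h) has_derivative (\<lambda>t. t *\<^sub>R h)) (at 0)"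
      by (auto intro!: derivative_eq_intros)
    moreover have "(\<psi> has_derivative (\<lambda>h. c * (h \<bullet> \<nu> x))) (at (x + 0 *\<^sub>R h))"
      using c(2) by simp
    ultimately have "((\<lambda>t. \<psi> (x + t *\<^sub>R h)) has_derivative (\<lambda>t. c * ((t *\<^sub>R h) \<bullet> \<nu> x))) (at 0)"
      by (rule has_derivative_compose)
    then have der: "((\<lambda>t. \<psi> (x + t *\<^sub>R h)) has_field_derivative (c * (h \<bullet> \<nu> x))) (at 0)"
      by (rule has_derivative_imp_has_field_derivative) (simp add: mult_ac)
    then have ders: "((\<lambda>t. s * \<psi> (x + t *\<^sub>R h)) has_field_derivative (s * (c * (h \<bullet> \<nu> x)))) (at 0)"
      by (rule DERIV_cmult)
    have "s * (c * (h \<bullet> \<nu> x)) < 0"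
      using neg c(1) by (metis mult.left_commute mult_pos_neg not_le)
    from DERIV_neg_dec_right[OF ders this] obtain a where
      a: "a > 0" "\<And>t. 0 < t \<Longrightarrow> t < a \<Longrightarrow> s * \<psi> (x + t *\<^sub>R h) < s * \<psi> (x + 0 *\<^sub>R h)"
      by auto
    have "\<psi> x = 0" using U(3) xU by blast
    then have a': "s * \<psi> (x + t *\<^sub>R h) < 0" if "0 < t" "t < a" for t
      using a(2)[OF that] by simp
    have "filterlim (\<lambda>t::real. x + t *\<^sub>R h) (nhds (x + 0 *\<^sub>R h)) (at_right 0)"
      by (intro tendsto_intros)
    then have ev1: "\<forall>\<^sub>F t in at_right 0. x + t *\<^sub>R h \<in> U"
      using topological_tendstoD[OF _ U(1)] xU(1) by fastforce
    \<comment> \<open>After multiplication by t > 0 this says |t h - (z - x)|^2 < |z - x|^2, that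
      is, x + t h lies in the ball.\<close>
    have ev2: "\<forall>\<^sub>F t in at_right (0::real). t * (h \<bullet> h) < 2 * (h \<bullet> (z - x))"
    proof -
      have "filterlim (\<lambda>t::real. t * (h \<bullet> h)) (nhds (0 * (h \<bullet> h))) (at_right 0)"
        by (intro tendsto_intros)
      moreover have "0 * (h \<bullet> h) < 2 * (h \<bullet> (z - x))"
        using h r by (simp add: e_def zero_less_divide_iff)
      ultimately show ?thesis by (rule order_tendstoD(2))
    qed
    have ev3: "\<forall>\<^sub>F t in at_right 0. t \<in> {0<..<a}"
      by (rule eventually_at_right_real[OF a(1)])
    obtain t where t: "x + t *\<^sub>R h \<in> U" "t * (h \<bullet> h) < 2 * (h \<bullet> (z - x))" "0 < t" "t < a"
      using eventually_happens[OF eventually_conj[OF ev1 eventually_conj[OF ev2 ev3]]]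
      by (auto simp: trivial_limit_at_right_real)
    have "x + t *\<^sub>R h \<in> ball z r"
    proof -
      have "t * (t * (h \<bullet> h)) < t * (2 * (h \<bullet> (z - x)))"
        using t by (intro mult_strict_left_mono) auto
      then have "(norm (t *\<^sub>R h - (z - x)))\<^sup>2 < (norm (z - x))\<^sup>2"
        by (simp add: power2_norm_eq_inner inner_diff_left inner_diff_right inner_commute algebra_simps)
      then have "norm (t *\<^sub>R h - (z - x)) < norm (z - x)"
        by (rule power2_less_imp_less) simp
      then show ?thesis
        by (simp add: r_def dist_norm norm_minus_commute algebra_simps)
    qed
    from side[OF this] have "x + t *\<^sub>R h \<in> \<Omega> \<longleftrightarrow> z \<in> \<Omega>" .
    moreover have "x + t *\<^sub>R h \<in> \<Omega> \<longleftrightarrow> \<psi> (x + t *\<^sub>R h) < 0"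
      using U(2) t(1) by blast
    ultimately show False
      using a'[OF t(3,4)] by (auto simp: s_def split: if_splits)
  qed
  \<comment> \<open>If the unit vectors e and s \<nu> differed, h = e - s \<nu> would violate
    \<open>key\<close>: h \<bullet> e = 1 - s (e \<bullet> \<nu>) is positive, while s (h \<bullet>
    \<nu>) is its negative.\<close>
  have "e = s *\<^sub>R \<nu> x"
  proof (rule ccontr)
    assume ne: "e \<noteq> s *\<^sub>R \<nu> x"
    have ip: "e \<bullet> e = 1" "\<nu> x \<bullet> \<nu> x = 1" using e1 n1 by (simp_all add: norm_eq_1)
    have "(e - s *\<^sub>R \<nu> x) \<bullet> (e - s *\<^sub>R \<nu> x) > 0" using ne by simp
    then have lt: "e \<bullet> (s *\<^sub>R \<nu> x) < 1"
      using ip s2(1) by (simp add: inner_diff_left inner_diff_right inner_commute algebra_simps)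
    have "(e - s *\<^sub>R \<nu> x) \<bullet> e > 0"
      using lt ip by (simp add: inner_diff_left inner_commute[of "\<nu> x" e])
    from key[OF this] show False
      using lt ip s2(1) by (simp add: inner_diff_left right_diff_distrib mult.assoc[symmetric])
  qed
  moreover have "z - x = r *\<^sub>R e" using r by (simp add: e_def)
  ultimately have "z - x = (s * r) *\<^sub>R \<nu> x" by (simp add: mult.commute)
  then show ?thesis
    unfolding dz x_def by (simp add: algebra_simps)
qed

text \<open>\<open>z \<mapsto> (P z, d z)\<close> is a continuous section of \<open>(x, s) \<mapsto> (x + s \<nu> x, \<psi> x)\<close> over
  \<open>z \<mapsto> (z, 0)\<close>.\<close>

lemma proj_has_derivative:
  assumes z0: "z0 \<in> closure T" and ch: "chart U \<psi> \<nu> D\<nu>" and PU: "P z0 \<in> U"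
    and inj: "\<And>h. h \<bullet> \<nu> (P z0) = 0 \<Longrightarrow> h + d z0 *\<^sub>R D\<nu> (P z0) h = 0 \<Longrightarrow> h = 0"
  obtains P' where "(P has_derivative P') (at z0)"
    "(d has_derivative (\<lambda>h. h \<bullet> \<nu> (P z0))) (at z0)"
    "\<And>h. P' h \<bullet> \<nu> (P z0) = 0"
    "\<And>h. P' h + d z0 *\<^sub>R D\<nu> (P z0) (P' h) = h - (h \<bullet> \<nu> (P z0)) *\<^sub>R \<nu> (P z0)"
proof -
  define x0 where "x0 = P z0"
  define s0 where "s0 = d z0"
  have xU: "x0 \<in> U" using PU by (simp add: x0_def)
  obtain c where U: "open U" "\<Gamma> \<inter> U = {x\<in>U. \<psi> x = 0}" and c: "c > 0" "(\<psi> has_derivative (\<lambda>h. c * (h \<bullet> \<nu> x0))) (at x0)"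
    and n1: "norm (\<nu> x0) = 1" and D: "(\<nu> has_derivative blinfun_apply (D\<nu> x0)) (at x0)"
    using ch xU unfolding chart_def by blast
  have nn: "\<nu> x0 \<bullet> \<nu> x0 = 1" using n1 by (simp add: norm_eq_1)
  have Dn: "D\<nu> x0 h \<bullet> \<nu> x0 = 0" for h by (rule chart_inner_deriv_eq_0[OF ch xU])
  define f where "f p = (fst p + snd p *\<^sub>R \<nu> (fst p), \<psi> (fst p))" for p :: "(real^3) \<times> real"
  define f' where "f' p = (fst p + (s0 *\<^sub>R D\<nu> x0 (fst p) + snd p *\<^sub>R \<nu> x0), c * (fst p \<bullet> \<nu> x0))"
    for p :: "(real^3) \<times> real"
  define g where "g z = (P z, d z)" for z
  define \<iota> where "\<iota> z = (z, 0::real)" for z :: "real^3"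
  have fst': "(fst has_derivative fst) (at p)" and snd': "(snd has_derivative snd) (at p)"
    for p :: "(real^3) \<times> real"
    by (auto intro!: derivative_eq_intros)
  have f: "(f has_derivative f') (at (g z0))"
  proof -
    have g0: "fst (g z0) = x0" "snd (g z0) = s0" by (simp_all add: g_def x0_def s0_def)
    have 1: "((\<lambda>p. \<nu> (fst p)) has_derivative (\<lambda>h. D\<nu> x0 (fst h))) (at (g z0))"
      using has_derivative_compose[OF fst'] D g0 by metis
    have 2: "((\<lambda>p. \<psi> (fst p)) has_derivative (\<lambda>h. c * (fst h \<bullet> \<nu> x0))) (at (g z0))"
      by (rule has_derivative_compose[OF fst']) (use c(2) g0 in simp)
    have 3: "((\<lambda>p. snd p *\<^sub>R \<nu> (fst p)) has_derivative
        (\<lambda>h. s0 *\<^sub>R D\<nu> x0 (fst h) + snd h *\<^sub>R \<nu> x0)) (at (g z0))"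
      using has_derivative_scaleR[OF snd' 1] g0 by simp
    show ?thesis
      unfolding f_def f'_def by (intro has_derivative_Pair has_derivative_add fst' 2 3)
  qed
  interpret f': bounded_linear f' using f by (rule has_derivative_bounded_linear)
  \<comment> \<open>The inner product with \<nu> isolates \<open>snd p\<close>, since the derivative
    of a unit field is orthogonal to it; the remaining tangential equation is the one in
    \<open>inj\<close>.\<close>
  have "p = 0" if p: "f' p = 0" for p
  proof -
    have p0: "fst p \<bullet> \<nu> x0 = 0" "fst p + (s0 *\<^sub>R D\<nu> x0 (fst p) + snd p *\<^sub>R \<nu> x0) = 0"
      using p c(1) by (auto simp: f'_def prod_eq_iff)
    then have "(fst p + (s0 *\<^sub>R D\<nu> x0 (fst p) + snd p *\<^sub>R \<nu> x0)) \<bullet> \<nu> x0 = 0" by simp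
    then have "snd p = 0" using p0(1) Dn nn by (simp add: inner_add_left)
    then have "fst p = 0" using inj[of "fst p"] p0 by (simp add: x0_def s0_def)
    then show "p = 0" using \<open>snd p = 0\<close> by (simp add: prod_eq_iff)
  qed
  then have "inj f'" using f'.linear_axioms linear_injective_0 by blast
  then obtain g' where g': "linear g'" "g' \<circ> f' = id"
    using linear_injective_left_inverse f'.linear_axioms by blast
  have gf: "g' (f' h) = h" for h using g'(2) by (metis comp_apply id_apply)
  have blg: "bounded_linear g'" using g'(1) by (simp add: linear_conv_bounded_linear)
  have \<iota>': "(\<iota> has_derivative \<iota>) (at z)" for z
    unfolding \<iota>_def by (auto intro!: has_derivative_Pair derivative_eq_intros)
  \<comment> \<open>Holds on a full neighbourhood of \<open>z0\<close>, also beyond the tube,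
    because it needs only P z \<in> U.\<close>
  have ev: "\<forall>\<^sub>F z in nhds z0. f (g z) = \<iota> z"
  proof -
    have "\<forall>\<^sub>F x in nhds (P z0). x \<in> U" using PU U(1) by (rule eventually_nhds_in_open[rotated])
    from eventually_compose_filterlim[OF this filterlim_proj[OF z0]]
    show ?thesis
    proof eventually_elim
      case (elim z)
      then have "P z + d z *\<^sub>R \<nu> (P z) = z" by (rule proj_add_normal[OF ch])
      moreover have "\<psi> (P z) = 0" using U(2) elim proj_in by blast
      ultimately show ?case by (simp add: f_def g_def \<iota>_def)
    qed
  qed
  have gc: "continuous (at z0) g"
    unfolding g_def using isCont_proj[OF z0] isCont_signed_dist by (intro continuous_Pair)
  define H where "H h = g' (\<iota> h)" for h
  have H: "(g has_derivative H) (at z0)"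
    unfolding H_def by (rule has_derivative_section[OF f blg gf gc \<iota>' ev])
  \<comment> \<open>The left inverse was an arbitrary choice. The chain rule for f (g z) = \<iota> z
    gives equations for \<open>H\<close> in which it no longer occurs.\<close>
  have fH: "f' (H h) = \<iota> h" for h
  proof -
    have 1: "((\<lambda>z. f (g z)) has_derivative (\<lambda>h. f' (H h))) (at z0)"
      by (rule has_derivative_compose[OF H f])
    have "((\<lambda>z. f (g z)) has_derivative \<iota>) (at z0)"
    proof (rule has_derivative_transform_eventually[OF \<iota>'])
      show "\<forall>\<^sub>F z in at z0. \<iota> z = f (g z)"
        using ev by (auto simp: eventually_at_filter elim: eventually_mono)
      show "\<iota> z0 = f (g z0)" using eventually_nhds_x_imp_x[OF ev] by simp
    qed simp
    from has_derivative_unique[OF 1 this] show ?thesis by meson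
  qed
  have P'd': "(P has_derivative (\<lambda>h. fst (H h))) (at z0)" "(d has_derivative (\<lambda>h. snd (H h))) (at z0)"
    using has_derivative_fst[OF H] has_derivative_snd[OF H] by (simp_all add: g_def)
  have A: "fst (H h) + (s0 *\<^sub>R D\<nu> x0 (fst (H h)) + snd (H h) *\<^sub>R \<nu> x0) = h" and B: "fst (H h) \<bullet> \<nu> x0 = 0" for h
    using fH[of h] c(1) by (auto simp: f'_def \<iota>_def)
  have C: "snd (H h) = h \<bullet> \<nu> x0" for h
  proof -
    have "(fst (H h) + (s0 *\<^sub>R D\<nu> x0 (fst (H h)) + snd (H h) *\<^sub>R \<nu> x0)) \<bullet> \<nu> x0 = h \<bullet> \<nu> x0"
      using A by simp
    then show ?thesis using B[of h] Dn nn by (simp add: inner_add_left)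
  qed
  show ?thesis
  proof (rule that[of "\<lambda>h. fst (H h)"])
    show "(P has_derivative (\<lambda>h. fst (H h))) (at z0)" by fact
    show "(d has_derivative (\<lambda>h. h \<bullet> \<nu> (P z0))) (at z0)"
      using P'd'(2) unfolding C x0_def .
    show "fst (H h) \<bullet> \<nu> (P z0) = 0" for h using B by (simp add: x0_def)
    show "fst (H h) + d z0 *\<^sub>R D\<nu> (P z0) (fst (H h)) = h - (h \<bullet> \<nu> (P z0)) *\<^sub>R \<nu> (P z0)" for h
      using A[of h] unfolding C x0_def s0_def by (simp add: algebra_simps)
  qed
qed

text \<open>Breaks a circularity: the principal curvatures are derivatives of \<open>n\<close>,
  hence of the gradient of \<open>d\<close>, so the bound on them says nothing about
  \<open>D\<nu>\<close> before \<open>n\<close> is known near \<Gamma>. Close to \<Gamma> the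
  required injectivity follows instead from |d| times the norm of \<open>D\<nu>\<close> being less
  than 1.\<close>

lemma eventually_normal_eq_chart:
  assumes x0: "x0 \<in> \<Gamma>" and ch: "chart U \<psi> \<nu> D\<nu>" and xU: "x0 \<in> U"
  shows "\<forall>\<^sub>F z in nhds x0. n z = \<nu> (P z)"
proof -
  have x0T: "x0 \<in> T" using x0 boundary_subset by blast
  then have x0c: "x0 \<in> closure T" using closure_subset by blast
  have Px0: "P x0 = x0" by (rule proj_boundary[OF x0])
  have U: "open U" and Dc: "continuous_on U D\<nu>" using ch by (auto simp: chart_def)
  have ev1: "\<forall>\<^sub>F z in nhds x0. z \<in> T" by (rule eventually_nhds_in_open[OF open_tube x0T])
  have "\<forall>\<^sub>F x in nhds (P x0). x \<in> U" using xU U Px0 by (simp add: eventually_nhds_in_open)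
  from eventually_compose_filterlim[OF this filterlim_proj[OF x0c]]
  have ev2: "\<forall>\<^sub>F z in nhds x0. P z \<in> U" .
  have "isCont D\<nu> (P x0)" using Dc U xU Px0 continuous_on_eq_continuous_at by metis
  then have iD: "isCont (\<lambda>z. D\<nu> (P z)) x0"
    using isCont_o2[OF isCont_proj[OF x0c]] by blast
  define q where "q z = \<bar>d z\<bar> * norm (D\<nu> (P z))" for z
  have "isCont q x0"
    unfolding q_def using iD isCont_signed_dist by (intro continuous_intros)
  then have "(q \<longlongrightarrow> q x0) (nhds x0)"
    unfolding isCont_def tendsto_at_iff_tendsto_nhds .
  moreover have "q x0 < 1" using signed_dist_boundary[OF x0] by (simp add: q_def)
  ultimately have ev3: "\<forall>\<^sub>F z in nhds x0. q z < 1"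
    by (rule order_tendstoD)
  from ev1 ev2 ev3 show ?thesis
  proof eventually_elim
    case (elim z)
    have zc: "z \<in> closure T" using elim(1) closure_subset by blast
    have inj: "h = 0" if "h + d z *\<^sub>R D\<nu> (P z) h = 0" for h
    proof (rule ccontr)
      assume "h \<noteq> 0"
      have "norm h = \<bar>d z\<bar> * norm (D\<nu> (P z) h)"
        using that by (metis add_eq_0_iff norm_minus_cancel norm_scaleR)
      also have "\<dots> \<le> \<bar>d z\<bar> * (norm (D\<nu> (P z)) * norm h)"
        by (intro mult_left_mono norm_blinfun) auto
      also have "\<dots> < 1 * norm h"
        using elim(3) \<open>h \<noteq> 0\<close> unfolding q_def by (simp only: mult.assoc[symmetric]) (intro mult_strict_right_mono, auto)
      finally show False by simp
    qed
    have "(d has_derivative (\<lambda>h. h \<bullet> \<nu> (P z))) (at z)"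
      using proj_has_derivative[OF zc ch elim(2)] inj by metis
    then show ?case unfolding normal_def by (rule grad_eqI)
  qed
qed

section \<open>Principal frames and the derivatives of \<open>P\<close> and \<open>n\<close>\<close>

lemma frame_facts:
  assumes "x \<in> \<Gamma>"
  shows "norm (t\<^sub>1 x) = 1" "norm (t\<^sub>2 x) = 1" "t\<^sub>1 x \<bullet> t\<^sub>2 x = 0" "t\<^sub>1 x \<bullet> n x = 0" "t\<^sub>2 x \<bullet> n x = 0"
  using frame assms by (auto simp: principal_frame_def)

text \<open>Near \<open>x0\<close> the normal is \<nu> composed with \<open>P\<close>, and on
  \<Gamma> the derivative of \<open>P\<close> is the orthogonal projection to the tangent plane. So
  the ambient derivatives of \<open>n\<close> prescribed by the frame are values of
  \<open>D\<nu>\<close>, and the frame diagonalises it.\<close>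

lemma normal_boundary:
  assumes x0: "x0 \<in> \<Gamma>" and ch: "chart U \<psi> \<nu> D\<nu>" and xU: "x0 \<in> U"
  shows "n x0 = \<nu> x0" "norm (n x0) = 1"
    "D\<nu> x0 (t\<^sub>1 x0) = \<kappa>\<^sub>1 x0 *\<^sub>R t\<^sub>1 x0" "D\<nu> x0 (t\<^sub>2 x0) = \<kappa>\<^sub>2 x0 *\<^sub>R t\<^sub>2 x0"
proof -
  have x0c: "x0 \<in> closure T" using x0 boundary_subset closure_subset by blast
  have Px0: "P x0 = x0" and d0: "d x0 = 0" using proj_boundary signed_dist_boundary x0 by auto
  note ev = eventually_normal_eq_chart[OF assms]
  show nx: "n x0 = \<nu> x0" using eventually_nhds_x_imp_x[OF ev] Px0 by simp
  then show "norm (n x0) = 1" using ch xU by (simp add: chart_def)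
  have D: "(\<nu> has_derivative blinfun_apply (D\<nu> x0)) (at x0)" using ch xU by (simp add: chart_def)
  obtain P' where P': "(P has_derivative P') (at x0)"
     "\<And>h. P' h + d x0 *\<^sub>R D\<nu> (P x0) (P' h) = h - (h \<bullet> \<nu> (P x0)) *\<^sub>R \<nu> (P x0)"
    by (rule proj_has_derivative[OF x0c ch]) (use xU Px0 d0 in auto)
  have P'eq: "P' h = h - (h \<bullet> n x0) *\<^sub>R n x0" for h
    using P'(2)[of h] by (simp add: d0 Px0 nx)
  have "((\<lambda>z. \<nu> (P z)) has_derivative (\<lambda>h. D\<nu> x0 (P' h))) (at x0)"
    by (rule has_derivative_compose[OF P'(1)]) (simp add: Px0 D)
  then have n': "(n has_derivative (\<lambda>h. D\<nu> x0 (P' h))) (at x0)"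
  proof (rule has_derivative_transform_eventually)
    show "\<forall>\<^sub>F z in at x0. \<nu> (P z) = n z"
      using ev by (auto simp: eventually_at_filter elim: eventually_mono)
  qed (simp_all add: nx Px0)
  have tang: "D\<nu> x0 t = k *\<^sub>R t" if t: "t \<bullet> n x0 = 0"
    and v: "((\<lambda>s. n (x0 + s *\<^sub>R t)) has_vector_derivative k *\<^sub>R t) (at 0)" for t k
  proof -
    have "((\<lambda>s. x0 + s *\<^sub>R t) has_derivative (\<lambda>s. s *\<^sub>R t)) (at 0)"
      by (auto intro!: derivative_eq_intros)
    then have "((\<lambda>s. n (x0 + s *\<^sub>R t)) has_derivative (\<lambda>s. D\<nu> x0 (P' (s *\<^sub>R t)))) (at 0)"
      by (rule has_derivative_compose) (simp add: n')
    from has_derivative_unique[OF this v[unfolded has_vector_derivative_def]]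
    have "D\<nu> x0 (P' (1 *\<^sub>R t)) = 1 *\<^sub>R (k *\<^sub>R t)" by meson
    then show ?thesis using t by (simp add: P'eq)
  qed
  show "D\<nu> x0 (t\<^sub>1 x0) = \<kappa>\<^sub>1 x0 *\<^sub>R t\<^sub>1 x0" "D\<nu> x0 (t\<^sub>2 x0) = \<kappa>\<^sub>2 x0 *\<^sub>R t\<^sub>2 x0"
    using tang frame x0 by (auto simp: principal_frame_def)
qed

lemma norm_normal: "x \<in> \<Gamma> \<Longrightarrow> norm (n x) = 1"
  using chart_exists normal_boundary(2) by metis

lemma frame_expansion:
  assumes "x \<in> \<Gamma>"
  shows "(v \<bullet> t\<^sub>1 x) *\<^sub>R t\<^sub>1 x + (v \<bullet> t\<^sub>2 x) *\<^sub>R t\<^sub>2 x + (v \<bullet> n x) *\<^sub>R n x = v"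
  using orthonormal_expansion frame_facts[OF assms] norm_normal[OF assms] by blast

lemma frame_inner:
  assumes "x \<in> \<Gamma>"
  shows "t\<^sub>1 x \<bullet> t\<^sub>1 x = 1" "t\<^sub>2 x \<bullet> t\<^sub>2 x = 1" "n x \<bullet> n x = 1" "t\<^sub>1 x \<bullet> t\<^sub>2 x = 0" "t\<^sub>2 x \<bullet> t\<^sub>1 x = 0"
    "t\<^sub>1 x \<bullet> n x = 0" "t\<^sub>2 x \<bullet> n x = 0" "n x \<bullet> t\<^sub>1 x = 0" "n x \<bullet> t\<^sub>2 x = 0"
  using frame_facts[OF assms] norm_normal[OF assms] by (simp_all add: norm_eq_1 inner_commute)

abbreviation "\<sigma>\<^sub>1 \<equiv> sigma \<Omega> \<kappa>\<^sub>1"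
abbreviation "\<sigma>\<^sub>2 \<equiv> sigma \<Omega> \<kappa>\<^sub>2"

text \<open>Candidate for the derivative of \<open>P\<close>: orthogonal projection to the tangent
  plane at \<open>P z\<close>, followed by the inverse of id + d z D\<nu>(P z) there. Written in the
  frame, it refers to no chart.\<close>

definition DP where
  "DP z h = (\<sigma>\<^sub>1 z * (h \<bullet> t\<^sub>1 (P z))) *\<^sub>R t\<^sub>1 (P z) + (\<sigma>\<^sub>2 z * (h \<bullet> t\<^sub>2 (P z))) *\<^sub>R t\<^sub>2 (P z)"

definition Dn where
  "Dn z h = (\<kappa>\<^sub>1 (P z) * \<sigma>\<^sub>1 z * (h \<bullet> t\<^sub>1 (P z))) *\<^sub>R t\<^sub>1 (P z) +
    (\<kappa>\<^sub>2 (P z) * \<sigma>\<^sub>2 z * (h \<bullet> t\<^sub>2 (P z))) *\<^sub>R t\<^sub>2 (P z)"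

lemma one_plus_curv_pos:
  assumes "z \<in> closure T"
  shows "1 + d z * \<kappa>\<^sub>1 (P z) \<ge> 1 - \<epsilon> * \<kappa>\<^sub>m" "1 + d z * \<kappa>\<^sub>2 (P z) \<ge> 1 - \<epsilon> * \<kappa>\<^sub>m"
proof -
  have *: "\<bar>d z * k\<bar> \<le> \<epsilon> * \<kappa>\<^sub>m" if "\<bar>k\<bar> \<le> \<kappa>\<^sub>m" for k
    unfolding abs_mult using closure_tube[OF assms] that \<epsilon>_pos by (intro mult_mono) auto
  show "1 + d z * \<kappa>\<^sub>1 (P z) \<ge> 1 - \<epsilon> * \<kappa>\<^sub>m" "1 + d z * \<kappa>\<^sub>2 (P z) \<ge> 1 - \<epsilon> * \<kappa>\<^sub>m"
    using *[of "\<kappa>\<^sub>1 (P z)"] *[of "\<kappa>\<^sub>2 (P z)"] curv proj_in[of z] by auto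
qed

lemma sigma_bounds:
  assumes "z \<in> closure T"
  shows "0 < \<sigma>\<^sub>1 z" "0 < \<sigma>\<^sub>2 z" "\<sigma>\<^sub>1 z \<le> inverse (1 - \<epsilon> * \<kappa>\<^sub>m)" "\<sigma>\<^sub>2 z \<le> inverse (1 - \<epsilon> * \<kappa>\<^sub>m)"
  using one_plus_curv_pos[OF assms] \<epsilon>_small by (auto simp: sigma_def intro!: le_imp_inverse_le)

text \<open>In the principal frame the equation decouples into two scalar ones with factors 1 + d
  \<open>\<kappa>\<^sub>i\<close>, positive on the closed tube. For w = 0 this is the injectivity
  asked for by \<open>proj_has_derivative\<close>.\<close>

lemma DP_eqI:
  assumes z: "z \<in> closure T" and ch: "chart U \<psi> \<nu> D\<nu>" and PU: "P z \<in> U"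
    and h: "h \<bullet> \<nu> (P z) = 0" "h + d z *\<^sub>R D\<nu> (P z) h = w"
  shows "h = DP z w"
proof -
  note nb = normal_boundary[OF proj_in ch PU]
  note fi = frame_inner[OF proj_in[of z]]
  define a b where "a = h \<bullet> t\<^sub>1 (P z)" and "b = h \<bullet> t\<^sub>2 (P z)"
  have he: "h = a *\<^sub>R t\<^sub>1 (P z) + b *\<^sub>R t\<^sub>2 (P z)"
    using frame_expansion[OF proj_in[of z], of h] h(1) by (simp add: nb(1) a_def b_def)
  have "D\<nu> (P z) h = (a * \<kappa>\<^sub>1 (P z)) *\<^sub>R t\<^sub>1 (P z) + (b * \<kappa>\<^sub>2 (P z)) *\<^sub>R t\<^sub>2 (P z)"
    by (subst he) (simp add: blinfun.add_right blinfun.scaleR_right nb(3,4))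
  with h(2) have w: "w = (a * (1 + d z * \<kappa>\<^sub>1 (P z))) *\<^sub>R t\<^sub>1 (P z) + (b * (1 + d z * \<kappa>\<^sub>2 (P z))) *\<^sub>R t\<^sub>2 (P z)"
    by (subst (asm) he) (simp add: algebra_simps)
  have w12: "w \<bullet> t\<^sub>1 (P z) = a * (1 + d z * \<kappa>\<^sub>1 (P z))" "w \<bullet> t\<^sub>2 (P z) = b * (1 + d z * \<kappa>\<^sub>2 (P z))"
    by (simp_all add: w inner_add_left fi)
  have nz: "1 + d z * \<kappa>\<^sub>1 (P z) \<noteq> 0" "1 + d z * \<kappa>\<^sub>2 (P z) \<noteq> 0"
    using one_plus_curv_pos[OF z] \<epsilon>_small by auto
  then have "\<sigma>\<^sub>1 z * (w \<bullet> t\<^sub>1 (P z)) = a" "\<sigma>\<^sub>2 z * (w \<bullet> t\<^sub>2 (P z)) = b"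
    by (simp_all add: w12 sigma_def)
  then show ?thesis by (simp add: DP_def he)
qed

text \<open>With the frame now tied to \<open>D\<nu>\<close>, \<open>DP_eqI\<close> gives
  injectivity on the whole closed tube and identifies the derivative. The linear equation for
  \<open>DP\<close> in a chart is kept as well, because the frame formula alone does not show
  continuity.\<close>

lemma proj_derivative:
  assumes z: "z \<in> closure T"
  shows "(P has_derivative DP z) (at z)" "n z = n (P z)"
    and "chart U \<psi> \<nu> D\<nu> \<Longrightarrow> P z \<in> U \<Longrightarrow> n z = \<nu> (P z)"
    and "chart U \<psi> \<nu> D\<nu> \<Longrightarrow> P z \<in> U \<Longrightarrow> D\<nu> (P z) (DP z h) = Dn z h"
    and "chart U \<psi> \<nu> D\<nu> \<Longrightarrow> P z \<in> U \<Longrightarrow> DP z h + d z *\<^sub>R D\<nu> (P z) (DP z h) = h - (h \<bullet> \<nu> (P z)) *\<^sub>R \<nu> (P z)"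
proof -
  have *: "(P has_derivative DP z) (at z) \<and> n z = \<nu> (P z) \<and>
      DP z h + d z *\<^sub>R D\<nu> (P z) (DP z h) = h - (h \<bullet> \<nu> (P z)) *\<^sub>R \<nu> (P z)"
    if ch: "chart U \<psi> \<nu> D\<nu>" and PU: "P z \<in> U" for U \<psi> \<nu> D\<nu> h
  proof -
    have nP: "\<nu> (P z) = n (P z)" using normal_boundary(1)[OF proj_in ch PU] by simp
    have inj: "h = 0" if "h \<bullet> \<nu> (P z) = 0" "h + d z *\<^sub>R D\<nu> (P z) h = 0" for h
      using DP_eqI[OF z ch PU that] by (simp add: DP_def)
    obtain P' where P': "(P has_derivative P') (at z)"
      "(d has_derivative (\<lambda>h. h \<bullet> \<nu> (P z))) (at z)" "\<And>h. P' h \<bullet> \<nu> (P z) = 0"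
      "\<And>h. P' h + d z *\<^sub>R D\<nu> (P z) (P' h) = h - (h \<bullet> \<nu> (P z)) *\<^sub>R \<nu> (P z)"
      using proj_has_derivative[OF z ch PU inj] by blast
    have "P' h = DP z h" for h
    proof -
      have "P' h = DP z (h - (h \<bullet> \<nu> (P z)) *\<^sub>R \<nu> (P z))"
        by (rule DP_eqI[OF z ch PU P'(3,4)])
      also have "\<dots> = DP z h"
        using frame_inner[OF proj_in[of z]] by (simp add: DP_def nP inner_diff_left)
      finally show ?thesis .
    qed
    then have "P' = DP z" by blast
    then show ?thesis using P' grad_eqI[OF P'(2)] by (simp add: normal_def)
  qed
  obtain U \<psi> \<nu> D\<nu> where ch: "P z \<in> U" "chart U \<psi> \<nu> D\<nu>" using chart_exists[OF proj_in] by blast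
  show "(P has_derivative DP z) (at z)" "n z = n (P z)"
    using *[OF ch(2,1)] normal_boundary(1)[OF proj_in ch(2,1)] by auto
  show "chart U \<psi> \<nu> D\<nu> \<Longrightarrow> P z \<in> U \<Longrightarrow> n z = \<nu> (P z)" for U \<psi> \<nu> D\<nu> using * by blast
  show "chart U \<psi> \<nu> D\<nu> \<Longrightarrow> P z \<in> U \<Longrightarrow> DP z h + d z *\<^sub>R D\<nu> (P z) (DP z h) = h - (h \<bullet> \<nu> (P z)) *\<^sub>R \<nu> (P z)" for U \<psi> \<nu> D\<nu>
    using * by blast
  show "D\<nu> (P z) (DP z h) = Dn z h" if "chart U \<psi> \<nu> D\<nu>" "P z \<in> U" for U \<psi> \<nu> D\<nu>
    using normal_boundary(3,4)[OF proj_in that]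
    by (simp add: DP_def Dn_def blinfun.add_right blinfun.scaleR_right mult_ac)
qed

lemma norm_DP_le:
  assumes "z \<in> closure T"
  shows "norm (DP z h) \<le> 2 * inverse (1 - \<epsilon> * \<kappa>\<^sub>m) * norm h"
proof -
  have "norm ((s * (h \<bullet> t)) *\<^sub>R t) \<le> inverse (1 - \<epsilon> * \<kappa>\<^sub>m) * norm h"
    if "norm t = 1" "0 < s" "s \<le> inverse (1 - \<epsilon> * \<kappa>\<^sub>m)" for s and t :: "real^3"
  proof -
    have "\<bar>h \<bullet> t\<bar> \<le> norm h" using Cauchy_Schwarz_ineq2[of h t] that(1) by simp
    then have "s * \<bar>h \<bullet> t\<bar> \<le> inverse (1 - \<epsilon> * \<kappa>\<^sub>m) * norm h"
      using that \<epsilon>_small by (intro mult_mono) auto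
    then show ?thesis using that by (simp add: abs_mult)
  qed
  from this[OF frame_facts(1)[OF proj_in[of z]] sigma_bounds(1,3)[OF assms]]
    this[OF frame_facts(2)[OF proj_in[of z]] sigma_bounds(2,4)[OF assms]]
  show ?thesis unfolding DP_def by (intro norm_triangle_le) linarith
qed

lemma continuous_on_proj: "continuous_on T P"
  using isCont_proj closure_subset by (intro continuous_at_imp_continuous_on) blast

text \<open>The frame may jump from point to point, so continuity cannot be read off the formula for
  \<open>DP\<close>. It follows from \<open>DP z h\<close> being the solution of a linear equation
  with continuous coefficients, together with the uniform bound \<open>norm_DP_le\<close>.\<close>

lemma continuous_on_DP: "continuous_on T (\<lambda>z. DP z h)"
proof (rule continuous_at_imp_continuous_on, intro ballI)
  fix z0 assume z0T: "z0 \<in> T"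
  then have z0: "z0 \<in> closure T" using closure_subset by blast
  obtain U \<psi> \<nu> D\<nu> where PU: "P z0 \<in> U" and ch: "chart U \<psi> \<nu> D\<nu>" using chart_exists[OF proj_in] by blast
  have U: "open U" and Dc: "continuous_on U D\<nu>" using ch by (auto simp: chart_def)
  have \<nu>d: "(\<nu> has_derivative blinfun_apply (D\<nu> (P z0))) (at (P z0))" using ch PU by (simp add: chart_def)
  define M where "M k = k + d z0 *\<^sub>R D\<nu> (P z0) k" for k
  have linM: "linear M" unfolding M_def
    by (intro linearI) (simp_all add: blinfun.add_right blinfun.scaleR_right algebra_simps)
  have "k = 0" if "M k = 0" for k
  proof -
    have "M k \<bullet> \<nu> (P z0) = 0" using that by simp
    then have "k \<bullet> \<nu> (P z0) = 0"
      by (simp add: M_def inner_add_left chart_inner_deriv_eq_0[OF ch PU])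
    from DP_eqI[OF z0 ch PU this refl] that show "k = 0"
      by (simp add: M_def DP_def)
  qed
  then have "inj M" using linear_injective_0[OF linM] by blast
  then obtain R where R: "linear R" "R \<circ> M = id" using linear_injective_left_inverse[OF linM] by blast
  have RM: "R (M k) = k" for k using R(2) by (metis comp_apply id_apply)
  obtain K where K: "K > 0" "\<And>v. norm (R v) \<le> norm v * K"
    using bounded_linear.pos_bounded R(1) linear_conv_bounded_linear by blast
  define C where "C = 2 * inverse (1 - \<epsilon> * \<kappa>\<^sub>m) * norm h"
  define Q where "Q z = h - (h \<bullet> \<nu> (P z)) *\<^sub>R \<nu> (P z)" for z
  define B where "B z = d z *\<^sub>R D\<nu> (P z)" for z
  have ev1: "\<forall>\<^sub>F z in nhds z0. z \<in> T" by (rule eventually_nhds_in_open[OF open_tube z0T])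
  have "\<forall>\<^sub>F x in nhds (P z0). x \<in> U" using PU U by (simp add: eventually_nhds_in_open)
  from eventually_compose_filterlim[OF this filterlim_proj[OF z0]]
  have ev2: "\<forall>\<^sub>F z in nhds z0. P z \<in> U" .
  have le: "\<forall>\<^sub>F z in nhds z0. norm (DP z h - DP z0 h) \<le> (norm (Q z - Q z0) + norm (B z - B z0) * C) * K"
    using ev1 ev2
  proof eventually_elim
    case (elim z)
    have z: "z \<in> closure T" using elim(1) closure_subset by blast
    have 1: "DP z h + B z (DP z h) = Q z"
      using proj_derivative(5)[OF z ch elim(2)] by (simp add: B_def Q_def blinfun.scaleR_left)
    have 2: "M (DP z0 h) = Q z0"
      using proj_derivative(5)[OF z0 ch PU] by (simp add: M_def Q_def)
    \<comment> \<open>The operator at \<open>z\<close> is treated as a perturbation of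
      \<open>M\<close>, the operator at \<open>z0\<close>, so that the fixed inverse
      \<open>R\<close> serves for all nearby \<open>z\<close>.\<close>
    have 3: "M (DP z h) = Q z - (B z - B z0) (DP z h)"
      using 1 by (simp add: M_def B_def blinfun.diff_left blinfun.scaleR_left algebra_simps)
    have "DP z h - DP z0 h = R (Q z - Q z0 - (B z - B z0) (DP z h))"
      using RM[of "DP z h"] RM[of "DP z0 h"] unfolding 2 3 by (simp add: linear_diff[OF R(1)])
    then have "norm (DP z h - DP z0 h) \<le> norm (Q z - Q z0 - (B z - B z0) (DP z h)) * K"
      using K(2) by simp
    also have "norm (Q z - Q z0 - (B z - B z0) (DP z h)) \<le> norm (Q z - Q z0) + norm ((B z - B z0) (DP z h))"
      by (rule norm_triangle_ineq4)
    also have "norm ((B z - B z0) (DP z h)) \<le> norm (B z - B z0) * norm (DP z h)"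
      by (rule norm_blinfun)
    also have "\<dots> \<le> norm (B z - B z0) * C"
      unfolding C_def by (intro mult_left_mono norm_DP_le z) auto
    finally show ?case using K(1) by simp
  qed
  have ip: "isCont P z0" by (rule isCont_proj[OF z0])
  have i\<nu>: "isCont (\<lambda>z. \<nu> (P z)) z0"
    using isCont_o2[OF ip has_derivative_continuous[OF \<nu>d]] .
  have "isCont D\<nu> (P z0)" using Dc U PU continuous_on_eq_continuous_at by blast
  then have iD: "isCont (\<lambda>z. D\<nu> (P z)) z0" using isCont_o2[OF ip] by blast
  have "isCont Q z0" "isCont B z0"
    unfolding Q_def B_def using i\<nu> iD isCont_signed_dist by (auto intro!: continuous_intros)
  then have "isCont (\<lambda>z. (norm (Q z - Q z0) + norm (B z - B z0) * C) * K) z0"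
    by (intro continuous_intros)
  then have lim: "(\<lambda>z. (norm (Q z - Q z0) + norm (B z - B z0) * C) * K) \<midarrow>z0\<rightarrow> 0"
    by (simp add: isCont_def)
  have "(\<lambda>z. DP z h - DP z0 h) \<midarrow>z0\<rightarrow> 0"
    by (rule Lim_null_comparison[OF _ lim]) (use le in \<open>simp add: eventually_at_filter eventually_mono\<close>)
  then show "isCont (\<lambda>z. DP z h) z0"
    unfolding isCont_def by (rule LIM_zero_cancel)
qed

lemma C1_map_proj: "C1_map T P"
proof (rule C1_mapI[OF _ continuous_on_DP])
  show "(P has_derivative DP z) (at z)" if "z \<in> T" for z
    using proj_derivative(1) that closure_subset by blast
qed

lemma open_proj_neighborhood:
  assumes "z0 \<in> T" "open V" "P z0 \<in> V"
  shows "\<exists>W. open W \<and> z0 \<in> W \<and> W \<subseteq> T \<and> P ` W \<subseteq> V"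
proof (intro exI conjI)
  show "open (T \<inter> P -` V)"
    using continuous_on_proj open_tube assms(2) by (rule continuous_open_preimage)
qed (use assms in auto)

lemma normal_has_derivative:
  assumes z0: "z0 \<in> T"
  shows "(n has_derivative Dn z0) (at z0)"
proof -
  have z0c: "z0 \<in> closure T" using z0 closure_subset by blast
  obtain U \<psi> \<nu> D\<nu> where PU: "P z0 \<in> U" and ch: "chart U \<psi> \<nu> D\<nu>" using chart_exists[OF proj_in] by blast
  obtain W where W: "open W" "z0 \<in> W" "W \<subseteq> T" "P ` W \<subseteq> U"
    using open_proj_neighborhood[OF z0 _ PU] ch unfolding chart_def by blast
  have "(\<nu> has_derivative blinfun_apply (D\<nu> (P z0))) (at (P z0))" using ch PU by (simp add: chart_def)
  with has_derivative_compose[OF proj_derivative(1)[OF z0c]]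
  have "((\<lambda>z. \<nu> (P z)) has_derivative (\<lambda>h. D\<nu> (P z0) (DP z0 h))) (at z0)" by blast
  then have "((\<lambda>z. \<nu> (P z)) has_derivative Dn z0) (at z0)"
    unfolding proj_derivative(4)[OF z0c ch PU] .
  then show ?thesis
  proof (rule has_derivative_transform_within_open[OF _ W(1,2)])
    fix z assume "z \<in> W"
    then have "z \<in> closure T" "P z \<in> U" using W closure_subset by blast+
    then show "\<nu> (P z) = n z" using proj_derivative(3)[OF _ ch] by simp
  qed
qed

lemma C1_map_normal: "C1_map T n"
proof (rule C1_map_local)
  fix z0 assume z0: "z0 \<in> T"
  obtain U \<psi> \<nu> D\<nu> where PU: "P z0 \<in> U" and ch: "chart U \<psi> \<nu> D\<nu>" using chart_exists[OF proj_in] by blast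
  obtain W where W: "open W" "z0 \<in> W" "W \<subseteq> T" "P ` W \<subseteq> U"
    using open_proj_neighborhood[OF z0 _ PU] ch unfolding chart_def by blast
  have "C1_map U \<nu>" using ch unfolding chart_def C1_map_def by blast
  from C1_map_compose[OF C1_map_subset[OF C1_map_proj W(3)] this W(4)]
  have "C1_map W (\<lambda>z. \<nu> (P z))" .
  then have "C1_map W n"
  proof (rule C1_map_cong[OF W(1)])
    fix z assume "z \<in> W"
    then have "z \<in> closure T" "P z \<in> U" using W closure_subset by blast+
    then show "\<nu> (P z) = n z" using proj_derivative(3)[OF _ ch] by simp
  qed
  then show "\<exists>V. open V \<and> z0 \<in> V \<and> C1_map V n" using W by blast
qed

section \<open>Normal extensions and the surface gradient\<close>

lemma proj_proj: "P (P z) = P z"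
  by (rule proj_boundary[OF proj_in])

lemma proj_in_tube: "P z \<in> T"
  using boundary_subset proj_in by blast

lemma tube_subset_closure: "z \<in> T \<Longrightarrow> z \<in> closure T"
  using closure_subset by blast

lemma normal_proj: "z \<in> closure T \<Longrightarrow> n z = n (P z)"
  by (rule proj_derivative(2))

lemma DP_boundary: "DP (P z) h = h - (h \<bullet> n (P z)) *\<^sub>R n (P z)"
proof -
  have "\<sigma>\<^sub>1 (P z) = 1" "\<sigma>\<^sub>2 (P z) = 1"
    by (simp_all add: sigma_def signed_dist_boundary[OF proj_in])
  then show ?thesis
    using frame_expansion[OF proj_in[of z], of h] by (simp add: DP_def proj_proj algebra_simps)
qed

lemma DP_inner: "DP z a \<bullet> b = a \<bullet> DP z b"
  by (simp add: DP_def inner_add_left inner_add_right inner_commute mult_ac)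

lemma DP_normal: "DP z (n (P z)) = 0"
  by (simp add: DP_def frame_inner[OF proj_in])

lemma inner_DP_normal: "DP z h \<bullet> n (P z) = 0"
  by (simp add: DP_inner DP_normal)

lemma DP_diff_scaleR: "DP z (a - c *\<^sub>R b) = DP z a - c *\<^sub>R DP z b"
  by (simp add: DP_def inner_diff_left algebra_simps)

text \<open>f (P z) = f (P (P z)), so the derivative at \<open>P z\<close> determines the one along
  the whole normal segment by the chain rule.\<close>

lemma derivative_normal_extension:
  fixes f :: "real^3 \<Rightarrow> 'b::euclidean_space"
  assumes z: "z \<in> closure T" and f: "((\<lambda>z. f (P z)) has_derivative f') (at (P z))"
  shows "((\<lambda>z. f (P z)) has_derivative (\<lambda>h. f' (DP z h))) (at z)"
  using has_derivative_compose[OF proj_derivative(1)[OF z] f] by (simp add: proj_proj)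

text \<open>The normal extension restricts to \<open>f\<close> on \<Gamma> and is constant along
  normals, so its ambient gradient is tangent and represents the derivative within \<Gamma>.
  Uniqueness holds because the chain rule with \<open>P\<close> sends any derivative within \<Gamma>
  to an ambient derivative.\<close>

lemma surf_grad_eq:
  assumes diff: "(\<lambda>z. f (P z)) differentiable (at (P z))"
  shows "surf_grad \<Omega> f (P z) = grad (\<lambda>z. f (P z)) (P z)"
    and "grad (\<lambda>z. f (P z)) (P z) \<bullet> n (P z) = 0"
proof -
  define x where "x = P z"
  have x: "x \<in> \<Gamma>" "x \<in> closure T" "P x = x"
    using proj_in proj_in_tube tube_subset_closure proj_proj by (auto simp: x_def)
  define G where "G = grad (\<lambda>z. f (P z)) x"
  have G: "((\<lambda>z. f (P z)) has_derivative (\<lambda>h. h \<bullet> G)) (at x)"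
    unfolding G_def x_def by (rule has_derivative_grad[OF diff])
  have Gx: "((\<lambda>z. f (P z)) has_derivative (\<lambda>h. h \<bullet> G)) (at (P x))"
    using G x(3) by simp
  have "((\<lambda>z. f (P z)) has_derivative (\<lambda>h. DP x h \<bullet> G)) (at x)"
    by (rule derivative_normal_extension[OF x(2) Gx])
  from has_derivative_unique[OF G this] have "n x \<bullet> G = DP x (n x) \<bullet> G" by meson
  then have Gn: "G \<bullet> n x = 0" using DP_normal[of x] x(3) by (simp add: inner_commute)
  have "surf_grad \<Omega> f x = G"
    unfolding surf_grad_def
  proof (rule the_equality)
    have "(f has_derivative (\<lambda>h. h \<bullet> G)) (at x within \<Gamma>)"
      by (rule has_derivative_transform[OF x(1) _ has_derivative_at_withinI[OF G]])
        (simp add: proj_boundary)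
    moreover have "(\<lambda>h. h \<bullet> G) = (\<bullet>) G" by (auto simp: inner_commute)
    ultimately show "G \<bullet> n x = 0 \<and> (f has_derivative (\<bullet>) G) (at x within \<Gamma>)"
      using Gn by simp
  next
    fix g assume g: "g \<bullet> n x = 0 \<and> (f has_derivative (\<bullet>) g) (at x within \<Gamma>)"
    have "(f has_derivative (\<bullet>) g) (at (P x) within range P)"
      using has_derivative_subset[of f "(\<bullet>) g" x \<Gamma> "range P"] g proj_in x(3) by auto
    from has_derivative_in_compose[OF proj_derivative(1)[OF x(2)] this]
    have "((\<lambda>z. f (P z)) has_derivative (\<lambda>h. g \<bullet> DP x h)) (at x)" .
    from has_derivative_unique[OF G this] have eq: "h \<bullet> G = g \<bullet> DP x h" for h by meson
    have "h \<bullet> G = h \<bullet> g" for h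
      using eq[of h] g DP_boundary[of x h] x(3) by (simp add: inner_diff_right inner_commute)
    then show "g = G" by (metis vector_eq_ldot)
  qed
  then show "surf_grad \<Omega> f (P z) = grad (\<lambda>z. f (P z)) (P z)"
    "grad (\<lambda>z. f (P z)) (P z) \<bullet> n (P z) = 0"
    using Gn by (simp_all add: G_def x_def)
qed

lemma grad_normal_extension:
  assumes z: "z \<in> closure T" and V: "open V" "P z \<in> V" "\<forall>y\<in>\<Gamma> \<inter> V. f y = g y"
    and g: "g differentiable (at (P z))"
  shows "(\<lambda>z. f (P z)) differentiable (at z)" "grad (\<lambda>z. f (P z)) z = DP z (grad g (P z))"
proof -
  have 1: "((\<lambda>z. g (P z)) has_derivative (\<lambda>h. DP z h \<bullet> grad g (P z))) (at z)"
    by (rule has_derivative_compose[OF proj_derivative(1)[OF z] has_derivative_grad[OF g]])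
  have "\<forall>\<^sub>F x in nhds (P z). x \<in> V" using V by (simp add: eventually_nhds_in_open)
  from eventually_compose_filterlim[OF this filterlim_proj[OF z]]
  have ev: "\<forall>\<^sub>F y in nhds z. g (P y) = f (P y)"
    by eventually_elim (use V proj_in in auto)
  have 2: "((\<lambda>z. f (P z)) has_derivative (\<lambda>h. DP z h \<bullet> grad g (P z))) (at z)"
  proof (rule has_derivative_transform_eventually[OF 1])
    show "\<forall>\<^sub>F y in at z. g (P y) = f (P y)"
      using ev by (auto simp: eventually_at_filter elim: eventually_mono)
    show "g (P z) = f (P z)" using eventually_nhds_x_imp_x[OF ev] .
  qed simp
  then show "(\<lambda>z. f (P z)) differentiable (at z)" unfolding differentiable_def by blast
  show "grad (\<lambda>z. f (P z)) z = DP z (grad g (P z))"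
    using 2 by (intro grad_eqI) (simp add: DP_inner)
qed

text \<open>The sign of the frame, 1 or -1. No orientation is prescribed, and it may vary with the
  point; in flux and source it occurs squared.\<close>

definition orient where "orient z = cross3 (t\<^sub>1 (P z)) (t\<^sub>2 (P z)) \<bullet> n (P z)"

lemma frame_cross:
  "cross3 (t\<^sub>1 (P z)) (t\<^sub>2 (P z)) = orient z *\<^sub>R n (P z)"
  "cross3 (t\<^sub>1 (P z)) (n (P z)) = - orient z *\<^sub>R t\<^sub>2 (P z)"
  "cross3 (t\<^sub>2 (P z)) (n (P z)) = orient z *\<^sub>R t\<^sub>1 (P z)"
  "orient z * orient z = 1"
proof -
  note fi = frame_inner[OF proj_in[of z]] and fe = frame_expansion[OF proj_in[of z]]
  show c: "cross3 (t\<^sub>1 (P z)) (t\<^sub>2 (P z)) = orient z *\<^sub>R n (P z)"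
    using fe[of "cross3 (t\<^sub>1 (P z)) (t\<^sub>2 (P z))"] by (simp add: dot_cross_self orient_def inner_commute)
  have "cross3 (t\<^sub>1 (P z)) (n (P z)) \<bullet> t\<^sub>2 (P z) = - orient z"
    unfolding orient_def by (simp add: cross3_simps)
  then show "cross3 (t\<^sub>1 (P z)) (n (P z)) = - orient z *\<^sub>R t\<^sub>2 (P z)"
    using fe[of "cross3 (t\<^sub>1 (P z)) (n (P z))"] by (simp add: dot_cross_self inner_commute)
  have "cross3 (t\<^sub>2 (P z)) (n (P z)) \<bullet> t\<^sub>1 (P z) = orient z"
    unfolding orient_def by (simp add: cross3_simps)
  then show "cross3 (t\<^sub>2 (P z)) (n (P z)) = orient z *\<^sub>R t\<^sub>1 (P z)"
    using fe[of "cross3 (t\<^sub>2 (P z)) (n (P z))"] by (simp add: dot_cross_self inner_commute)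
  have "(norm (cross3 (t\<^sub>1 (P z)) (t\<^sub>2 (P z))))\<^sup>2 = 1"
    using norm_cross_dot[of "t\<^sub>1 (P z)" "t\<^sub>2 (P z)"] frame_facts[OF proj_in[of z]] by simp
  then show "orient z * orient z = 1"
    unfolding c using norm_normal[OF proj_in[of z]] by (simp add: power2_eq_square)
qed

lemma cross_normal_inner:
  "cross3 (n (P z)) v \<bullet> t\<^sub>1 (P z) = - orient z * (v \<bullet> t\<^sub>2 (P z))"
  "cross3 (n (P z)) v \<bullet> t\<^sub>2 (P z) = orient z * (v \<bullet> t\<^sub>1 (P z))"
  by (simp_all add: inner_cross3 frame_cross)

lemma grad_proj_cross_normal:
  assumes z: "z \<in> closure T"
  shows "cross3 (grad (\<lambda>y. P y $ p) z) (n z) =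
    (orient z * \<sigma>\<^sub>2 z * t\<^sub>2 (P z) $ p) *\<^sub>R t\<^sub>1 (P z) - (orient z * \<sigma>\<^sub>1 z * t\<^sub>1 (P z) $ p) *\<^sub>R t\<^sub>2 (P z)"
proof -
  have "h \<bullet> grad (\<lambda>y. P y $ p) z =
      h \<bullet> ((\<sigma>\<^sub>1 z * t\<^sub>1 (P z) $ p) *\<^sub>R t\<^sub>1 (P z) + (\<sigma>\<^sub>2 z * t\<^sub>2 (P z) $ p) *\<^sub>R t\<^sub>2 (P z))" for h
    unfolding grad_nth[OF proj_derivative(1)[OF z]] by (simp add: DP_def inner_add_right mult_ac)
  then have "grad (\<lambda>y. P y $ p) z =
      (\<sigma>\<^sub>1 z * t\<^sub>1 (P z) $ p) *\<^sub>R t\<^sub>1 (P z) + (\<sigma>\<^sub>2 z * t\<^sub>2 (P z) $ p) *\<^sub>R t\<^sub>2 (P z)"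
    by (metis vector_eq_ldot)
  then show ?thesis
    by (simp add: normal_proj[OF z] cross_add_left cross_mult_left frame_cross mult_ac)
qed

text \<open>For a tangential field \<open>W = W \<circ> P\<close> put \<open>V = n \<times> W\<close>. Then
  \<open>J A W = \<Sum>\<^sub>p V\<^sub>p (\<nabla>P\<^sub>p \<times> n)\<close> and
  \<open>\<Sum>\<^sub>p \<nabla>V\<^sub>p \<bullet> (\<nabla>P\<^sub>p \<times> n) = J div W\<close>, with the divergence taken at \<open>P z\<close>.\<close>

lemma flux_eq:
  assumes z: "z \<in> closure T" and W: "w \<bullet> n (P z) = 0"
  shows "(\<Sum>p\<in>UNIV. cross3 (n z) w $ p *\<^sub>R cross3 (grad (\<lambda>y. P y $ p) z) (n z)) =
    (\<sigma>\<^sub>2 z * (w \<bullet> t\<^sub>1 (P z))) *\<^sub>R t\<^sub>1 (P z) + (\<sigma>\<^sub>1 z * (w \<bullet> t\<^sub>2 (P z))) *\<^sub>R t\<^sub>2 (P z)"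
proof -
  define V where "V = cross3 (n z) w"
  have V: "V \<bullet> t\<^sub>1 (P z) = - orient z * (w \<bullet> t\<^sub>2 (P z))" "V \<bullet> t\<^sub>2 (P z) = orient z * (w \<bullet> t\<^sub>1 (P z))"
    unfolding V_def normal_proj[OF z] cross_normal_inner by simp_all
  have "(\<Sum>p\<in>UNIV. V $ p *\<^sub>R cross3 (grad (\<lambda>y. P y $ p) z) (n z)) =
      (orient z * \<sigma>\<^sub>2 z * (V \<bullet> t\<^sub>2 (P z))) *\<^sub>R t\<^sub>1 (P z) - (orient z * \<sigma>\<^sub>1 z * (V \<bullet> t\<^sub>1 (P z))) *\<^sub>R t\<^sub>2 (P z)"
    unfolding grad_proj_cross_normal[OF z]
    by (simp add: scaleR_diff_right sum_subtractf inner_vec_def sum_distrib_left mult_ac flip: scaleR_sum_left)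
  also have "\<dots> = (orient z * orient z) *\<^sub>R ((\<sigma>\<^sub>2 z * (w \<bullet> t\<^sub>1 (P z))) *\<^sub>R t\<^sub>1 (P z) + (\<sigma>\<^sub>1 z * (w \<bullet> t\<^sub>2 (P z))) *\<^sub>R t\<^sub>2 (P z))"
    unfolding V by (simp add: scaleR_add_right mult_ac)
  finally show ?thesis by (simp add: V_def frame_cross(4))
qed

lemma trace_frame:
  fixes f :: "real^3 \<Rightarrow> real^3"
  assumes "linear f"
  shows "(\<Sum>i\<in>UNIV. f (axis i 1) $ i) =
    f (t\<^sub>1 (P z)) \<bullet> t\<^sub>1 (P z) + f (t\<^sub>2 (P z)) \<bullet> t\<^sub>2 (P z) + f (n (P z)) \<bullet> n (P z)"
proof -
  have "f (axis i 1) = (t\<^sub>1 (P z) $ i) *\<^sub>R f (t\<^sub>1 (P z)) + (t\<^sub>2 (P z) $ i) *\<^sub>R f (t\<^sub>2 (P z)) + (n (P z) $ i) *\<^sub>R f (n (P z))" for i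
    by (subst frame_expansion[OF proj_in[of z], of "axis i 1", symmetric])
      (simp add: linear_add[OF assms] linear_scale[OF assms] inner_axis')
  then show ?thesis
    by (simp add: inner_vec_def sum.distrib mult.commute)
qed

lemma source_eq:
  assumes z: "z \<in> T" and W: "C1_map T W" and WP: "\<And>y. W (P y) = W y" and Wn: "W z \<bullet> n (P z) = 0"
  shows "(\<Sum>p\<in>UNIV. grad (\<lambda>y. cross3 (n y) (W y) $ p) z \<bullet> cross3 (grad (\<lambda>y. P y $ p) z) (n z)) =
    \<sigma>\<^sub>1 z * \<sigma>\<^sub>2 z * (\<Sum>i\<in>UNIV. grad (\<lambda>y. W y $ i) (P z) $ i)"
proof -
  have zc: "z \<in> closure T" by (rule tube_subset_closure[OF z])
  define W' where "W' = frechet_derivative W (at (P z))"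
  have W': "(W has_derivative W') (at (P z))"
    unfolding W'_def by (rule C1_map_frechet(1)[OF W proj_in_tube])
  have lin: "linear W'" using W' by (rule has_derivative_linear)
  have WP': "(\<lambda>y. W (P y)) = W" using WP by blast
  have comp: "(W has_derivative (\<lambda>h. W' (DP y h))) (at y)" if "y \<in> closure T" "P y = P z" for y
    using derivative_normal_extension[OF that(1), of W W'] W' unfolding WP' that(2) by blast
  \<comment> \<open>\<open>W\<close> is constant along normals, so the normal direction adds nothing
    to the trace and only the two tangential terms remain.\<close>
  have W'n: "W' (n (P z)) = 0"
  proof -
    have "(W has_derivative (\<lambda>h. W' (DP (P z) h))) (at (P z))"
      using comp proj_in_tube tube_subset_closure proj_proj by blast
    from has_derivative_unique[OF W' this] have "W' (n (P z)) = W' (DP (P z) (n (P z)))" by meson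
    then show ?thesis using DP_normal[of "P z"] by (simp add: proj_proj linear_0[OF lin])
  qed
  define V' where "V' h = cross3 (n z) (W' (DP z h)) + cross3 (Dn z h) (W z)" for h
  have V': "((\<lambda>y. cross3 (n y) (W y)) has_derivative V') (at z)"
    unfolding V'_def
    using bounded_bilinear.FDERIV[OF bilinear_conv_bounded_bilinear[THEN iffD1, OF bilinear_cross]
        normal_has_derivative[OF z] comp[OF zc refl]] .
  note fi = frame_inner[OF proj_in[of z]]
  have a: "grad (\<lambda>y. cross3 (n y) (W y) $ p) z \<bullet> h = V' h $ p" for p h
    using grad_nth[OF V'] by (simp add: inner_commute)
  have DPt: "DP z (t\<^sub>1 (P z)) = \<sigma>\<^sub>1 z *\<^sub>R t\<^sub>1 (P z)" "DP z (t\<^sub>2 (P z)) = \<sigma>\<^sub>2 z *\<^sub>R t\<^sub>2 (P z)"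
    "Dn z (t\<^sub>1 (P z)) = (\<kappa>\<^sub>1 (P z) * \<sigma>\<^sub>1 z) *\<^sub>R t\<^sub>1 (P z)" "Dn z (t\<^sub>2 (P z)) = (\<kappa>\<^sub>2 (P z) * \<sigma>\<^sub>2 z) *\<^sub>R t\<^sub>2 (P z)"
    by (simp_all add: DP_def Dn_def fi)
  \<comment> \<open>Here the curvature terms from differentiating \<open>n\<close> drop out: the
    cross product of two tangent vectors is normal, and \<open>Dn\<close> maps each frame vector to
    a multiple of itself.\<close>
  have tt: "cross3 (t\<^sub>1 (P z)) (W z) \<bullet> t\<^sub>2 (P z) = 0" "cross3 (t\<^sub>2 (P z)) (W z) \<bullet> t\<^sub>1 (P z) = 0"
    using Wn by (simp_all add: inner_cross3 frame_cross cross_skew[of "t\<^sub>2 (P z)" "t\<^sub>1 (P z)"])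
  have V12: "V' (t\<^sub>2 (P z)) \<bullet> t\<^sub>1 (P z) = - orient z * \<sigma>\<^sub>2 z * (W' (t\<^sub>2 (P z)) \<bullet> t\<^sub>2 (P z))"
    "V' (t\<^sub>1 (P z)) \<bullet> t\<^sub>2 (P z) = orient z * \<sigma>\<^sub>1 z * (W' (t\<^sub>1 (P z)) \<bullet> t\<^sub>1 (P z))"
    unfolding V'_def normal_proj[OF zc] inner_add_left cross_normal_inner DPt
    by (simp_all add: cross_mult_left tt linear_scale[OF lin])
  have "(\<Sum>p\<in>UNIV. grad (\<lambda>y. cross3 (n y) (W y) $ p) z \<bullet> cross3 (grad (\<lambda>y. P y $ p) z) (n z)) =
      orient z * \<sigma>\<^sub>2 z * (V' (t\<^sub>1 (P z)) \<bullet> t\<^sub>2 (P z)) - orient z * \<sigma>\<^sub>1 z * (V' (t\<^sub>2 (P z)) \<bullet> t\<^sub>1 (P z))"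
    unfolding grad_proj_cross_normal[OF zc] inner_diff_right inner_scaleR_right a
    by (simp add: sum_subtractf inner_vec_def sum_distrib_left mult_ac)
  also have "\<dots> = (orient z * orient z) * (\<sigma>\<^sub>1 z * \<sigma>\<^sub>2 z *
      (W' (t\<^sub>1 (P z)) \<bullet> t\<^sub>1 (P z) + W' (t\<^sub>2 (P z)) \<bullet> t\<^sub>2 (P z)))"
    unfolding V12 by (simp add: algebra_simps)
  also have "\<dots> = \<sigma>\<^sub>1 z * \<sigma>\<^sub>2 z * (\<Sum>i\<in>UNIV. W' (axis i 1) $ i)"
    unfolding trace_frame[OF lin, of z] by (simp add: frame_cross(4) W'n)
  also have "(\<Sum>i\<in>UNIV. W' (axis i 1) $ i) = (\<Sum>i\<in>UNIV. grad (\<lambda>y. W y $ i) (P z) $ i)"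
    using grad_nth[OF W'] by (simp add: inner_axis' flip: grad_nth[OF W'])
  finally show ?thesis .
qed

lemma Amat_mult_vec:
  assumes "z \<in> closure T"
  shows "Amat \<Omega> t\<^sub>1 t\<^sub>2 \<kappa>\<^sub>1 \<kappa>\<^sub>2 \<mu> z *v v =
    (inverse (\<sigma>\<^sub>1 z) * (v \<bullet> t\<^sub>1 (P z))) *\<^sub>R t\<^sub>1 (P z) + (inverse (\<sigma>\<^sub>2 z) * (v \<bullet> t\<^sub>2 (P z))) *\<^sub>R t\<^sub>2 (P z) +
    (\<mu> * (v \<bullet> n (P z))) *\<^sub>R n (P z)"
  by (simp add: Amat_def matrix_vector_mult_add_rdistrib scaleR_matrix_vector_assoc[symmetric]
      tensor_mult_vec inner_commute normal_proj[OF assms])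

end

section \<open>The extended energy\<close>

locale surface_energy = tubular_neighborhood +
  fixes L :: "real^3 \<Rightarrow> real \<Rightarrow> real^3 \<Rightarrow> real" and u :: "real^3 \<Rightarrow> real"
  assumes L_C2: "C2_on_subset (frontier \<Omega> \<times> UNIV \<times> UNIV) (\<lambda>(x, q, p). L x q p)"
    and L_tan: "\<forall>x\<in>frontier \<Omega>. \<forall>q t. t \<bullet> normal \<Omega> x = 0 \<longrightarrow> L_p L x q t \<bullet> normal \<Omega> x = 0"
    and u_C2: "C2_on_subset (frontier \<Omega>) u"
    and u_EL: "EL_surface \<Omega> L u"
begin

section \<open>Regularity of the extended data and the extended Euler-Lagrange equation\<close>

definition S where "S z = surf_grad \<Omega> u (P z)"
definition W where "W z = L_p L (P z) (u (P z)) (S z)"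

lemma local_extension_u:
  obtains V g where "open V" "P z \<in> V" "C2_on V g" "\<forall>y\<in>\<Gamma> \<inter> V. u y = g y"
proof -
  have "\<exists>V g. open V \<and> P z \<in> V \<and> C2_on V g \<and> (\<forall>y\<in>\<Gamma> \<inter> V. u y = g y)"
    using u_C2 proj_in[of z] unfolding C2_on_subset_def by blast
  then show ?thesis using that by (elim exE conjE) blast
qed

text \<open>The gradient of a local extension \<open>g\<close> of \<open>u\<close> depends on the
  extension, but only through its normal component.\<close>

lemma surf_grad_u_local:
  assumes V: "open V" "C2_on V g" "\<forall>y\<in>\<Gamma> \<inter> V. u y = g y" and PV: "P z \<in> V"
  shows "S z = grad g (P z) - (grad g (P z) \<bullet> n (P z)) *\<^sub>R n (P z)"
    and "z \<in> closure T \<Longrightarrow> (\<lambda>z. u (P z)) differentiable (at z)"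
    and "z \<in> closure T \<Longrightarrow> grad (\<lambda>z. u (P z)) z = DP z (grad g (P z))"
    and "S z \<bullet> n (P z) = 0"
proof -
  have g: "g differentiable (at (P z))"
    using C2_on_grad(1)[OF V(2) PV] unfolding differentiable_def by blast
  have Pc: "P z \<in> closure T" using proj_in_tube tube_subset_closure by blast
  note 1 = grad_normal_extension[OF Pc V(1) _ V(3), unfolded proj_proj, OF PV g]
  have 2: "(\<lambda>z. u (P z)) differentiable (at (P z))" using 1(1) by blast
  have 3: "grad (\<lambda>z. u (P z)) (P z) = DP (P z) (grad g (P z))" using 1(2) by blast
  show "S z = grad g (P z) - (grad g (P z) \<bullet> n (P z)) *\<^sub>R n (P z)"
    unfolding S_def surf_grad_eq(1)[OF 2] 3 DP_boundary ..
  show "S z \<bullet> n (P z) = 0"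
    unfolding S_def surf_grad_eq(1)[OF 2] by (rule surf_grad_eq(2)[OF 2])
  show "(\<lambda>z. u (P z)) differentiable (at z)" "grad (\<lambda>z. u (P z)) z = DP z (grad g (P z))"
    if "z \<in> closure T"
    using grad_normal_extension[OF that V(1) PV V(3) g] by blast+
qed

lemma S_tangential: "S z \<bullet> n (P z) = 0"
  using local_extension_u[of z] surf_grad_u_local(4) by metis

text \<open>\<open>DP z\<close> annihilates the normal component of \<open>grad g\<close>, so the
  auxiliary extension of \<open>u\<close> disappears from the formula.\<close>

lemma extension_u:
  assumes z: "z \<in> closure T"
  shows "(u \<circ> P) differentiable (at z)" "grad (u \<circ> P) z = DP z (S z)"
proof -
  obtain V g where V: "open V" "P z \<in> V" "C2_on V g" "\<forall>y\<in>\<Gamma> \<inter> V. u y = g y"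
    using local_extension_u by blast
  note s = surf_grad_u_local[OF V(1,3,4,2)]
  show "(u \<circ> P) differentiable (at z)" using s(2)[OF z] by (simp add: o_def)
  show "grad (u \<circ> P) z = DP z (S z)"
    using s(3)[OF z] unfolding s(1) by (simp add: o_def DP_diff_scaleR DP_normal)
qed

lemma W_tangential: "W z \<bullet> n (P z) = 0"
  using L_tan proj_in S_tangential unfolding W_def by blast

lemma W_proj: "W (P z) = W z"
  by (simp add: W_def S_def proj_proj)

text \<open>With \<open>x\<close> fixed on \<Gamma> and \<open>q\<close> fixed, varying
  \<open>p\<close> stays inside the set on which \<open>L\<close> agrees with its ambient extension,
  so the \<open>p\<close>-gradient is a component of the full gradient of that extension.\<close>

lemma L_p_local:
  assumes V: "open V" "C2_on V g" "\<forall>y\<in>(\<Gamma> \<times> UNIV \<times> UNIV) \<inter> V. (\<lambda>(x, q, p). L x q p) y = g y"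
    and x: "x \<in> \<Gamma>" "(x, q, p) \<in> V"
  shows "L_p L x q p = snd (snd (grad g (x, q, p)))"
proof -
  have 1: "((\<lambda>p. (x, q, p)) has_derivative (\<lambda>h. (0, 0, h))) (at p)"
    by (auto intro!: has_derivative_Pair)
  have 2: "((\<lambda>p. g (x, q, p)) has_derivative (\<lambda>h. (0, 0, h) \<bullet> grad g (x, q, p))) (at p)"
    by (rule has_derivative_compose[OF 1 C2_on_grad(1)[OF V(2) x(2)]])
  have o: "open ((\<lambda>p. (x, q, p)) -` V)"
    by (intro continuous_open_vimage V(1) continuous_intros)
  have "(L x q has_derivative (\<lambda>h. (0, 0, h) \<bullet> grad g (x, q, p))) (at p)"
  proof (rule has_derivative_transform_within_open[OF 2 o])
    show "g (x, q, p') = L x q p'" if "p' \<in> (\<lambda>p. (x, q, p)) -` V" for p'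
      using bspec[OF V(3), of "(x, q, p')"] that x(1) by simp
  qed (use x in simp)
  then show ?thesis
    unfolding L_p_def by (intro grad_eqI) (simp add: inner_prod_def)
qed

text \<open>Locally \<open>W\<close> is the gradient of a C2 extension of \<open>L\<close> composed
  with a C1 map; the one derivative spent on \<open>u\<close> and the one spent on \<open>L\<close>
  are exactly what C2 can afford.\<close>

lemma C1_map_W: "C1_map T W"
proof (rule C1_map_local)
  fix z0 assume z0: "z0 \<in> T"
  obtain V g where V: "open V" "P z0 \<in> V" "C2_on V g" "\<forall>y\<in>\<Gamma> \<inter> V. u y = g y"
    using local_extension_u by blast
  have "(P z0, u (P z0), S z0) \<in> \<Gamma> \<times> UNIV \<times> UNIV" using proj_in by simp
  then obtain V2 g2 where V2: "open V2" "(P z0, u (P z0), S z0) \<in> V2" "C2_on V2 g2"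
    "\<forall>y\<in>(\<Gamma> \<times> UNIV \<times> UNIV) \<inter> V2. (\<lambda>(x, q, p). L x q p) y = g2 y"
    using L_C2 unfolding C2_on_subset_def by metis
  obtain W1 where W1: "open W1" "z0 \<in> W1" "W1 \<subseteq> T" "P ` W1 \<subseteq> V"
    using open_proj_neighborhood[OF z0 V(1,2)] by blast
  \<comment> \<open>An ambient C1 formula for (P z, u (P z), S z), with \<open>u\<close> replaced by
    its local extension \<open>g\<close> and the surface gradient by the tangential part of
    \<open>grad g\<close>.\<close>
  define yy where "yy z = (P z, g (P z), grad g (P z) - (grad g (P z) \<bullet> n z) *\<^sub>R n z)" for z
  have P1: "C1_map W1 P" by (rule C1_map_subset[OF C1_map_proj W1(3)])
  have n1: "C1_map W1 n" by (rule C1_map_subset[OF C1_map_normal W1(3)])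
  have gg: "C1_map V (grad g)" by (rule C2_on_grad(2)[OF V(3,1)])
  have "C1_map V g"
    by (rule C1_mapI[OF C2_on_grad(1)[OF V(3)]])
      (auto intro!: continuous_intros C1_map_continuous_on[OF gg])
  from C1_map_compose[OF P1 this W1(4)] C1_map_compose[OF P1 gg W1(4)]
  have yy1: "C1_map W1 yy"
    unfolding yy_def by (intro C1_map_Pair P1 C1_map_diff C1_map_scaleR C1_map_inner n1)
  have yy: "yy z = (P z, u (P z), S z)" if "z \<in> W1" for z
  proof -
    have "P z \<in> V" "z \<in> closure T" using that W1(3,4) tube_subset_closure by blast+
    then show ?thesis
      using surf_grad_u_local(1)[OF V(1,3,4)] bspec[OF V(4), of "P z"] proj_in[of z] normal_proj[of z]
      by (simp add: yy_def)
  qed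
  define W2 where "W2 = W1 \<inter> yy -` V2"
  have W2: "open W2" "z0 \<in> W2" "W2 \<subseteq> W1" "yy ` W2 \<subseteq> V2"
    using continuous_open_preimage[OF C1_map_continuous_on[OF yy1] W1(1) V2(1)] W1(2) V2(2) yy
    by (auto simp: W2_def)
  have "C1_map W2 (\<lambda>z. grad g2 (yy z))"
    by (rule C1_map_compose[OF C1_map_subset[OF yy1 W2(3)] C2_on_grad(2)[OF V2(3,1)] W2(4)])
  then have "C1_map W2 (\<lambda>z. snd (snd (grad g2 (yy z))))"
    by (intro C1_map_bounded_linear[OF bounded_linear_snd] C1_map_bounded_linear[OF bounded_linear_snd])
  then have "C1_map W2 W"
  proof (rule C1_map_cong[OF W2(1)])
    fix z assume z: "z \<in> W2"
    then have "yy z = (P z, u (P z), S z)" "yy z \<in> V2" using W2 yy by blast+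
    then show "snd (snd (grad g2 (yy z))) = W z"
      using L_p_local[OF V2(1,3,4) proj_in] unfolding W_def by simp
  qed
  then show "\<exists>V. open V \<and> z0 \<in> V \<and> C1_map V W" using W2 by blast
qed

text \<open>\<open>W\<close> is the normal extension of the surface flux, so the surface divergence
  in the Euler-Lagrange equation becomes an ambient trace evaluated at \<open>P z\<close>.\<close>

lemma L_q_eq_divergence:
  "L_q L (P z) (u (P z)) (S z) = (\<Sum>i\<in>UNIV. grad (\<lambda>y. W y $ i) (P z) $ i)"
proof -
  let ?w = "\<lambda>y. L_p L y (u y) (surf_grad \<Omega> u y)"
  have Ww: "(\<lambda>y. ?w (P y) $ i) = (\<lambda>y. W y $ i)" for i
    by (simp add: W_def S_def)
  have "surf_grad \<Omega> (\<lambda>y. ?w y $ i) (P z) = grad (\<lambda>y. W y $ i) (P z)" for i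
    using surf_grad_eq(1)[of "\<lambda>y. ?w y $ i" z] C1_map_differentiable[OF C1_map_nth[OF C1_map_W] proj_in_tube]
    unfolding Ww by blast
  then have "surf_div \<Omega> ?w (P z) = (\<Sum>i\<in>UNIV. grad (\<lambda>y. W y $ i) (P z) $ i)"
    by (simp add: surf_div_def)
  then show ?thesis
    using u_EL proj_in[of z] unfolding EL_surface_def S_def by force
qed

text \<open>On the tangent plane \<open>A\<close> inverts \<open>DP\<close>, and the gradient of the
  extension is \<open>DP z (S z)\<close>: the matrix \<open>A\<close> is designed to recover the
  surface gradient.\<close>

lemma Amat_grad_extension:
  assumes z: "z \<in> closure T"
  shows "Amat \<Omega> t\<^sub>1 t\<^sub>2 \<kappa>\<^sub>1 \<kappa>\<^sub>2 \<mu> z *v grad (u \<circ> P) z = S z"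
proof -
  have "DP z (S z) \<bullet> t\<^sub>1 (P z) = \<sigma>\<^sub>1 z * (S z \<bullet> t\<^sub>1 (P z))" "DP z (S z) \<bullet> t\<^sub>2 (P z) = \<sigma>\<^sub>2 z * (S z \<bullet> t\<^sub>2 (P z))"
    by (simp_all add: DP_def inner_add_left frame_inner[OF proj_in])
  then show ?thesis
    unfolding extension_u(2)[OF z] Amat_mult_vec[OF z] inner_DP_normal
    using sigma_bounds(1,2)[OF z] frame_expansion[OF proj_in[of z], of "S z"]
    by (simp add: S_tangential mult.assoc[symmetric])
qed

lemma ext_flux_eq:
  assumes z: "z \<in> closure T"
  shows "ext_flux \<Omega> t\<^sub>1 t\<^sub>2 \<kappa>\<^sub>1 \<kappa>\<^sub>2 \<mu> L (u \<circ> P) z =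
    (\<Sum>p\<in>UNIV. cross3 (n z) (W z) $ p *\<^sub>R cross3 (grad (\<lambda>y. P y $ p) z) (n z))"
proof -
  have "ext_flux \<Omega> t\<^sub>1 t\<^sub>2 \<kappa>\<^sub>1 \<kappa>\<^sub>2 \<mu> L (u \<circ> P) z =
      (\<sigma>\<^sub>1 z * \<sigma>\<^sub>2 z) *\<^sub>R (Amat \<Omega> t\<^sub>1 t\<^sub>2 \<kappa>\<^sub>1 \<kappa>\<^sub>2 \<mu> z *v W z)"
    by (simp only: ext_flux_def Amat_grad_extension[OF z] W_def Jfac_def comp_apply)
  moreover have "\<sigma>\<^sub>1 z * \<sigma>\<^sub>2 z * (inverse (\<sigma>\<^sub>1 z) * a) = \<sigma>\<^sub>2 z * a"
    "\<sigma>\<^sub>1 z * \<sigma>\<^sub>2 z * (inverse (\<sigma>\<^sub>2 z) * a) = \<sigma>\<^sub>1 z * a" for a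
    using sigma_bounds(1,2)[OF z] by simp_all
  ultimately show ?thesis
    unfolding flux_eq[OF z W_tangential] Amat_mult_vec[OF z]
    by (simp add: W_tangential scaleR_add_right)
qed

lemma ext_source_eq:
  assumes z: "z \<in> T"
  shows "ext_source \<Omega> t\<^sub>1 t\<^sub>2 \<kappa>\<^sub>1 \<kappa>\<^sub>2 \<mu> L (u \<circ> P) z =
    (\<Sum>p\<in>UNIV. grad (\<lambda>y. cross3 (n y) (W y) $ p) z \<bullet> cross3 (grad (\<lambda>y. P y $ p) z) (n z))"
  unfolding ext_source_def Amat_grad_extension[OF tube_subset_closure[OF z]]
    source_eq[OF z C1_map_W W_proj W_tangential] comp_apply L_q_eq_divergence Jfac_def ..

lemma EL_extended_extension: "EL_extended \<Omega> t\<^sub>1 t\<^sub>2 \<kappa>\<^sub>1 \<kappa>\<^sub>2 \<mu> L \<epsilon> (u \<circ> P)"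
proof -
  let ?F = "ext_flux \<Omega> t\<^sub>1 t\<^sub>2 \<kappa>\<^sub>1 \<kappa>\<^sub>2 \<mu> L (u \<circ> P)" and ?g = "ext_source \<Omega> t\<^sub>1 t\<^sub>2 \<kappa>\<^sub>1 \<kappa>\<^sub>2 \<mu> L (u \<circ> P)"
  have V: "C1_map T (\<lambda>y. cross3 (n y) (W y) $ p)" for p
    by (intro C1_map_nth C1_map_bounded_bilinear[OF bilinear_conv_bounded_bilinear[THEN iffD1, OF bilinear_cross]]
        C1_map_normal C1_map_W)
  have Pp: "C1_map T (\<lambda>y. P y $ p)" for p by (rule C1_map_nth[OF C1_map_proj])
  \<comment> \<open>The derivative of \<open>n\<close> is symmetric, which expresses that
    \<open>n\<close>, being a gradient, is curl free.\<close>
  have sym: "a \<bullet> Dn z b = b \<bullet> Dn z a" for a b z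
    by (simp add: Dn_def inner_add_right mult_ac inner_commute)
  have "has_weak_divergence_on
     (\<lambda>z. \<Sum>p\<in>UNIV. cross3 (n z) (W z) $ p *\<^sub>R cross3 (grad (\<lambda>y. P y $ p) z) (n z))
     (\<lambda>z. \<Sum>p\<in>UNIV. grad (\<lambda>y. cross3 (n y) (W y) $ p) z \<bullet> cross3 (grad (\<lambda>y. P y $ p) z) (n z)) T"
    by (intro has_weak_divergence_on_sum finite
        has_weak_divergence_on_cross[OF open_tube V Pp C1_map_normal normal_has_derivative sym])
  then have weak: "has_weak_divergence_on ?F ?g T"
    by (rule has_weak_divergence_on_cong) (simp_all add: ext_flux_eq tube_subset_closure ext_source_eq)
  \<comment> \<open>Continuity of the source is obtained from the cross product formula, in which
    only gradients of C1 functions occur. It is the hypothesis that makes the weak divergence agree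
    with the classical one at each point of differentiability.\<close>
  have "continuous_on T (\<lambda>z. \<Sum>p\<in>UNIV. grad (\<lambda>y. cross3 (n y) (W y) $ p) z \<bullet> cross3 (grad (\<lambda>y. P y $ p) z) (n z))"
    by (intro continuous_intros continuous_on_cross C1_map_continuous_on_grad V Pp
        C1_map_continuous_on[OF C1_map_normal])
  then have "continuous_on T ?g"
    by (rule continuous_on_eq) (simp add: ext_source_eq)
  then have "continuous (at z) ?g" if "z \<in> T" for z
    using that open_tube continuous_on_eq_continuous_at by blast
  then show ?thesis
    unfolding EL_extended_def
    using weak weak_divergence_eq_divergence[OF open_tube _ weak] by (intro exI[of _ ?g]) simp
qed

end

theorem theorem2p3:
  fixes \<Omega> :: "(real^3) set"
    and \<epsilon> \<mu> \<kappa>\<^sub>m :: real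
    and t\<^sub>1 t\<^sub>2 :: "real^3 \<Rightarrow> real^3"
    and \<kappa>\<^sub>1 \<kappa>\<^sub>2 :: "real^3 \<Rightarrow> real"
    and L :: "real^3 \<Rightarrow> real \<Rightarrow> real^3 \<Rightarrow> real"
    and u :: "real^3 \<Rightarrow> real"
  assumes "open \<Omega>" and "bounded \<Omega>" and "C2_boundary \<Omega>"
    and frame: "\<forall>x\<in>frontier \<Omega>. principal_frame \<Omega> x (t\<^sub>1 x) (t\<^sub>2 x) (\<kappa>\<^sub>1 x) (\<kappa>\<^sub>2 x)"
    and curv: "\<forall>x\<in>frontier \<Omega>. \<bar>\<kappa>\<^sub>1 x\<bar> \<le> \<kappa>\<^sub>m \<and> \<bar>\<kappa>\<^sub>2 x\<bar> \<le> \<kappa>\<^sub>m"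
    and "\<epsilon> > 0" and "\<epsilon> * \<kappa>\<^sub>m < 1"
    and proj_wd: "\<forall>z\<in>closure (tube \<Omega> \<epsilon>). has_unique_closest_point (frontier \<Omega>) z"
    and L_C2: "C2_on_subset (frontier \<Omega> \<times> UNIV \<times> UNIV) (\<lambda>(x, q, p). L x q p)"
    and L_tan: "\<forall>x\<in>frontier \<Omega>. \<forall>q t. t \<bullet> normal \<Omega> x = 0 \<longrightarrow> L_p L x q t \<bullet> normal \<Omega> x = 0"
    and u_C2: "C2_on_subset (frontier \<Omega>) u"
    and u_EL: "EL_surface \<Omega> L u"
  shows "(\<forall>z\<in>closure (tube \<Omega> \<epsilon>). (u \<circ> proj \<Omega>) differentiable (at z)) \<and>
         EL_extended \<Omega> t\<^sub>1 t\<^sub>2 \<kappa>\<^sub>1 \<kappa>\<^sub>2 \<mu> L \<epsilon> (u \<circ> proj \<Omega>) \<and>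
         (\<forall>z\<in>frontier (tube \<Omega> \<epsilon>). normal_deriv \<Omega> (u \<circ> proj \<Omega>) z = 0)"
proof -
  interpret surface_energy \<Omega> \<epsilon> \<kappa>\<^sub>m t\<^sub>1 t\<^sub>2 \<kappa>\<^sub>1 \<kappa>\<^sub>2 L u
    using assms by unfold_locales
  \<comment> \<open>The gradient of the extension is \<open>DP z (S z)\<close>, tangent at
    \<open>P z\<close>, while n z = n (P z); both facts hold up to the boundary of the tube.\<close>
  have "normal_deriv \<Omega> (u \<circ> proj \<Omega>) z = 0" if "z \<in> frontier (tube \<Omega> \<epsilon>)" for z
  proof -
    have z: "z \<in> closure (tube \<Omega> \<epsilon>)" using that by (simp add: frontier_def)
    show ?thesis
      using inner_DP_normal[of z "S z"]
      by (simp add: normal_deriv_def extension_u(2)[OF z] normal_proj[OF z] inner_commute)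
  qed
  then show ?thesis
    using extension_u(1) EL_extended_extension by blast
qed

end
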